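(* Fix $\Delta\in\mathbb{N}$. There is a constant $C=C(\Delta)>0$ such that the following holds. Let $G$ be a connected graph on $n$ vertices in which every vertex has even degree and the maximum degree is at most $\Delta$, and suppose $G$ is $\ell$-good. Then for every rule $\mathcal{A}$ (including rules chosen on-line by an adversary), the vertex cover time of the $E$-process on $G$ satisfies \[ C_G(E\text{-process}) \le C\left(n + \frac{n\log n}{\ell\,(1-\lambda_{\max})}\right). \]
   Context: $E$-process on a graph $G$: a walk which maintains a set of visited edges, initially empty. If the walk is at vertex $x$ and some edge incident with $x$ has not yet been traversed (an unvisited edge), it chooses one such edge according to a rule $\mathcal{A}$ (which may be arbitrary: random, deterministic, varying from vertex to vertex, or chosen on-line by an adversary depending on the history), moves along it and marks it visited. If all edges incident with $x$ are visited, it moves to a neighbour of $x$ chosen uniformly at random. Vertex cover time: $C_G=\max_{v}C_v$, where $C_v$ is the expected number of steps for the walk started at $v$ to visit every vertex of $G$. A vertex $v$ is $\ell$-good if every subgraph of $G$ in which all vertices have even degree and which contains all edges of $G$ incident with $v$ has at least $\ell$ vertices; $G$ is $\ell$-good if every vertex is $\ell$-good. Let $P$ be the transition matrix of the simple random walk on $G$ with eigenvalues $1=\lambda_1\ge\lambda_2\ge\dots\ge\lambda_n$; $\lambda_{\max}=\max(|\lambda_2|,|\lambda_n|)$ (the bound is vacuous if $\lambda_{\max}=1$). *)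

theory Defs
  imports "HOL-Probability.Probability" "Jordan_Normal_Form.Char_Poly"
begin

section \<open>Finite simple graphs on the vertex set \<open>{..<n}\<close>\<close>

definition simple_graph :: "nat \<Rightarrow> nat set set \<Rightarrow> bool" where
  "simple_graph n E \<longleftrightarrow> (\<forall>e\<in>E. e \<subseteq> {..<n} \<and> card e = 2)"

definition connected_graph :: "nat \<Rightarrow> nat set set \<Rightarrow> bool" where
  "connected_graph n E \<longleftrightarrow>
     0 < n \<and> (\<forall>u<n. \<forall>v<n. (u, v) \<in> {(x, y). {x, y} \<in> E}\<^sup>*)"

definition incident_edges :: "nat set set \<Rightarrow> nat \<Rightarrow> nat set set" where
  "incident_edges E v = {e \<in> E. v \<in> e}"

definition vertex_degree :: "nat set set \<Rightarrow> nat \<Rightarrow> nat" where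
  "vertex_degree E v = card (incident_edges E v)"

definition neighbours :: "nat set set \<Rightarrow> nat \<Rightarrow> nat set" where
  "neighbours E x = {y. {x, y} \<in> E}"

definition subgraph :: "nat set \<Rightarrow> nat set set \<Rightarrow> nat \<Rightarrow> nat set set \<Rightarrow> bool" where
  "subgraph W F n E \<longleftrightarrow> W \<subseteq> {..<n} \<and> F \<subseteq> E \<and> \<Union>F \<subseteq> W"

definition good_vertex :: "nat \<Rightarrow> nat set set \<Rightarrow> nat \<Rightarrow> nat \<Rightarrow> bool" where
  "good_vertex n E l v \<longleftrightarrow>
     (\<forall>W F. subgraph W F n E \<and> (\<forall>w\<in>W. even (vertex_degree F w)) \<and> incident_edges E v \<subseteq> F
        \<longrightarrow> l \<le> card W)"

definition good_graph :: "nat \<Rightarrow> nat set set \<Rightarrow> nat \<Rightarrow> bool" where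
  "good_graph n E l \<longleftrightarrow> (\<forall>v<n. good_vertex n E l v)"


section \<open>Spectrum of the simple random walk\<close>

definition transition_matrix :: "nat \<Rightarrow> nat set set \<Rightarrow> real mat" where
  "transition_matrix n E =
     mat n n (\<lambda>(i, j). if {i, j} \<in> E then 1 / real (vertex_degree E i) else 0)"

text \<open>
  \<open>walk_eigenvalue n E k\<close> is the \<open>k\<close>-th largest eigenvalue, counted with algebraic multiplicity,
  for \<open>1 \<le> k \<le> n\<close>. All roots of the characteristic polynomial are real, because the walk is
  reversible. If \<open>n = 1\<close> there is no second eigenvalue, and \<open>lambda_max\<close> is unspecified.
\<close>

definition walk_eigenvalue :: "nat \<Rightarrow> nat set set \<Rightarrow> nat \<Rightarrow> real" where
  "walk_eigenvalue n E k =
     rev (sorted_list_of_multiset (proots (char_poly (transition_matrix n E)))) ! (k - 1)"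

definition lambda_max :: "nat \<Rightarrow> nat set set \<Rightarrow> real" where
  "lambda_max n E = max \<bar>walk_eigenvalue n E 2\<bar> \<bar>walk_eigenvalue n E n\<bar>"


section \<open>The E-process\<close>

text \<open>
  A history is the nonempty list of the vertices occupied so far, the current vertex last; it
  determines the set of visited edges. As the graph is simple, an edge incident with the current
  vertex is identified with its other endpoint. A rule maps each history to a probability
  distribution on the unvisited edges at the current vertex; it is constrained only where such
  edges exist. Deterministic rules are the point masses.
\<close>

definition visited_edges :: "nat list \<Rightarrow> nat set set" where
  "visited_edges h = {{h ! i, h ! Suc i} | i. Suc i < length h}"

definition unvisited_neighbours :: "nat set set \<Rightarrow> nat list \<Rightarrow> nat set" where
  "unvisited_neighbours E h = {y. {last h, y} \<in> E - visited_edges h}"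

definition valid_rule :: "nat set set \<Rightarrow> (nat list \<Rightarrow> nat pmf) \<Rightarrow> bool" where
  "valid_rule E A \<longleftrightarrow>
     (\<forall>h. h \<noteq> [] \<and> unvisited_neighbours E h \<noteq> {} \<longrightarrow> set_pmf (A h) \<subseteq> unvisited_neighbours E h)"

text \<open>The walk stays put at an isolated vertex; in a connected graph this occurs only for \<open>n = 1\<close>.\<close>

definition eprocess_step :: "nat set set \<Rightarrow> (nat list \<Rightarrow> nat pmf) \<Rightarrow> nat list \<Rightarrow> nat pmf" where
  "eprocess_step E A h =
     (if unvisited_neighbours E h \<noteq> {} then A h
      else if neighbours E (last h) \<noteq> {} then pmf_of_set (neighbours E (last h))
      else return_pmf (last h))"

definition eprocess_kernel ::
    "nat set set \<Rightarrow> (nat list \<Rightarrow> nat pmf) \<Rightarrow> nat \<Rightarrow> nat \<Rightarrow> (nat \<Rightarrow> nat) \<Rightarrow> nat measure" where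
  "eprocess_kernel E A v t \<omega> =
     measure_pmf (if t = 0 then return_pmf v else eprocess_step E A (map \<omega> [0..<t]))"

text \<open>
  The law of the infinite trajectory started at \<open>v\<close>: position \<open>t\<close> is drawn from
  \<open>eprocess_kernel E A v t\<close> given the positions before time \<open>t\<close> (Ionescu-Tulcea extension).
\<close>

definition eprocess :: "nat set set \<Rightarrow> (nat list \<Rightarrow> nat pmf) \<Rightarrow> nat \<Rightarrow> (nat \<Rightarrow> nat) measure" where
  "eprocess E A v =
     projective_family.lim UNIV
       (Ionescu_Tulcea.CI (eprocess_kernel E A v) (\<lambda>_. count_space UNIV)) (\<lambda>_. count_space UNIV)"

lemma measurable_eprocess_kernel:
  "eprocess_kernel E A v t \<in>
     measurable (PiM {0..<t} (\<lambda>_. count_space UNIV)) (subprob_algebra (count_space UNIV))"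
proof -
  have "(\<lambda>\<omega>. map \<omega> [0..<s]) \<in> measurable (PiM {0..<t} (\<lambda>_. count_space (UNIV :: nat set))) (count_space UNIV)"
    if "s \<le> t" for s
    using that
  proof (induction s)
    case (Suc s)
    have [measurable]:
      "(\<lambda>\<omega>. map \<omega> [0..<s]) \<in> measurable (PiM {0..<t} (\<lambda>_. count_space (UNIV :: nat set))) (count_space UNIV)"
      using Suc by simp
    have [measurable]:
      "(\<lambda>\<omega>. \<omega> s) \<in> measurable (PiM {0..<t} (\<lambda>_. count_space (UNIV :: nat set))) (count_space UNIV)"
      using Suc.prems by (intro measurable_component_singleton) auto
    have "(\<lambda>\<omega>. map \<omega> [0..<s] @ [\<omega> s])
        \<in> measurable (PiM {0..<t} (\<lambda>_. count_space (UNIV :: nat set))) (count_space UNIV)"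
      by measurable
    then show ?case by simp
  qed simp
  then have "(\<lambda>\<omega>. map \<omega> [0..<t])
      \<in> measurable (PiM {0..<t} (\<lambda>_. count_space (UNIV :: nat set))) (count_space UNIV)"
    by simp
  then have "(\<lambda>h. measure_pmf (if t = 0 then return_pmf v else eprocess_step E A h))
      \<circ> (\<lambda>\<omega>. map \<omega> [0..<t])
      \<in> measurable (PiM {0..<t} (\<lambda>_. count_space UNIV)) (subprob_algebra (count_space UNIV))"
    by (rule measurable_comp) (auto simp: space_subprob_algebra
        intro: measure_pmf.subprob_space_axioms)
  then show ?thesis
    by (simp add: eprocess_kernel_def[abs_def] comp_def)
qed

lemma Ionescu_Tulcea_eprocess:
  "Ionescu_Tulcea (eprocess_kernel E A v) (\<lambda>_. count_space UNIV)"
proof (rule Ionescu_Tulcea.intro)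
  show "eprocess_kernel E A v t \<in>
      measurable (PiM {0..<t} (\<lambda>_. count_space UNIV)) (subprob_algebra (count_space UNIV))" for t
    by (rule measurable_eprocess_kernel)
  show "prob_space (eprocess_kernel E A v t \<omega>)" for t and \<omega> :: "nat \<Rightarrow> nat"
    unfolding eprocess_kernel_def by (rule measure_pmf.prob_space_axioms)
qed

lemma space_eprocess: "space (eprocess E A v) = UNIV"
proof -
  interpret Ionescu_Tulcea "eprocess_kernel E A v" "\<lambda>_. count_space UNIV"
    by (rule Ionescu_Tulcea_eprocess)
  show ?thesis
    by (simp add: eprocess_def space_PiM)
qed

lemma prob_space_eprocess: "prob_space (eprocess E A v)"
proof -
  interpret IT: Ionescu_Tulcea "eprocess_kernel E A v" "\<lambda>_. count_space UNIV"
    by (rule Ionescu_Tulcea_eprocess)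
  let ?M = "\<lambda>_ :: nat. count_space (UNIV :: nat set)"
  interpret C: prob_space "IT.CI {}"
    by (rule IT.PF.prob_space_P) auto
  have sets: "sets (IT.CI {}) = sets (PiM {} ?M)"
    by (simp add: IT.CI_def)
  have space: "space (IT.CI {}) = space (PiM {} ?M)"
    by (rule sets_eq_imp_space_eq[OF sets])
  have "emeasure IT.PF.lim (IT.PF.emb UNIV {} (space (PiM {} ?M))) = 1"
    using C.emeasure_space_1 by (subst IT.lim) (auto simp: space)
  moreover have "IT.PF.emb UNIV {} (space (PiM {} ?M)) = space IT.PF.lim"
    by (auto simp: prod_emb_def space_PiM)
  ultimately show ?thesis
    unfolding eprocess_def by (intro prob_spaceI) simp
qed


section \<open>Vertex cover time\<close>

text \<open>The infimum of the empty set is \<open>\<infinity>\<close>: trajectories that never cover have infinite cover time.\<close>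

definition cover_step :: "nat \<Rightarrow> (nat \<Rightarrow> nat) \<Rightarrow> ennreal" where
  "cover_step n \<omega> = (INF t \<in> {t. {..<n} \<subseteq> \<omega> ` {..t}}. of_nat t)"

definition expected_cover_time ::
    "nat \<Rightarrow> nat set set \<Rightarrow> (nat list \<Rightarrow> nat pmf) \<Rightarrow> nat \<Rightarrow> ennreal" where
  "expected_cover_time n E A v = (\<integral>\<^sup>+\<omega>. cover_step n \<omega> \<partial>eprocess E A v)"

definition cover_time :: "nat \<Rightarrow> nat set set \<Rightarrow> (nat list \<Rightarrow> nat pmf) \<Rightarrow> ennreal" where
  "cover_time n E A = Max (expected_cover_time n E A ` {..<n})"

lemma measurable_cover_step: "cover_step n \<in> borel_measurable (eprocess E A v)"
proof -
  interpret IT: Ionescu_Tulcea "eprocess_kernel E A v" "\<lambda>_. count_space UNIV"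
    by (rule Ionescu_Tulcea_eprocess)
  let ?M = "\<lambda>_ :: nat. count_space (UNIV :: nat set)"
  have [measurable]: "(\<lambda>\<omega>. \<omega> i) \<in> measurable (PiM UNIV ?M) (count_space UNIV)" for i
    by (rule measurable_component_singleton) simp
  have covered: "{..<n} \<subseteq> \<omega> ` {..t} \<longleftrightarrow> (\<forall>x\<in>{..<n}. \<exists>i\<in>{..t}. \<omega> i = x)" for \<omega> :: "nat \<Rightarrow> nat" and t
    unfolding subset_iff image_iff Ball_def Bex_def by metis
  have "cover_step n = (\<lambda>\<omega>. INF t. if \<forall>x\<in>{..<n}. \<exists>i\<in>{..t}. \<omega> i = x then of_nat t else top_class.top)"
  proof (intro ext antisym)
    fix \<omega> :: "nat \<Rightarrow> nat"
    show "cover_step n \<omega> \<le> (INF t. if \<forall>x\<in>{..<n}. \<exists>i\<in>{..t}. \<omega> i = x then of_nat t else top_class.top)"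
      unfolding cover_step_def covered by (intro INF_greatest) (simp add: INF_lower)
    show "(INF t. if \<forall>x\<in>{..<n}. \<exists>i\<in>{..t}. \<omega> i = x then of_nat t else top_class.top) \<le> cover_step n \<omega>"
      unfolding cover_step_def covered
    proof (rule INF_greatest)
      fix t assume "t \<in> {t. \<forall>x\<in>{..<n}. \<exists>i\<in>{..t}. \<omega> i = x}"
      then show "(INF t. if \<forall>x\<in>{..<n}. \<exists>i\<in>{..t}. \<omega> i = x then of_nat t else top_class.top)
          \<le> (of_nat t :: ennreal)"
        by (intro INF_lower2[of t]) auto
    qed
  qed
  also have "\<dots> \<in> borel_measurable (PiM UNIV ?M)"
    by measurable
  also have "borel_measurable (PiM UNIV ?M) = borel_measurable (eprocess E A v)"
    unfolding eprocess_def by (rule measurable_cong_sets) simp_all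
  finally show ?thesis .
qed

end

theory Submission
  imports Defs
begin

text \<open>
  Since all degrees are even, every maximal run of steps along unvisited edges returns to its starting
  vertex, its anchor. Deleting these runs leaves a simple random walk, the red walk, whatever the rule
  is. The runs contribute at most \<open>card E\<close> steps. If a vertex \<open>u\<close> is still unvisited after a run, then
  the component of \<open>u\<close> in the even graph of unvisited edges avoids all vertices from which red steps were
  made. As \<open>u\<close> is \<open>l\<close>-good, this component contains an induced path from \<open>u\<close> with \<open>m\<close> of order \<open>l\<close>
  edges: an even subgraph of radius \<open>D\<close> with all edges at \<open>u\<close> could be thinned to \<open>O(D)\<close> vertices.
  So it suffices to bound, over all induced paths \<open>p\<close> of this length, the sum of the probabilities that
  the red walk avoids \<open>p\<close> for time \<open>T\<close>.

  By the spectral gap \<open>\<gamma>\<close>, each such probability decays at rate \<open>\<gamma> * m / n\<close>, while the number of paths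
  with \<open>b\<close> branching vertices (degree at least 4) is at most exponential in \<open>b\<close>. This suffices if
  \<open>b = O(ln n)\<close>. For larger \<open>b\<close>, goodness of the neighbours of \<open>p\<close> yields of order \<open>b\<close> disjoint legs of
  length \<open>x\<close>, about \<open>m / ln n\<close>, attached to \<open>p\<close>. A function that vanishes on \<open>p\<close> and has little energy is
  small on the legs as well, so the rate improves to \<open>\<gamma> * b * x / n\<close>, provided that \<open>x\<^sup>2 * \<gamma>\<close> is bounded.
  The latter holds because the diameter is \<open>O(ln n / sqrt \<gamma>)\<close> and \<open>l\<close> is at most of the order of the
  diameter.
\<close>

section \<open>Even subgraphs through a vertex\<close>

text \<open>The obstacle is the union bound. There may be exponentially many paths with
  \<open>m\<close> edges, and paying for them with the basic rate alone would take time of order n /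
  \<gamma>, without the factor ln n / l. Only branching vertices offer a choice, so the entropy of
  \<open>p\<close> is about b * ln \<Delta>. In time of order n * ln n / (l * \<gamma>) a set of b
  legs of length x contributes about b * x * ln n / l to the exponent, which matches the entropy
  once x is of order l / ln n; this is the origin of the leg length. Against this, on legs of length
  x a function vanishing on \<open>p\<close> is only controlled up to x^2 times its energy, which
  does not spoil the rate as long as x is at most of order 1 / sqrt \<gamma>. The two demands are
  compatible precisely because l is O(ln n / sqrt \<gamma>).\<close>

definition adj_in :: "nat set set \<Rightarrow> nat set \<Rightarrow> (nat \<times> nat) set" where
  "adj_in E U = {(x, y). x \<in> U \<and> y \<in> U \<and> {x, y} \<in> E}"

lemma sym_adj_in: "sym (adj_in E U)"
  by (auto simp: adj_in_def sym_def insert_commute)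

lemma adj_in_iff: "(x, y) \<in> adj_in E U \<longleftrightarrow> x \<in> U \<and> y \<in> U \<and> {x, y} \<in> E"
  by (simp add: adj_in_def)

lemma relpow_sym:
  assumes "sym r" "(a, b) \<in> r ^^ k" shows "(b, a) \<in> r ^^ k"
  using assms(2)
proof (induction k arbitrary: a b)
  case (Suc k)
  then obtain c where "(a, c) \<in> r ^^ k" "(c, b) \<in> r" by auto
  then show ?case
    using Suc.IH assms(1) relpow_Suc_I2 by (metis symD)
qed auto

lemma relpow_trans: "(a, b) \<in> r ^^ i \<Longrightarrow> (b, c) \<in> r ^^ j \<Longrightarrow> (a, c) \<in> r ^^ (i + j)"
  by (auto simp: relpow_add)

lemma adj_in_rtrancl_mem: "(a, b) \<in> (adj_in E U)\<^sup>* \<Longrightarrow> a \<in> U \<Longrightarrow> b \<in> U"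
  by (induction rule: rtrancl_induct) (auto simp: adj_in_def)

lemma rtrancl_adj_in_sym: "(a, b) \<in> (adj_in E U)\<^sup>* \<Longrightarrow> (b, a) \<in> (adj_in E U)\<^sup>*"
  using sym_adj_in sym_rtrancl by (metis symD)

text \<open>On a geodesic, pigeonhole would place two vertices at distance more than \<open>2 * D\<close>
  near the same point of \<open>N\<close>.\<close>

lemma geodesic_bound:
  assumes "sym r" "finite N" "card N \<le> d"
    and near: "\<And>y. (a, y) \<in> r\<^sup>* \<Longrightarrow> \<exists>c\<in>N. \<exists>j\<le>D. (y, c) \<in> r ^^ j"
    and "(a, b) \<in> r\<^sup>*"
  shows "\<exists>k \<le> d * (2 * D + 1). (a, b) \<in> r ^^ k"
proof -
  define k where "k = (LEAST k. (a, b) \<in> r ^^ k)"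
  have ex: "\<exists>k. (a, b) \<in> r ^^ k" using assms(5) by (simp add: rtrancl_power)
  have k: "(a, b) \<in> r ^^ k" unfolding k_def using LeastI_ex[OF ex] .
  have min: "(a, b) \<in> r ^^ j \<Longrightarrow> k \<le> j" for j unfolding k_def by (rule Least_le)
  obtain f where f: "f 0 = a" "f k = b" "\<And>i. i < k \<Longrightarrow> (f i, f (Suc i)) \<in> r"
    using k by (auto simp: relpow_fun_conv)
  have seg: "i \<le> j \<Longrightarrow> j \<le> k \<Longrightarrow> (f i, f j) \<in> r ^^ (j - i)" for i j
    unfolding relpow_fun_conv
    by (rule exI[of _ "\<lambda>t. f (i + t)"]) (use f(3) in auto)
  have reach: "i \<le> k \<Longrightarrow> (a, f i) \<in> r\<^sup>*" for i
    using seg[of 0 i] f(1) by (auto simp: relpow_imp_rtrancl)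
  have "k \<le> d * (2 * D + 1)"
  proof (rule ccontr)
    assume big: "\<not> k \<le> d * (2 * D + 1)"
    define g where "g i = (SOME c. c \<in> N \<and> (\<exists>j\<le>D. (f (i * (2 * D + 1)), c) \<in> r ^^ j))" for i
    have pos: "i * (2 * D + 1) \<le> k" if "i \<le> d" for i
      using big that by (meson le_trans mult_le_mono1 nat_le_linear)
    have g: "g i \<in> N \<and> (\<exists>j\<le>D. (f (i * (2 * D + 1)), g i) \<in> r ^^ j)" if "i \<le> d" for i
      unfolding g_def by (rule someI_ex) (use near[OF reach[OF pos[OF that]]] in blast)
    have "card (g ` {..d}) \<le> card N" using g assms(2) by (intro card_mono) auto
    then have "\<not> inj_on g {..d}" using assms(3) card_image[of g "{..d}"] by auto
    then obtain i' j' where ij': "i' \<le> d" "j' \<le> d" "i' \<noteq> j'" "g i' = g j'"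
      by (auto simp: inj_on_def)
    define i where "i = min i' j'"
    define j where "j = max i' j'"
    have ij: "i < j" "j \<le> d" "g i = g j"
      using ij' by (auto simp: i_def j_def min_def max_def)
    obtain p q where p: "p \<le> D" "(f (i * (2 * D + 1)), g i) \<in> r ^^ p"
      and q: "q \<le> D" "(f (j * (2 * D + 1)), g i) \<in> r ^^ q"
      using g[of i] g[of j] ij by auto
    have "(f (i * (2 * D + 1)), f (j * (2 * D + 1))) \<in> r ^^ (p + q)"
      using p(2) relpow_sym[OF assms(1) q(2)] by (rule relpow_trans)
    then have "(a, b) \<in> r ^^ ((i * (2 * D + 1) + (p + q)) + (k - j * (2 * D + 1)))"
      using relpow_trans[OF relpow_trans[OF seg[of 0 "i * (2 * D + 1)"]] seg[of "j * (2 * D + 1)" k]]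
        pos[of i] pos[of j] ij f(1,2) by simp
    then have "k \<le> (i * (2 * D + 1) + (p + q)) + (k - j * (2 * D + 1))" by (rule min)
    moreover have "(i + 1) * (2 * D + 1) \<le> j * (2 * D + 1)"
      using ij(1) by (intro mult_le_mono1) simp
    moreover have "j * (2 * D + 1) \<le> k" using pos ij by auto
    ultimately show False using p(1) q(1) by simp
  qed
  then show ?thesis using k by blast
qed

section \<open>Parity of edge sets and joins of terminals\<close>

definition odd_vertices :: "nat set set \<Rightarrow> nat set" where
  "odd_vertices F = {w. odd (vertex_degree F w)}"

lemma even_card_sym_diff:
  assumes "finite A" "finite B"
  shows "even (card (sym_diff A B)) \<longleftrightarrow> even (card A + card B)"
proof -
  have "card (sym_diff A B) = card (A - B) + card (B - A)"
    using assms by (intro card_Un_disjoint) auto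
  moreover have "card A = card (A - B) + card (A \<inter> B)" "card B = card (B - A) + card (A \<inter> B)"
    using assms by (simp_all add: card_Diff_subset_Int Int_commute card_mono)
  ultimately show ?thesis by presburger
qed

text \<open>Over the two-element field \<open>odd_vertices\<close> is the boundary operator from
  edge sets to vertex sets; this is its additivity.\<close>

lemma odd_vertices_sym_diff:
  assumes "finite F" "finite G"
  shows "odd_vertices (sym_diff F G) = sym_diff (odd_vertices F) (odd_vertices G)"
proof -
  have *: "incident_edges (sym_diff F G) v = sym_diff (incident_edges F v) (incident_edges G v)" for v
    by (auto simp: incident_edges_def)
  have "finite (incident_edges F v)" "finite (incident_edges G v)" for v
    using assms by (auto simp: incident_edges_def)
  then have "even (vertex_degree (sym_diff F G) v) \<longleftrightarrow> even (vertex_degree F v + vertex_degree G v)" for v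
    unfolding vertex_degree_def * by (rule even_card_sym_diff)
  then show ?thesis unfolding odd_vertices_def by auto
qed

lemma odd_vertices_edge: "u \<noteq> v \<Longrightarrow> odd_vertices {{u, v}} = {u, v}"
proof -
  assume "u \<noteq> v"
  have "incident_edges {{u, v}} w = (if w \<in> {u, v} then {{u, v}} else {})" for w
    by (auto simp: incident_edges_def)
  then show ?thesis by (auto simp: odd_vertices_def vertex_degree_def split: if_splits)
qed

lemma odd_vertices_empty [simp]: "odd_vertices {} = {}"
  by (simp add: odd_vertices_def vertex_degree_def incident_edges_def)

text \<open>Double counting: an edge contributes \<open>card (e \<inter> C)\<close> to the degree
  sum, so modulo 2 only the edges leaving \<open>C\<close> count.\<close>

lemma handshake:
  assumes "finite F" "\<And>e. e \<in> F \<Longrightarrow> card e = 2" "finite C"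
  shows "even ((\<Sum>w\<in>C. vertex_degree F w) + card {e \<in> F. card (e \<inter> C) = 1})"
proof -
  have "(\<Sum>w\<in>C. vertex_degree F w) = (\<Sum>w\<in>C. \<Sum>e\<in>F. if w \<in> e then 1 else 0)"
    unfolding vertex_degree_def incident_edges_def using assms
    by (intro sum.cong) (auto simp: sum.If_cases Int_def)
  also have "\<dots> = (\<Sum>e\<in>F. \<Sum>w\<in>C. if w \<in> e then 1 else 0)"
    by (rule sum.swap)
  also have "\<dots> = (\<Sum>e\<in>F. card (e \<inter> C))"
    using assms by (intro sum.cong) (auto simp: sum.If_cases Int_def intro!: arg_cong[of _ _ card])
  finally have eq: "(\<Sum>w\<in>C. vertex_degree F w) = (\<Sum>e\<in>F. card (e \<inter> C))" .
  have "card (e \<inter> C) \<le> 2" if "e \<in> F" for e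
    using assms(2)[OF that] by (metis Int_lower1 card.infinite card_mono zero_neq_numeral)
  then have "even (card (e \<inter> C) + (if card (e \<inter> C) = 1 then 1 else 0))" if "e \<in> F" for e
    using that by (fastforce simp: le_Suc_eq numeral_2_eq_2)
  then have "even (\<Sum>e\<in>F. card (e \<inter> C) + (if card (e \<inter> C) = 1 then 1 else 0))"
    by (rule dvd_sum)
  moreover have "(\<Sum>e\<in>F. if card (e \<inter> C) = 1 then 1 else 0) = card {e \<in> F. card (e \<inter> C) = 1}"
    using assms by (simp add: sum.If_cases Int_def)
  ultimately show ?thesis unfolding eq by (simp add: sum.distrib)
qed

text \<open>The case \<open>n = 1\<close> is left to \<open>theorem1\<close>: there the only degree
  is 0 and \<open>lambda_max\<close> is unspecified. From \<open>n2\<close> and connectedness all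
  degrees are at least 2.\<close>

locale even_graph =
  fixes n :: nat and E :: "nat set set" and \<Delta> :: nat
  assumes simple: "simple_graph n E" and conn: "connected_graph n E"
    and even_deg: "\<And>v. v < n \<Longrightarrow> even (vertex_degree E v)"
    and deg_le: "\<And>v. v < n \<Longrightarrow> vertex_degree E v \<le> \<Delta>"
    and n2: "2 \<le> n"
begin

lemma edgeD: "{u, v} \<in> E \<Longrightarrow> u < n \<and> v < n \<and> u \<noteq> v"
  using simple unfolding simple_graph_def
  by (metis card_2_iff insert_subset lessThan_iff doubleton_eq_iff)

lemma card_edge: "e \<in> E \<Longrightarrow> card e = 2"
  using simple unfolding simple_graph_def by auto

lemma edgeE:
  assumes "e \<in> E" "v \<in> e" obtains u where "e = {v, u}" "u < n" "v < n" "u \<noteq> v"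
proof -
  obtain x y where xy: "e = {x, y}" using card_edge[OF assms(1)] by (auto simp: card_2_iff)
  with assms(2) have "v = x \<or> v = y" by auto
  then have "\<exists>u. e = {v, u}" using xy by (auto simp: insert_commute)
  then show ?thesis using that edgeD assms(1) by metis
qed

lemma finite_E: "finite E"
proof (rule finite_subset)
  show "E \<subseteq> Pow {..<n}" using simple unfolding simple_graph_def by auto
qed simp

lemma neighbours_subset: "neighbours E v \<subseteq> {..<n}"
  using edgeD by (auto simp: neighbours_def)

lemma finite_neighbours [simp]: "finite (neighbours E v)"
  using neighbours_subset finite_subset by blast

lemma incident_edges_conv: "F \<subseteq> E \<Longrightarrow> incident_edges F v = (\<lambda>y. {v, y}) ` neighbours F v"
  unfolding incident_edges_def neighbours_def by (auto elim: edgeE[rotated])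

lemma degree_conv: "F \<subseteq> E \<Longrightarrow> vertex_degree F v = card (neighbours F v)"
  unfolding vertex_degree_def incident_edges_conv
  by (rule card_image) (auto simp: inj_on_def doubleton_eq_iff)

lemma card_neighbours: "card (neighbours E v) = vertex_degree E v"
  using degree_conv[of E v] by simp

lemma neighbours_iff: "y \<in> neighbours E x \<longleftrightarrow> {x, y} \<in> E"
  by (simp add: neighbours_def)

lemma neighbours_sym: "y \<in> neighbours E x \<longleftrightarrow> x \<in> neighbours E y"
  by (simp add: neighbours_def insert_commute)

lemma degree_ge2: "v < n \<Longrightarrow> 2 \<le> vertex_degree E v"
proof -
  assume v: "v < n"
  define u where "u = (if v = 0 then 1 else 0 :: nat)"
  have u: "u < n" "u \<noteq> v" using n2 by (auto simp: u_def)
  have "(v, u) \<in> {(x, y). {x, y} \<in> E}\<^sup>*" using conn u v by (auto simp: connected_graph_def)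
  then obtain w where "{v, w} \<in> E" using u(2) by (cases rule: converse_rtranclE) auto
  then have "neighbours E v \<noteq> {}" by (auto simp: neighbours_def)
  then have "vertex_degree E v \<noteq> 0" by (simp add: card_neighbours[symmetric])
  then show ?thesis using even_deg[OF v] by presburger
qed

lemma Delta_ge2: "2 \<le> \<Delta>"
  using degree_ge2[of 0] deg_le[of 0] n2 by auto

text \<open>\<open>F\<close> is the sum modulo 2 of the edges along the walk: repeated edges cancel
  and only the two ends stay odd. Writing the odd set as a symmetric difference covers closed
  walks.\<close>

lemma walk_edges:
  assumes "(a, b) \<in> adj_in E U ^^ k"
  shows "\<exists>F. F \<subseteq> E \<and> \<Union>F \<subseteq> U \<and> card F \<le> k \<and> odd_vertices F = sym_diff {a} {b}"
  using assms
proof (induction k arbitrary: b)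
  case 0
  then show ?case by (intro exI[of _ "{}"]) auto
next
  case (Suc k)
  then obtain c where c: "(a, c) \<in> adj_in E U ^^ k" "(c, b) \<in> adj_in E U" by auto
  obtain F where F: "F \<subseteq> E" "\<Union>F \<subseteq> U" "card F \<le> k" "odd_vertices F = sym_diff {a} {c}"
    using Suc.IH[OF c(1)] by blast
  have cb: "{c, b} \<in> E" "c \<in> U" "b \<in> U" "c \<noteq> b"
    using c(2) edgeD by (auto simp: adj_in_def)
  have fin: "finite F" using F(1) finite_E finite_subset by blast
  have "odd_vertices (sym_diff F {{c, b}}) = sym_diff {a} {b}"
    using F(4) cb(4) fin by (subst odd_vertices_sym_diff) (auto simp: odd_vertices_edge)
  moreover have "card (sym_diff F {{c, b}}) \<le> Suc k"
  proof -
    have "card (sym_diff F {{c, b}}) \<le> card (insert {c, b} F)"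
      using fin by (intro card_mono) auto
    then show ?thesis using F(3) fin by (auto simp: card_insert_if split: if_splits)
  qed
  ultimately show ?case using F cb by (intro exI[of _ "sym_diff F {{c, b}}"]) auto
qed

text \<open>The construction of a \<open>T\<close>-join. Terminals of one class are paired off,
  which is possible because classes are even, and the joining walks are added modulo 2.\<close>

lemma join_edges:
  assumes "finite T" "T \<subseteq> U"
    and "\<And>a. a \<in> T \<Longrightarrow> even (card {b \<in> T. (a, b) \<in> (adj_in E U)\<^sup>*})"
    and "\<And>a b. a \<in> T \<Longrightarrow> b \<in> T \<Longrightarrow> (a, b) \<in> (adj_in E U)\<^sup>* \<Longrightarrow> \<exists>k\<le>L. (a, b) \<in> adj_in E U ^^ k"
  shows "\<exists>F. F \<subseteq> E \<and> \<Union>F \<subseteq> U \<and> card F \<le> card T * L \<and> odd_vertices F = T"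
  using assms
proof (induction "card T" arbitrary: T rule: less_induct)
  case less
  show ?case
  proof (cases "T = {}")
    case True
    then show ?thesis by (intro exI[of _ "{}"]) auto
  next
    case False
    then obtain a where a: "a \<in> T" by auto
    let ?r = "(adj_in E U)\<^sup>*"
    let ?C = "{b \<in> T. (a, b) \<in> ?r}"
    have aC: "a \<in> ?C" using a by simp
    have "?C \<noteq> {a}" using less.prems(3)[OF a] by (metis is_singletonI is_singleton_altdef odd_one)
    then obtain b where b: "b \<in> T" "(a, b) \<in> ?r" "b \<noteq> a" using aC by blast
    let ?T = "T - {a, b}"
    have card: "card T = card ?T + 2"
    proof -
      have "T = insert a (insert b ?T)" using a b by auto
      then have "card T = card (insert a (insert b ?T))" by simp
      also have "\<dots> = card ?T + 2" using b(3) less.prems(1) by simp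
      finally show ?thesis .
    qed
    have "even (card {d \<in> ?T. (c, d) \<in> ?r})" if c: "c \<in> ?T" for c
    proof (cases "(c, a) \<in> ?r")
      case True
      then have "(c, b) \<in> ?r" using b by auto
      then have "{d \<in> T. (c, d) \<in> ?r} = insert a (insert b {d \<in> ?T. (c, d) \<in> ?r})"
        using True a b by auto
      then have "card {d \<in> T. (c, d) \<in> ?r} = card {d \<in> ?T. (c, d) \<in> ?r} + 2"
        using b(3) less.prems(1) by simp
      then show ?thesis using less.prems(3)[of c] c by simp
    next
      case False
      then have "(c, b) \<notin> ?r" using rtrancl_trans rtrancl_adj_in_sym[OF b(2)] by metis
      then have "{d \<in> T. (c, d) \<in> ?r} = {d \<in> ?T. (c, d) \<in> ?r}" using False by auto
      then show ?thesis using less.prems(3)[of c] c by simp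
    qed
    then have "\<exists>F. F \<subseteq> E \<and> \<Union>F \<subseteq> U \<and> card F \<le> card ?T * L \<and> odd_vertices F = ?T"
      by (intro less.hyps) (use card less.prems in auto)
    then obtain F where F: "F \<subseteq> E" "\<Union>F \<subseteq> U" "card F \<le> card ?T * L" "odd_vertices F = ?T"
      by blast
    obtain k where k: "k \<le> L" "(a, b) \<in> adj_in E U ^^ k" using less.prems(4)[OF a b(1,2)] by auto
    obtain G where G: "G \<subseteq> E" "\<Union>G \<subseteq> U" "card G \<le> k" "odd_vertices G = sym_diff {a} {b}"
      using walk_edges[OF k(2)] by blast
    have fin: "finite F" "finite G" using F(1) G(1) finite_E finite_subset by blast+
    have "odd_vertices (sym_diff F G) = T"
      using F(4) G(4) b(3) a b fin by (subst odd_vertices_sym_diff) auto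
    moreover have "card (sym_diff F G) \<le> card T * L"
    proof -
      have "card (sym_diff F G) \<le> card (F \<union> G)" using fin by (intro card_mono) auto
      also have "\<dots> \<le> card ?T * L + L" using F(3) G(3) k(1) card_Un_le[of F G] by linarith
      also have "\<dots> \<le> card T * L" using card by simp
      finally show ?thesis .
    qed
    ultimately show ?thesis using F G by (intro exI[of _ "sym_diff F G"]) auto
  qed
qed

text \<open>The star of \<open>z\<close> has odd set \<open>neighbours E z\<close>. A join of these
  neighbours inside \<open>U - {z}\<close> cancels it, so the union is an even subgraph with all
  edges at \<open>z\<close>. By \<open>near\<close> and \<open>geodesic_bound\<close> the joining
  walks have length at most \<open>\<Delta> * (2 * D + 1)\<close>, so this subgraph is
  small.\<close>

lemma good_vertex_bound:
  assumes good: "good_vertex n E l z" and U: "U \<subseteq> {..<n}" "neighbours E z \<subseteq> U - {z}"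
    and z: "z < n"
    and near: "\<And>y. y \<in> U - {z} \<Longrightarrow> \<exists>c\<in>neighbours E z. \<exists>j\<le>D. (y, c) \<in> adj_in E (U - {z}) ^^ j"
    and ev: "\<And>a. a \<in> neighbours E z \<Longrightarrow>
      even (card {b \<in> neighbours E z. (a, b) \<in> (adj_in E (U - {z}))\<^sup>*})"
  shows "l \<le> 4 * \<Delta>\<^sup>2 * (D + 1)"
proof -
  let ?N = "neighbours E z" and ?L = "\<Delta> * (2 * D + 1)"
  have cardN: "card ?N \<le> \<Delta>" using deg_le[OF z] by (simp add: card_neighbours)
  have "\<exists>k\<le>?L. (a, b) \<in> adj_in E (U - {z}) ^^ k"
    if "a \<in> ?N" "(a, b) \<in> (adj_in E (U - {z}))\<^sup>*" for a b
  proof (rule geodesic_bound[OF sym_adj_in _ cardN near])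
    fix y assume "(a, y) \<in> (adj_in E (U - {z}))\<^sup>*"
    then show "y \<in> U - {z}"
      by (rule adj_in_rtrancl_mem) (use that(1) U(2) in blast)
  qed (simp_all add: that)
  then have "\<exists>F. F \<subseteq> E \<and> \<Union>F \<subseteq> U - {z} \<and> card F \<le> card ?N * ?L \<and> odd_vertices F = ?N"
    by (intro join_edges finite_neighbours U(2) ev)
  then obtain F where F: "F \<subseteq> E" "\<Union>F \<subseteq> U - {z}" "card F \<le> card ?N * ?L" "odd_vertices F = ?N"
    by blast
  define S where "S = incident_edges E z"
  have fin: "finite F" "finite S"
    using F(1) finite_E finite_subset by (auto simp: S_def incident_edges_def)
  have disj: "F \<inter> S = {}" using F(2) by (auto simp: S_def incident_edges_def)
  have SE: "S \<subseteq> E" by (auto simp: S_def incident_edges_def)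
  \<comment> \<open>In \<open>S\<close> the vertex \<open>z\<close> keeps its full degree, which is
    even, so only its neighbours are odd.\<close>
  have oddS: "odd_vertices S = ?N"
  proof -
    have "incident_edges S w = (if w = z then S else if w \<in> ?N then {{z, w}} else {})" for w
    proof -
      have "e = {z, w}" if "e \<in> E" "z \<in> e" "w \<in> e" "w \<noteq> z" for e
        using that edgeE[OF that(1,2)] by auto
      then have "{e \<in> S. w \<in> e} \<subseteq> {{z, w}}" if "w \<noteq> z"
        using that unfolding S_def incident_edges_def by blast
      moreover have "{z, w} \<in> S \<longleftrightarrow> w \<in> ?N"
        unfolding S_def incident_edges_def neighbours_iff by blast
      moreover have "{e \<in> S. z \<in> e} = S" unfolding S_def incident_edges_def by blast
      ultimately show ?thesis unfolding incident_edges_def by auto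
    qed
    then have "vertex_degree S w = (if w = z then vertex_degree E z else if w \<in> ?N then 1 else 0)" for w
      by (auto simp: vertex_degree_def S_def)
    then have "odd (vertex_degree S w) \<longleftrightarrow> w \<in> ?N" for w
      using even_deg[OF z] edgeD[of z z] by (auto simp: neighbours_iff)
    then show ?thesis by (auto simp: odd_vertices_def)
  qed
  have FS: "F \<union> S = sym_diff F S" using disj by auto
  have "odd_vertices (F \<union> S) = {}"
    unfolding FS using fin oddS F(4) by (subst odd_vertices_sym_diff) auto
  then have evn: "\<forall>w. even (vertex_degree (F \<union> S) w)" by (auto simp: odd_vertices_def)
  have "subgraph (\<Union>(F \<union> S)) (F \<union> S) n E"
    using F(1) SE simple by (auto simp: subgraph_def simple_graph_def)
  then have "l \<le> card (\<Union>(F \<union> S))"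
    using good evn unfolding good_vertex_def S_def by blast
  also have "\<dots> \<le> (\<Sum>e\<in>F \<union> S. card e)" by (rule card_Union_le_sum_card)
  also have "\<dots> = (\<Sum>e\<in>F \<union> S. 2)" using F(1) SE card_edge by (intro sum.cong) auto
  also have "\<dots> = 2 * card (F \<union> S)" by simp
  also have "\<dots> \<le> 2 * (\<Delta> * ?L + \<Delta>)"
  proof -
    have "card S \<le> \<Delta>" using deg_le[OF z] by (simp add: S_def vertex_degree_def)
    moreover have "card F \<le> \<Delta> * ?L" using F(3) cardN by (meson le_trans mult_le_mono1)
    ultimately have "card (F \<union> S) \<le> \<Delta> * ?L + \<Delta>"
      by (intro order_trans[OF card_Un_le] add_le_mono)
    then show ?thesis by (rule mult_le_mono2)
  qed
  also have "\<dots> \<le> 4 * \<Delta>\<^sup>2 * (D + 1)"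
  proof -
    have "\<Delta> \<le> \<Delta> * \<Delta>" by (rule le_square)
    then show ?thesis by (simp add: power2_eq_square algebra_simps)
  qed
  finally show ?thesis .
qed

section \<open>Unvisited paths and their legs\<close>

text \<open>Stop the walk just before its first visit to \<open>z\<close>.\<close>

lemma step_avoiding:
  assumes "(y, z) \<in> adj_in E U ^^ j" "y \<noteq> z"
  shows "\<exists>c\<in>neighbours E z. \<exists>i<j. (y, c) \<in> adj_in E (U - {z}) ^^ i"
  using assms
proof (induction j arbitrary: y)
  case (Suc j)
  from Suc.prems(1) obtain y1 where y1: "(y, y1) \<in> adj_in E U" "(y1, z) \<in> adj_in E U ^^ j"
    by (blast dest: relpow_Suc_D2)
  show ?case
  proof (cases "y1 = z")
    case True
    then have "y \<in> neighbours E z"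
      using y1(1) by (simp add: adj_in_iff neighbours_iff insert_commute)
    moreover have "(y, y) \<in> adj_in E (U - {z}) ^^ 0" by simp
    ultimately show ?thesis by blast
  next
    case False
    with Suc.IH[OF y1(2)] obtain c i where
      c: "c \<in> neighbours E z" "i < j" "(y1, c) \<in> adj_in E (U - {z}) ^^ i" by blast
    have "(y, y1) \<in> adj_in E (U - {z})" using y1(1) False Suc.prems(2) by (simp add: adj_in_iff)
    then have "(y, c) \<in> adj_in E (U - {z}) ^^ Suc i" using c(3) by (rule relpow_Suc_I2)
    then show ?thesis using c(1,2) by (meson Suc_mono)
  qed
qed simp

text \<open>Chords are excluded so that a vertex of degree at least 4 on the path has a neighbour
  off it, as used in \<open>branching_le_boundary\<close>.\<close>

definition induced_path :: "nat list \<Rightarrow> bool" where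
  "induced_path p \<longleftrightarrow> p \<noteq> [] \<and> distinct p \<and> set p \<subseteq> {..<n} \<and>
     (\<forall>i j. i < j \<and> j < length p \<longrightarrow> ({p ! i, p ! j} \<in> E \<longleftrightarrow> j = Suc i))"

lemma induced_path_edge: "induced_path p \<Longrightarrow> Suc i < length p \<Longrightarrow> {p ! i, p ! Suc i} \<in> E"
  unfolding induced_path_def by auto

text \<open>The list is an initial segment of a geodesic inside \<open>S\<close>. A repeated vertex
  would shorten it, and so would a chord, since an edge of \<open>E\<close> between vertices of
  \<open>S\<close> belongs to \<open>adj_in E S\<close>.\<close>

lemma geodesic_list:
  assumes "(v, y) \<in> (adj_in E S)\<^sup>*" "v \<in> S" "S \<subseteq> {..<n}"
    and far: "\<And>j. j < m \<Longrightarrow> (v, y) \<notin> adj_in E S ^^ j"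
  shows "\<exists>p. length p = Suc m \<and> hd p = v \<and> induced_path p \<and> set p \<subseteq> S"
proof -
  let ?r = "adj_in E S"
  define k where "k = (LEAST k. (v, y) \<in> ?r ^^ k)"
  have ex: "\<exists>k. (v, y) \<in> ?r ^^ k" using assms(1) by (simp add: rtrancl_power)
  have k: "(v, y) \<in> ?r ^^ k" unfolding k_def using LeastI_ex[OF ex] .
  have min: "(v, y) \<in> ?r ^^ j \<Longrightarrow> k \<le> j" for j unfolding k_def by (rule Least_le)
  have mk: "m \<le> k" using far k not_le by blast
  obtain f where f: "f 0 = v" "f k = y" "\<And>i. i < k \<Longrightarrow> (f i, f (Suc i)) \<in> ?r"
    using k by (auto simp: relpow_fun_conv)
  have seg: "i \<le> j \<Longrightarrow> j \<le> k \<Longrightarrow> (f i, f j) \<in> ?r ^^ (j - i)" for i j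
    unfolding relpow_fun_conv
    by (rule exI[of _ "\<lambda>t. f (i + t)"]) (use f(3) in auto)
  have inS: "i \<le> k \<Longrightarrow> f i \<in> S" for i
    using f(1) f(3)[of "i - 1"] assms(2) by (cases i) (auto simp: adj_in_iff)
  have short: "j \<le> i + t" if "i \<le> j" "j \<le> k" "(f i, f j) \<in> ?r ^^ t" for i j t
  proof -
    have "(v, y) \<in> ?r ^^ (i + t + (k - j))"
      using relpow_trans[OF relpow_trans[OF seg[of 0 i] that(3)] seg[of j k]] that f(1,2) by simp
    then show ?thesis using min that by fastforce
  qed
  have neq: "f i \<noteq> f j" if "i < j" "j \<le> k" for i j
    using short[of i j 0] that by auto
  have edge: "{f i, f j} \<in> E \<longleftrightarrow> j = Suc i" if "i < j" "j \<le> k" for i j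
  proof
    assume "{f i, f j} \<in> E"
    then have "(f i, f j) \<in> ?r ^^ 1" using inS that by (simp add: adj_in_iff)
    then show "j = Suc i" using short[of i j 1] that by auto
  qed (use f(3)[of i] that in \<open>auto simp: adj_in_iff\<close>)
  let ?p = "map f [0..<Suc m]"
  have nth: "i \<le> m \<Longrightarrow> ?p ! i = f i" for i by (simp del: upt_Suc)
  have "distinct ?p"
    unfolding distinct_map
  proof (intro conjI inj_onI)
    fix i j assume "i \<in> set [0..<Suc m]" "j \<in> set [0..<Suc m]" "f i = f j"
    then show "i = j" using neq[of i j] neq[of j i] mk by (cases i j rule: linorder_cases) auto
  qed simp
  moreover have "\<forall>i j. i < j \<and> j < length ?p \<longrightarrow> ({?p ! i, ?p ! j} \<in> E \<longleftrightarrow> j = Suc i)"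
    using edge mk nth by (simp del: upt_Suc add: less_Suc_eq_le)
  moreover have "set ?p \<subseteq> S" using inS mk by auto
  moreover have "hd ?p = v" using f(1) by (simp add: hd_map del: upt_Suc)
  ultimately have "length ?p = Suc m \<and> hd ?p = v \<and> induced_path ?p \<and> set ?p \<subseteq> S"
    using assms(3) unfolding induced_path_def by (auto simp del: upt_Suc)
  then show ?thesis by blast
qed

text \<open>By \<open>handshake\<close> an even number of edges of \<open>B\<close> leave
  \<open>C\<close>, and all of them end in \<open>z\<close>.\<close>

lemma class_parity:
  assumes "B \<subseteq> E" "finite C" "\<And>w. w \<in> C \<Longrightarrow> even (vertex_degree B w)" "z \<notin> C"
    and closed: "\<And>x y. x \<in> C \<Longrightarrow> {x, y} \<in> B \<Longrightarrow> y \<in> C \<or> y = z"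
  shows "even (card {b \<in> C. {z, b} \<in> B})"
proof -
  have fin: "finite B" using assms(1) finite_E finite_subset by blast
  have "even ((\<Sum>w\<in>C. vertex_degree B w) + card {e \<in> B. card (e \<inter> C) = 1})"
    using fin assms(1,2) card_edge by (intro handshake) auto
  moreover have "even (\<Sum>w\<in>C. vertex_degree B w)" using assms(3) by (rule dvd_sum)
  ultimately have "even (card {e \<in> B. card (e \<inter> C) = 1})" by simp
  moreover have "{e \<in> B. card (e \<inter> C) = 1} = (\<lambda>b. {z, b}) ` {b \<in> C. {z, b} \<in> B}"
  proof (intro equalityI subsetI)
    fix e assume "e \<in> {e \<in> B. card (e \<inter> C) = 1}"
    then have e: "e \<in> B" "card (e \<inter> C) = 1" by auto
    then obtain x where x: "e \<inter> C = {x}" by (auto simp: card_1_singleton_iff)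
    then obtain y where y: "e = {x, y}" "x \<noteq> y" using edgeE[of e x] e(1) assms(1) by auto
    then have "y \<notin> C" using x by auto
    then have "y = z" using closed[of x y] x y e(1) by auto
    then show "e \<in> (\<lambda>b. {z, b}) ` {b \<in> C. {z, b} \<in> B}"
      using x y e(1) by (auto simp: insert_commute)
  next
    fix e assume "e \<in> (\<lambda>b. {z, b}) ` {b \<in> C. {z, b} \<in> B}"
    then obtain b where b: "b \<in> C" "{z, b} \<in> B" "e = {z, b}" by auto
    then have "e \<inter> C = {b}" using assms(4) by auto
    then show "e \<in> {e \<in> B. card (e \<inter> C) = 1}" using b by simp
  qed
  moreover have "inj_on (\<lambda>b. {z, b}) {b \<in> C. {z, b} \<in> B}"
    by (auto simp: inj_on_def doubleton_eq_iff)
  ultimately show ?thesis by (simp add: card_image)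
qed

text \<open>Here \<open>S\<close> is the component of \<open>v\<close> in \<open>B\<close>, but
  distances are taken in the subgraph of \<open>E\<close> induced by \<open>S\<close>, so that
  geodesics are induced in \<open>E\<close>. If all of \<open>S\<close> were at distance below
  \<open>m\<close>, then \<open>good_vertex_bound\<close> would contradict \<open>m\<close>: a class
  of \<open>S - {v}\<close> is closed under \<open>B\<close> except for edges to \<open>v\<close>,
  so \<open>class_parity\<close> gives its evenness condition.\<close>

lemma blue_path:
  assumes B: "B \<subseteq> E" "\<And>w. even (vertex_degree B w)" "incident_edges E v \<subseteq> B"
    and v: "v < n" and good: "good_vertex n E l v" and m: "4 * \<Delta>\<^sup>2 * m < l"
  shows "\<exists>p. length p = Suc m \<and> hd p = v \<and> induced_path p \<and> (\<forall>u\<in>set p. u \<in> \<Union>B)"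
proof -
  define S where "S = {y. (v, y) \<in> {(a, b). {a, b} \<in> B}\<^sup>*}"
  have starB: "{v, b} \<in> E \<Longrightarrow> {v, b} \<in> B" for b using B(3) by (auto simp: incident_edges_def)
  have vS: "v \<in> S" by (simp add: S_def)
  have step: "x \<in> S \<Longrightarrow> {x, y} \<in> B \<Longrightarrow> y \<in> S" for x y
    unfolding S_def by (auto intro: rtrancl_into_rtrancl)
  have SB: "y \<in> \<Union>B" if "y \<in> S" for y
  proof -
    have "(v, y) \<in> {(a, b). {a, b} \<in> B}\<^sup>*" using that by (simp add: S_def)
    then show ?thesis
    proof (cases rule: rtranclE)
      case base
      have "card (neighbours E v) \<noteq> 0" using degree_ge2[OF v] by (simp add: card_neighbours)
      then obtain b where "b \<in> neighbours E v" by fastforce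
      then have "{v, b} \<in> B" using starB by (simp add: neighbours_iff)
      then show ?thesis using base by blast
    qed auto
  qed
  have Sn: "S \<subseteq> {..<n}" using SB B(1) simple by (force simp: simple_graph_def)
  have reach: "(v, y) \<in> (adj_in E S)\<^sup>*" if "y \<in> S" for y
  proof -
    have "(v, y) \<in> {(a, b). {a, b} \<in> B}\<^sup>*" using that by (simp add: S_def)
    then have "y \<in> S \<and> (v, y) \<in> (adj_in E S)\<^sup>*"
    proof (induction rule: rtrancl_induct)
      case (step a b)
      then have "b \<in> S" using \<open>\<And>x y. x \<in> S \<Longrightarrow> {x, y} \<in> B \<Longrightarrow> y \<in> S\<close> by auto
      then have "(a, b) \<in> adj_in E S" using step B(1) by (auto simp: adj_in_iff)
      then show ?case using step \<open>b \<in> S\<close> by (auto intro: rtrancl_into_rtrancl)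
    qed (simp add: vS)
    then show ?thesis ..
  qed
  have "\<exists>y\<in>S. \<forall>j<m. (v, y) \<notin> adj_in E S ^^ j"
  proof (rule ccontr)
    assume "\<not> (\<exists>y\<in>S. \<forall>j<m. (v, y) \<notin> adj_in E S ^^ j)"
    then have all: "\<And>y. y \<in> S \<Longrightarrow> \<exists>j<m. (v, y) \<in> adj_in E S ^^ j" by blast
    have m0: "0 < m" using all[OF vS] by auto
    have "l \<le> 4 * \<Delta>\<^sup>2 * ((m - 1) + 1)"
    proof (rule good_vertex_bound[OF good Sn _ v])
      show "neighbours E v \<subseteq> S - {v}"
        using step[OF vS starB] edgeD[of v v] by (auto simp: neighbours_iff)
    next
      fix y assume y: "y \<in> S - {v}"
      then obtain j where j: "j < m" "(v, y) \<in> adj_in E S ^^ j" using all by blast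
      have "(y, v) \<in> adj_in E S ^^ j" using relpow_sym[OF sym_adj_in j(2)] .
      then obtain c i where "c \<in> neighbours E v" "i < j" "(y, c) \<in> adj_in E (S - {v}) ^^ i"
        using step_avoiding[of y v j S] y by blast
      moreover then have "i \<le> m - 1" using j(1) by simp
      ultimately show "\<exists>c\<in>neighbours E v. \<exists>j\<le>m - 1. (y, c) \<in> adj_in E (S - {v}) ^^ j" by blast
    next
      fix a assume a: "a \<in> neighbours E v"
      let ?C = "{b. (a, b) \<in> (adj_in E (S - {v}))\<^sup>*}"
      have aS: "a \<in> S - {v}" using a step[OF vS starB] edgeD[of v v] by (auto simp: neighbours_iff)
      have C: "?C \<subseteq> S - {v}" using adj_in_rtrancl_mem[OF _ aS] by auto
      have "even (card {b \<in> ?C. {v, b} \<in> B})"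
      proof (rule class_parity[OF B(1)])
        show "finite ?C" using C Sn finite_subset by (metis Diff_subset finite_lessThan)
        show "v \<notin> ?C" using C by blast
        show "y \<in> ?C \<or> y = v" if xy: "x \<in> ?C" "{x, y} \<in> B" for x y
        proof (rule disjCI)
          assume "y \<noteq> v"
          moreover have "x \<in> S - {v}" "y \<in> S" using xy C step by blast+
          ultimately have "(x, y) \<in> adj_in E (S - {v})" using xy B(1) by (auto simp: adj_in_iff)
          then show "y \<in> ?C" using xy(1) by (auto intro: rtrancl_into_rtrancl)
        qed
      qed (rule B(2))
      moreover have "{b \<in> ?C. {v, b} \<in> B} = {b \<in> neighbours E v. (a, b) \<in> (adj_in E (S - {v}))\<^sup>*}"
        using starB B(1) by (auto simp: neighbours_iff)
      ultimately show "even (card {b \<in> neighbours E v. (a, b) \<in> (adj_in E (S - {v}))\<^sup>*})" by simp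
    qed
    then show False using m m0 by simp
  qed
  then obtain y where y: "y \<in> S" "\<And>j. j < m \<Longrightarrow> (v, y) \<notin> adj_in E S ^^ j" by blast
  obtain p where "length p = Suc m" "hd p = v" "induced_path p" "set p \<subseteq> S"
    using geodesic_list[OF reach[OF y(1)] vS Sn y(2)] by blast
  then show ?thesis using SB by blast
qed

section \<open>Disjoint legs attached to an induced path\<close>

definition path_boundary :: "nat list \<Rightarrow> nat set" where
  "path_boundary p = {z. z \<notin> set p \<and> (\<exists>w\<in>set p. {w, z} \<in> E)}"

text \<open>Walks from \<open>a\<close> in \<open>U - {z}\<close> never meet \<open>z'\<close>. In
  \<open>legs\<close> this carries a class over to \<open>U - {z'}\<close>, where two intersecting
  classes merge.\<close>

lemma class_avoiding:
  assumes "(a, b) \<in> (adj_in E (U - {z}))\<^sup>*" "(a, z') \<notin> (adj_in E (U - {z}))\<^sup>*"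
  shows "(a, b) \<in> (adj_in E (U - {z'}))\<^sup>*"
  using assms(1)
proof (induction rule: rtrancl_induct)
  case (step b c)
  have "b \<noteq> z'" "c \<noteq> z'"
    using step(1,2) assms(2) rtrancl_into_rtrancl[OF step(1,2)] by auto
  then have "(b, c) \<in> adj_in E (U - {z'})" using step(2) by (auto simp: adj_in_iff)
  then show ?case using step.IH by (rule rtrancl_into_rtrancl[rotated])
qed simp

lemma path_reach:
  assumes p: "induced_path p" "set p \<subseteq> U" and "a \<in> set p" "b \<in> set p"
  shows "\<exists>j < length p. (a, b) \<in> adj_in E U ^^ j"
proof -
  have seg: "(p ! i, p ! k) \<in> adj_in E U ^^ (k - i)" if "i \<le> k" "k < length p" for i k
    unfolding relpow_fun_conv
  proof (rule exI[of _ "\<lambda>t. p ! (i + t)"], intro conjI allI impI)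
    fix t assume t: "t < k - i"
    then have "{p ! (i + t), p ! Suc (i + t)} \<in> E" using induced_path_edge[OF p(1), of "i + t"] that by simp
    moreover have "p ! (i + t) \<in> U" "p ! Suc (i + t) \<in> U" using t that p(2) by (auto intro!: subsetD[OF p(2)])
    ultimately show "(p ! (i + t), p ! (i + Suc t)) \<in> adj_in E U" by (simp add: adj_in_iff)
  qed (use that in auto)
  obtain i k where ik: "i < length p" "a = p ! i" "k < length p" "b = p ! k"
    using assms(3,4) by (auto simp: in_set_conv_nth)
  show ?thesis
  proof (cases "i \<le> k")
    case True
    then show ?thesis using seg[of i k] ik by (intro exI[of _ "k - i"]) auto
  next
    case False
    then show ?thesis using relpow_sym[OF sym_adj_in seg[of k i]] ik
      by (intro exI[of _ "i - k"]) auto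
  qed
qed

text \<open>The class of \<open>a\<close> in the \<open>x\<close>-neighbourhood \<open>U\<close> of \<open>p\<close> without \<open>z\<close> receives an odd number of
  edges from \<open>z\<close>, so by parity it cannot be closed in the whole graph and must reach the rim of \<open>U\<close>.\<close>

lemma leg_exists:
  assumes p: "induced_path p" and len: "length p = Suc m" and x: "2 \<le> x"
    and l: "4 * \<Delta>\<^sup>2 * (x + m + 1) < l" and good: "good_graph n E l"
    and z: "z \<in> path_boundary p"
    and U: "U = {y. \<exists>w\<in>set p. \<exists>j\<le>x. (w, y) \<in> adj_in E UNIV ^^ j}"
  shows "\<exists>w qs a. w \<in> set p \<and> {w, z} \<in> E \<and> length qs = x \<and> hd qs = z \<and> induced_path qs \<and>
     a \<in> U - {z} \<and> {z, a} \<in> E \<and> set qs \<subseteq> insert z ((adj_in E (U - {z}))\<^sup>* `` {a}) \<and>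
     (adj_in E (U - {z}))\<^sup>* `` {a} \<inter> set p = {}"
proof -
  let ?r = "adj_in E UNIV" and ?R = "(adj_in E (U - {z}))\<^sup>*" and ?N = "neighbours E z"
  obtain w where w: "w \<in> set p" "{w, z} \<in> E" and zp: "z \<notin> set p"
    using z by (auto simp: path_boundary_def)
  have zn: "z < n" using edgeD[OF w(2)] by simp
  have wz: "(w, z) \<in> ?r" using w(2) by (simp add: adj_in_iff)
  have pU: "set p \<subseteq> U" unfolding U by (force intro: exI[of _ 0])
  have zU: "z \<in> U"
  proof -
    have "(w, z) \<in> ?r ^^ 1" using wz by simp
    then show ?thesis unfolding U using w(1) x by (intro CollectI bexI[of _ w] exI[of _ 1]) auto
  qed
  have NU: "?N \<subseteq> U - {z}"
  proof
    fix a assume a: "a \<in> ?N"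
    then have "(z, a) \<in> ?r" by (simp add: adj_in_iff neighbours_iff)
    with wz have "(w, a) \<in> ?r ^^ 2" by (auto simp: numeral_2_eq_2)
    then show "a \<in> U - {z}" unfolding U using w(1) x edgeD a
      by (auto simp: neighbours_iff intro!: bexI[of _ w] exI[of _ 2])
  qed
  have Un: "U \<subseteq> {..<n}"
  proof
    fix y assume "y \<in> U"
    then obtain u j where u: "u \<in> set p" "(u, y) \<in> ?r ^^ j" unfolding U by auto
    then show "y \<in> {..<n}"
      using p edgeD by (cases j) (auto simp: induced_path_def adj_in_iff)
  qed
  have closeU: "\<exists>u\<in>set p. \<exists>j\<le>x. (u, y) \<in> adj_in E U ^^ j" if "y \<in> U" for y
  proof -
    obtain u j where u: "u \<in> set p" "j \<le> x" "(u, y) \<in> ?r ^^ j" using \<open>y \<in> U\<close> unfolding U by auto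
    have "(u, y) \<in> adj_in E U ^^ j" using u(2,3)
    proof (induction j arbitrary: y)
      case (Suc j)
      then obtain y' where y': "(u, y') \<in> ?r ^^ j" "(y', y) \<in> ?r" by auto
      have "y' \<in> U" unfolding U using u(1) y'(1) Suc.prems(1)
        by (intro CollectI bexI[of _ u] exI[of _ j]) auto
      moreover have "y \<in> U" unfolding U using u(1) Suc.prems
        by (intro CollectI bexI[of _ u] exI[of _ "Suc j"] conjI)
      ultimately have "(y', y) \<in> adj_in E U" using y'(2) by (simp add: adj_in_iff)
      then show ?case using Suc.IH[OF _ y'(1)] Suc.prems(1) by auto
    qed simp
    then show ?thesis using u by blast
  qed
  have near: "\<exists>c\<in>?N. \<exists>j\<le>x + m. (y, c) \<in> adj_in E (U - {z}) ^^ j" if y: "y \<in> U - {z}" for y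
  proof -
    obtain u j where u: "u \<in> set p" "j \<le> x" "(u, y) \<in> adj_in E U ^^ j" using closeU y by blast
    obtain i where i: "i < length p" "(u, w) \<in> adj_in E U ^^ i" using path_reach[OF p pU u(1) w(1)] by blast
    have "(w, z) \<in> adj_in E U ^^ 1" using w zU pU by (auto simp: adj_in_iff)
    then have "(y, z) \<in> adj_in E U ^^ (j + i + 1)"
      using relpow_trans[OF relpow_trans[OF relpow_sym[OF sym_adj_in u(3)] i(2)]] by blast
    then obtain c k where c: "c \<in> ?N" "k < j + i + 1" "(y, c) \<in> adj_in E (U - {z}) ^^ k"
      using step_avoiding[of y z "j + i + 1" U] y by blast
    moreover have "k \<le> x + m" using c(2) u(2) i(1) len by simp
    ultimately show ?thesis by blast
  qed
  have sym: "(b, a) \<in> ?R" if "(a, b) \<in> ?R" for a b using that by (rule rtrancl_adj_in_sym)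
  have pconn: "(b, c) \<in> ?R" if "b \<in> set p" "c \<in> set p" for b c
    using path_reach[where U = "U - {z}", OF p _ that] pU zp by (auto dest: relpow_imp_rtrancl)
  \<comment> \<open>Otherwise the neighbours of \<open>z\<close> whose classes miss \<open>p\<close>
    split into even classes. The other neighbours all lie in the class of \<open>p\<close>, and
    their number is even because the degree of \<open>z\<close> is. Then
    \<open>good_vertex_bound\<close> with \<open>D = x + m\<close> contradicts
    \<open>l\<close>.\<close>
  have "\<exists>a\<in>?N. odd (card {b \<in> ?N. (a, b) \<in> ?R}) \<and> (\<forall>b\<in>set p. (a, b) \<notin> ?R)"
  proof (rule ccontr)
    assume "\<not> ?thesis"
    then have ev: "\<And>a. a \<in> ?N \<Longrightarrow> \<forall>b\<in>set p. (a, b) \<notin> ?R \<Longrightarrow> even (card {b \<in> ?N. (a, b) \<in> ?R})"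
      by blast
    define N' where "N' = {a \<in> ?N. \<forall>b\<in>set p. (a, b) \<notin> ?R}"
    have cls: "{b \<in> N'. (a, b) \<in> ?R} = {b \<in> ?N. (a, b) \<in> ?R}" if "a \<in> N'" for a
      using that unfolding N'_def by (auto intro: rtrancl_trans)
    have "even (card N')"
    proof (rule equiv_imp_dvd_card[where r = "{(a, b). a \<in> N' \<and> b \<in> N' \<and> (a, b) \<in> ?R}"])
      show "finite N'" unfolding N'_def by simp
      show "equiv N' {(a, b). a \<in> N' \<and> b \<in> N' \<and> (a, b) \<in> ?R}"
        by (rule equivI) (auto simp: refl_on_def sym_def trans_def intro: sym rtrancl_trans)
      fix X assume "X \<in> N' // {(a, b). a \<in> N' \<and> b \<in> N' \<and> (a, b) \<in> ?R}"
      then obtain a where a: "a \<in> N'" "X = {b \<in> N'. (a, b) \<in> ?R}" by (auto simp: quotient_def)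
      then show "even (card X)" using ev cls by (auto simp: N'_def)
    qed
    moreover have "even (card ?N)" using even_deg[OF zn] by (simp add: card_neighbours)
    moreover have "card ?N = card N' + card (?N - N')"
      by (simp add: N'_def card_Diff_subset card_mono)
    ultimately have evP: "even (card (?N - N'))" by simp
    have "even (card {b \<in> ?N. (a, b) \<in> ?R})" if a: "a \<in> ?N" for a
    proof (cases "a \<in> N'")
      case False
      then obtain u where u: "u \<in> set p" "(a, u) \<in> ?R" using a by (auto simp: N'_def)
      have "{b \<in> ?N. (a, b) \<in> ?R} = ?N - N'"
      proof (intro equalityI subsetI)
        fix b assume "b \<in> {b \<in> ?N. (a, b) \<in> ?R}"
        then show "b \<in> ?N - N'" using u sym unfolding N'_def by (blast intro: rtrancl_trans)
      next
        fix b assume "b \<in> ?N - N'"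
        then obtain t where t: "b \<in> ?N" "t \<in> set p" "(b, t) \<in> ?R" by (auto simp: N'_def)
        then show "b \<in> {b \<in> ?N. (a, b) \<in> ?R}"
          using rtrancl_trans[OF rtrancl_trans[OF u(2) pconn[OF u(1) t(2)]] sym[OF t(3)]] by simp
      qed
      then show ?thesis using evP by simp
    qed (use ev in \<open>auto simp: N'_def\<close>)
    then have "l \<le> 4 * \<Delta>\<^sup>2 * (x + m + 1)"
      using good zn unfolding good_graph_def by (intro good_vertex_bound[OF _ Un NU zn near]) auto
    then show False using l by simp
  qed
  then obtain a where a: "a \<in> ?N" "odd (card {b \<in> ?N. (a, b) \<in> ?R})" "\<And>b. b \<in> set p \<Longrightarrow> (a, b) \<notin> ?R"
    by blast
  let ?C = "?R `` {a}"
  have aU: "a \<in> U - {z}" using a(1) NU by auto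
  have CU: "?C \<subseteq> U - {z}" using adj_in_rtrancl_mem[OF _ aU] by auto
  have "\<exists>y\<in>?C. \<exists>y'. {y, y'} \<in> E \<and> y' \<notin> U"
  proof (rule ccontr)
    assume *: "\<not> ?thesis"
    have "even (card {b \<in> ?C. {z, b} \<in> E})"
    proof (rule class_parity[OF order_refl])
      show "finite ?C" using CU Un finite_subset by (metis Diff_subset finite_lessThan)
      show "z \<notin> ?C" using CU by blast
      show "even (vertex_degree E w)" if "w \<in> ?C" for w using that CU Un even_deg by blast
      show "y \<in> ?C \<or> y = z" if xy: "x \<in> ?C" "{x, y} \<in> E" for x y
      proof (rule disjCI)
        assume "y \<noteq> z"
        moreover have "y \<in> U" using * xy by blast
        moreover have "x \<in> U - {z}" using xy CU by blast
        ultimately have "(x, y) \<in> adj_in E (U - {z})" using xy by (simp add: adj_in_iff)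
        then show "y \<in> ?C" using xy(1) by (auto intro: rtrancl_into_rtrancl)
      qed
    qed
    moreover have "{b \<in> ?C. {z, b} \<in> E} = {b \<in> ?N. (a, b) \<in> ?R}" by (auto simp: neighbours_iff)
    ultimately show False using a(2) by simp
  qed
  then obtain y y' where y: "y \<in> ?C" "{y, y'} \<in> E" "y' \<notin> U" by blast
  let ?V = "insert z ?C"
  have "(a, y) \<in> (adj_in E ?V)\<^sup>*"
  proof -
    have "(a, y) \<in> ?R" using y(1) by simp
    then show ?thesis
    proof (induction rule: rtrancl_induct)
      case (step b c)
      then have "(a, c) \<in> ?R" by (rule_tac rtrancl_into_rtrancl)
      then have "(b, c) \<in> adj_in E ?V" using step by (auto simp: adj_in_iff)
      then show ?case using step.IH by (rule rtrancl_into_rtrancl[rotated])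
    qed simp
  qed
  moreover have "(z, a) \<in> adj_in E ?V" using a(1) by (simp add: adj_in_iff neighbours_iff)
  ultimately have zy: "(z, y) \<in> (adj_in E ?V)\<^sup>*" by (rule converse_rtrancl_into_rtrancl[rotated])
  \<comment> \<open>Prepending \<open>w\<close> and appending \<open>y'\<close> turns a walk of
    length \<open>j\<close> from \<open>z\<close> to \<open>y\<close> into one of length
    \<open>j + 2\<close> from \<open>p\<close> to \<open>y'\<close>; as \<open>y'\<close> is outside
    \<open>U\<close>, this length exceeds \<open>x\<close>.\<close>
  have "(z, y) \<notin> adj_in E ?V ^^ j" if j: "j < x - 1" for j
  proof
    assume "(z, y) \<in> adj_in E ?V ^^ j"
    then have "(z, y) \<in> ?r ^^ j"
      by (force simp: relpow_fun_conv adj_in_iff)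
    then have "(w, y') \<in> ?r ^^ (1 + j + 1)"
      using relpow_trans[OF relpow_trans[of w z 1 ?r y j], of y' 1] wz y(2) by (simp add: adj_in_iff)
    moreover have "1 + j + 1 \<le> x" using j by simp
    ultimately have "y' \<in> U" unfolding U using w(1)
      by (intro CollectI bexI[of _ w] exI[of _ "1 + j + 1"] conjI)
    then show False using y(3) by simp
  qed
  then obtain qs where "length qs = Suc (x - 1)" "hd qs = z" "induced_path qs" "set qs \<subseteq> ?V"
    using geodesic_list[OF zy, of "x - 1"] CU Un zn by blast
  moreover have "?C \<inter> set p = {}" using a(3) by auto
  ultimately show ?thesis using w aU a(1) x
    by (intro exI[of _ w] exI[of _ qs] exI[of _ a]) (simp add: neighbours_iff)
qed

text \<open>Each leg stays in the class supplied by \<open>leg_exists\<close>. The class of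
  \<open>z\<close> contains no other boundary vertex \<open>z'\<close>, because \<open>z'\<close> is
  adjacent to \<open>p\<close> and would bring a vertex of \<open>p\<close> into it. If the classes
  of \<open>z\<close> and \<open>z'\<close> met, the first would lie in \<open>U - {z'}\<close> and
  would put \<open>z\<close> into the second.\<close>

lemma legs:
  assumes p: "induced_path p" and len: "length p = Suc m" and x: "2 \<le> x"
    and l: "4 * \<Delta>\<^sup>2 * (x + m + 1) < l" and good: "good_graph n E l"
  shows "\<exists>q. (\<forall>z\<in>path_boundary p. q z 0 \<in> set p \<and> (\<forall>i<x. {q z i, q z (Suc i)} \<in> E)) \<and>
     inj_on (\<lambda>(z, i). q z i) (path_boundary p \<times> {1..x})"
proof -
  define U where "U = {y. \<exists>w\<in>set p. \<exists>j\<le>x. (w, y) \<in> adj_in E UNIV ^^ j}"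
  let ?R = "\<lambda>z. (adj_in E (U - {z}))\<^sup>*"
  have "\<forall>z\<in>path_boundary p. \<exists>t. case t of (w, qs, a) \<Rightarrow>
     w \<in> set p \<and> {w, z} \<in> E \<and> length qs = x \<and> hd qs = z \<and> induced_path qs \<and>
     a \<in> U - {z} \<and> {z, a} \<in> E \<and> set qs \<subseteq> insert z (?R z `` {a}) \<and> ?R z `` {a} \<inter> set p = {}"
    using leg_exists[OF p len x l good _ U_def] by simp
  from bchoice[OF this] obtain t where "\<forall>z\<in>path_boundary p. case t z of (w, qs, a) \<Rightarrow>
     w \<in> set p \<and> {w, z} \<in> E \<and> length qs = x \<and> hd qs = z \<and> induced_path qs \<and>
     a \<in> U - {z} \<and> {z, a} \<in> E \<and> set qs \<subseteq> insert z (?R z `` {a}) \<and> ?R z `` {a} \<inter> set p = {}" ..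
  note t = bspec[OF this]
  define w where "w z = fst (t z)" for z
  define Q where "Q z = fst (snd (t z))" for z
  define a where "a z = snd (snd (t z))" for z
  have T: "w z \<in> set p" "{w z, z} \<in> E" "length (Q z) = x" "hd (Q z) = z" "induced_path (Q z)"
     "a z \<in> U - {z}" "{z, a z} \<in> E" "set (Q z) \<subseteq> insert z (?R z `` {a z})" "?R z `` {a z} \<inter> set p = {}"
    if "z \<in> path_boundary p" for z
    using t[OF that] unfolding w_def Q_def a_def by (auto simp: case_prod_beta)
  have pU: "set p \<subseteq> U" unfolding U_def by (force intro: exI[of _ 0])
  have bU: "z \<in> U" if "z \<in> path_boundary p" for z
  proof -
    have "(w z, z) \<in> adj_in E UNIV ^^ 1" using T(2)[OF that] by (simp add: adj_in_iff)
    then show ?thesis unfolding U_def using T(1)[OF that] x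
      by (intro CollectI bexI[of _ "w z"] exI[of _ 1]) auto
  qed
  have notin: "z' \<notin> ?R z `` {a z}" if z: "z \<in> path_boundary p" "z' \<in> path_boundary p" "z \<noteq> z'" for z z'
  proof
    assume "z' \<in> ?R z `` {a z}"
    then have R: "(a z, z') \<in> ?R z" by simp
    have "z \<noteq> w z'" using T(1)[OF z(2)] z(1) by (auto simp: path_boundary_def)
    then have "(z', w z') \<in> adj_in E (U - {z})"
      using T(1,2)[OF z(2)] pU bU[OF z(2)] z(3) by (auto simp: adj_in_iff insert_commute)
    with R have "w z' \<in> ?R z `` {a z}" by (auto intro: rtrancl_into_rtrancl)
    then show False using T(9)[OF z(1)] T(1)[OF z(2)] by blast
  qed
  have disj: "insert z (?R z `` {a z}) \<inter> insert z' (?R z' `` {a z'}) = {}"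
    if z: "z \<in> path_boundary p" "z' \<in> path_boundary p" "z \<noteq> z'" for z z'
  proof -
    have "False" if b: "(a z, b) \<in> ?R z" "(a z', b) \<in> ?R z'" for b
    proof -
      have az: "(a z, z') \<notin> ?R z" using notin[OF z] by simp
      have "(a z, b) \<in> ?R z'" using b(1) az by (rule class_avoiding)
      then have "(a z', a z) \<in> ?R z'" using b(2) rtrancl_adj_in_sym by (meson rtrancl_trans)
      moreover have "a z \<noteq> z'" using az by auto
      then have "(a z, z) \<in> adj_in E (U - {z'})"
        using T(6,7)[OF z(1)] bU[OF z(1)] z(3) by (simp add: adj_in_iff insert_commute)
      ultimately have "z \<in> ?R z' `` {a z'}" by (auto intro: rtrancl_into_rtrancl)
      then show False using notin[OF z(2,1)] z(3) by blast
    qed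
    then show ?thesis using notin[OF z] notin[OF z(2,1)] z(3) by auto
  qed
  \<comment> \<open>Index 0 is the foot on \<open>p\<close>, where test functions vanish; the leg
    proper has indices 1 to \<open>x\<close>.\<close>
  define q where "q z i = (w z # Q z) ! i" for z i
  have mem: "q z i \<in> insert z (?R z `` {a z})" if "z \<in> path_boundary p" "i \<in> {1..x}" for z i
  proof -
    have "q z i \<in> set (Q z)" using that T(3)[OF that(1)] by (cases i) (auto simp: q_def)
    then show ?thesis using T(8)[OF that(1)] by blast
  qed
  have "inj_on (\<lambda>(z, i). q z i) (path_boundary p \<times> {1..x})"
  proof (rule inj_onI, clarify)
    fix z i z' j assume *: "z \<in> path_boundary p" "z' \<in> path_boundary p" "i \<in> {1..x}" "j \<in> {1..x}"
      "q z i = q z' j"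
    have zz: "z = z'"
    proof (rule ccontr)
      assume "z \<noteq> z'"
      from disj[OF *(1,2) this] mem[OF *(1,3)] mem[OF *(2,4)] *(5) show False by (metis IntI empty_iff)
    qed
    obtain i' j' where ij: "i = Suc i'" "j = Suc j'" using *(3,4) by (cases i; cases j) auto
    have "distinct (Q z)" using T(5)[OF *(1)] by (simp add: induced_path_def)
    then have "i' = j'"
      using *(3,4,5) ij T(3)[OF *(1)] zz by (simp add: q_def nth_eq_iff_index_eq)
    then show "z = z' \<and> i = j" using zz ij by simp
  qed
  moreover have "q z 0 \<in> set p \<and> (\<forall>i<x. {q z i, q z (Suc i)} \<in> E)" if z: "z \<in> path_boundary p" for z
  proof (intro conjI allI impI)
    show "q z 0 \<in> set p" using T(1)[OF z] by (simp add: q_def)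
    fix i assume i: "i < x"
    have Qne: "Q z \<noteq> []" using T(5)[OF z] by (simp add: induced_path_def)
    show "{q z i, q z (Suc i)} \<in> E"
    proof (cases i)
      case 0
      then show ?thesis using T(2,4)[OF z] Qne by (simp add: q_def hd_conv_nth)
    next
      case (Suc k)
      then show ?thesis using induced_path_edge[OF T(5)[OF z], of k] T(3)[OF z] i by (simp add: q_def)
    qed
  qed
  ultimately show ?thesis by (intro exI[of _ q]) blast
qed

section \<open>The Poincare inequality\<close>

abbreviation deg :: "nat \<Rightarrow> real" where "deg v \<equiv> real (vertex_degree E v)"

text \<open>This is the form of the transition operator in the degree-weighted inner product: the
  weight \<open>deg x\<close> cancels the factor \<open>1 / deg x\<close> of the walk.\<close>

definition adjform :: "(nat \<Rightarrow> real) \<Rightarrow> (nat \<Rightarrow> real) \<Rightarrow> real" where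
  "adjform f g = (\<Sum>x<n. \<Sum>y\<in>neighbours E x. f x * g y)"

definition wnorm :: "(nat \<Rightarrow> real) \<Rightarrow> real" where
  "wnorm f = (\<Sum>x<n. deg x * (f x)\<^sup>2)"

definition energy :: "(nat \<Rightarrow> real) \<Rightarrow> real" where
  "energy f = (\<Sum>x<n. \<Sum>y\<in>neighbours E x. (f x - f y)\<^sup>2) / 2"

definition total_degree :: real where "total_degree = (\<Sum>x<n. deg x)"

lemma deg_ge1: "x < n \<Longrightarrow> 1 \<le> deg x"
  using degree_ge2[of x] by simp

lemma total_degree_pos: "0 < total_degree"
  unfolding total_degree_def
proof (intro sum_pos)
  show "{..<n} \<noteq> {}" using n2 by (metis lessThan_iff empty_iff less_le_trans zero_less_numeral)
  show "0 < deg i" if "i \<in> {..<n}" for i using deg_ge1[of i] that by simp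
qed simp

lemma sum_neighbours_swap:
  fixes h :: "nat \<Rightarrow> nat \<Rightarrow> real"
  shows "(\<Sum>x<n. \<Sum>y\<in>neighbours E x. h x y) = (\<Sum>x<n. \<Sum>y\<in>neighbours E x. h y x)"
proof -
  have *: "(\<Sum>y\<in>neighbours E x. g y) = (\<Sum>y<n. if {x, y} \<in> E then g y else 0)" for x and g :: "nat \<Rightarrow> real"
    using neighbours_subset[of x]
    by (intro sum.mono_neutral_cong_left) (auto simp: neighbours_def)
  show ?thesis unfolding * by (subst sum.swap) (simp add: insert_commute)
qed

lemma sum_neighbours_const: "(\<Sum>y\<in>neighbours E x. c) = deg x * (c :: real)"
  by (simp add: card_neighbours)

lemma adjform_commute: "adjform f g = adjform g f"
  unfolding adjform_def by (subst sum_neighbours_swap) (simp add: mult.commute)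

lemma energy_conv: "energy f = wnorm f - adjform f f"
proof -
  have "(\<Sum>x<n. \<Sum>y\<in>neighbours E x. (f x - f y)\<^sup>2)
      = (\<Sum>x<n. \<Sum>y\<in>neighbours E x. (f x)\<^sup>2) + (\<Sum>x<n. \<Sum>y\<in>neighbours E x. (f y)\<^sup>2) - 2 * adjform f f"
    unfolding adjform_def
    by (simp add: power2_diff sum.distrib sum_subtractf sum_distrib_left mult.assoc)
  also have "(\<Sum>x<n. \<Sum>y\<in>neighbours E x. (f y)\<^sup>2) = (\<Sum>x<n. \<Sum>y\<in>neighbours E x. (f x)\<^sup>2)"
    by (rule sum_neighbours_swap)
  also have "(\<Sum>x<n. \<Sum>y\<in>neighbours E x. (f x)\<^sup>2) = wnorm f"
    unfolding wnorm_def sum_neighbours_const ..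
  finally show ?thesis by (simp add: energy_def)
qed

lemma energy_nonneg: "0 \<le> energy f"
  unfolding energy_def by (simp add: sum_nonneg)

lemma wnorm_nonneg: "0 \<le> wnorm f"
  unfolding wnorm_def by (intro sum_nonneg) auto

lemma wnorm_zero: "wnorm f = 0 \<Longrightarrow> x < n \<Longrightarrow> f x = 0"
proof -
  assume "wnorm f = 0" "x < n"
  then have "deg x * (f x)\<^sup>2 = 0"
    unfolding wnorm_def by (subst (asm) sum_nonneg_eq_0_iff) auto
  then show ?thesis using deg_ge1[OF \<open>x < n\<close>] by auto
qed

lemma energy_zero_const:
  assumes "energy f = 0" "u < n" "v < n" shows "f u = f v"
proof -
  have "(\<Sum>x<n. \<Sum>y\<in>neighbours E x. (f x - f y)\<^sup>2) = 0" using assms(1) by (simp add: energy_def)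
  then have "\<forall>x<n. (\<Sum>y\<in>neighbours E x. (f x - f y)\<^sup>2) = 0"
    by (subst (asm) sum_nonneg_eq_0_iff) (auto intro: sum_nonneg)
  then have *: "f x = f y" if "{x, y} \<in> E" for x y
  proof -
    have "(\<Sum>y\<in>neighbours E x. (f x - f y)\<^sup>2) = 0"
      using \<open>\<forall>x<n. _ x = 0\<close> edgeD[OF that] by blast
    then have "\<forall>y\<in>neighbours E x. (f x - f y)\<^sup>2 = 0"
      by (subst (asm) sum_nonneg_eq_0_iff) auto
    then show ?thesis using that by (auto simp: neighbours_iff)
  qed
  have "(u, v) \<in> {(x, y). {x, y} \<in> E}\<^sup>*" using conn assms by (auto simp: connected_graph_def)
  then show ?thesis by (induction rule: rtrancl_induct) (auto dest: *)
qed

lemma adjform_add_scale: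
  "adjform (\<lambda>x. f x + t * h x) (\<lambda>x. f x + t * h x)
     = adjform f f + 2 * t * adjform f h + t\<^sup>2 * adjform h h"
proof -
  have "adjform (\<lambda>x. f x + t * h x) (\<lambda>x. f x + t * h x)
     = adjform f f + t * adjform f h + t * adjform h f + t\<^sup>2 * adjform h h"
    unfolding adjform_def
    by (simp add: algebra_simps sum.distrib sum_distrib_left power2_eq_square)
  then show ?thesis using adjform_commute[of h f] by simp
qed

lemma wnorm_add_scale:
  "wnorm (\<lambda>x. f x + t * h x) = wnorm f + 2 * t * (\<Sum>x<n. deg x * f x * h x) + t\<^sup>2 * wnorm h"
  unfolding wnorm_def
  by (simp add: algebra_simps sum.distrib sum_distrib_left power2_eq_square)

lemma adjform_conv: "adjform f g = (\<Sum>x<n. f x * (\<Sum>y\<in>neighbours E x. g y))"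
  unfolding adjform_def by (simp add: sum_distrib_left)

text \<open>The first-order condition at an extremum: for small \<open>t\<close> of the right sign
  the linear term dominates.\<close>

lemma linear_coeff_zero:
  fixes b c :: real
  assumes "\<And>t. 0 \<le> 2 * t * b + t\<^sup>2 * c"
  shows "b = 0"
proof (rule ccontr)
  assume b: "b \<noteq> 0"
  define d where "d = \<bar>c\<bar> + 1"
  have d: "0 < d" "c \<le> d" "c < 2 * d" by (auto simp: d_def)
  have "0 \<le> 2 * (- b / d) * b + (- b / d)\<^sup>2 * c" by (rule assms)
  also have "\<dots> = b\<^sup>2 / d\<^sup>2 * (c - 2 * d)" using d by (simp add: field_simps power2_eq_square)
  also have "\<dots> < 0" using b d by (intro mult_pos_neg) auto
  finally show False by simp
qed

section \<open>Variational description of the second eigenvalue\<close>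

definition mean_zero :: "(nat \<Rightarrow> real) \<Rightarrow> bool" where
  "mean_zero f \<longleftrightarrow> (\<Sum>x<n. deg x * f x) = 0"

text \<open>Fixing the values outside \<open>{..<n}\<close> to 0 makes this a compact subset of the
  product space \<open>nat \<Rightarrow> real\<close>.\<close>

definition unit_sphere :: "(nat \<Rightarrow> real) set" where
  "unit_sphere = {f. (\<forall>i\<ge>n. f i = 0) \<and> wnorm f = 1 \<and> mean_zero f}"

lemma compact_unit_sphere: "compact unit_sphere"
proof -
  let ?B = "\<lambda>i. if i < n then {-1..1} else {0 :: real}"
  have "compactin (product_topology (\<lambda>i. euclidean) UNIV) (PiE UNIV ?B)"
    by (subst compactin_PiE) auto
  then have box: "compact (PiE UNIV ?B)" by (simp add: euclidean_product_topology)
  have cont: "continuous_on UNIV (\<lambda>f :: nat \<Rightarrow> real. f i)" for i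
    by (rule continuous_on_product_coordinates)
  have "closed {f. wnorm f = 1}" "closed {f. mean_zero f}"
    unfolding wnorm_def mean_zero_def
    by (intro closed_Collect_eq continuous_intros continuous_on_subset[OF cont] subset_UNIV)+
  then have "compact (PiE UNIV ?B \<inter> ({f. wnorm f = 1} \<inter> {f. mean_zero f}))"
    using box by (intro compact_Int_closed closed_Int)
  moreover have "PiE UNIV ?B \<inter> ({f. wnorm f = 1} \<inter> {f. mean_zero f}) = unit_sphere"
  proof -
    have "\<bar>f i\<bar> \<le> 1" if "wnorm f = 1" "i < n" for f i
    proof -
      have "deg i * (f i)\<^sup>2 \<le> wnorm f"
        unfolding wnorm_def using that(2) by (intro member_le_sum) auto
      moreover have "1 * (f i)\<^sup>2 \<le> deg i * (f i)\<^sup>2" using deg_ge1[OF that(2)] by (intro mult_right_mono) auto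
      ultimately have "(f i)\<^sup>2 \<le> 1" using that(1) by simp
      then show ?thesis by (simp add: abs_square_le_1)
    qed
    then show ?thesis unfolding unit_sphere_def by (force simp: PiE_def Pi_def abs_le_iff split: if_splits)
  qed
  ultimately show ?thesis by simp
qed

lemma maximal_rayleigh:
  assumes "unit_sphere \<noteq> {}"
  obtains f where "f \<in> unit_sphere" "\<And>g. g \<in> unit_sphere \<Longrightarrow> adjform g g \<le> adjform f f"
proof -
  have cont: "continuous_on UNIV (\<lambda>f :: nat \<Rightarrow> real. f i)" for i
    by (rule continuous_on_product_coordinates)
  have "continuous_on unit_sphere (\<lambda>f. adjform f f)"
    unfolding adjform_def
    by (intro continuous_intros continuous_on_subset[OF cont] subset_UNIV)
  from continuous_attains_sup[OF compact_unit_sphere assms this] show ?thesis using that by blast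
qed

lemma eigenvalue_transition_matrix:
  assumes "\<And>x. x < n \<Longrightarrow> (\<Sum>y\<in>neighbours E x. f y) = \<mu> * deg x * f x" "x0 < n" "f x0 \<noteq> 0"
  shows "poly (char_poly (transition_matrix n E)) \<mu> = 0"
proof -
  let ?A = "transition_matrix n E"
  have A: "?A \<in> carrier_mat n n" by (simp add: transition_matrix_def)
  have "eigenvector ?A (vec n f) \<mu>"
    unfolding eigenvector_def
  proof (intro conjI)
    show "vec n f \<in> carrier_vec (dim_row ?A)" using A by simp
    show "vec n f \<noteq> 0\<^sub>v (dim_row ?A)"
    proof
      assume "vec n f = 0\<^sub>v (dim_row ?A)"
      then have "vec_index (vec n f) x0 = vec_index (0\<^sub>v (dim_row ?A)) x0" by simp
      then show False using A assms(2,3) by simp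
    qed
    show "?A *\<^sub>v vec n f = \<mu> \<cdot>\<^sub>v vec n f"
    proof (rule eq_vecI)
      fix i assume "i < dim_vec (\<mu> \<cdot>\<^sub>v vec n f)"
      then have i: "i < n" by simp
      have "vec_index (?A *\<^sub>v vec n f) i = (\<Sum>j<n. (if {i, j} \<in> E then 1 / deg i else 0) * f j)"
        using i by (simp add: transition_matrix_def scalar_prod_def lessThan_atLeast0)
      also have "\<dots> = (\<Sum>j\<in>neighbours E i. f j / deg i)"
        using neighbours_subset[of i]
        by (intro sum.mono_neutral_cong_right) (auto simp: neighbours_iff)
      also have "\<dots> = \<mu> * f i"
        using assms(1)[OF i] deg_ge1[OF i] by (simp add: sum_divide_distrib[symmetric])
      finally show "vec_index (?A *\<^sub>v vec n f) i = vec_index (\<mu> \<cdot>\<^sub>v vec n f) i" using i by simp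
    qed (simp add: transition_matrix_def)
  qed
  then have "eigenvalue ?A \<mu>" by (auto simp: eigenvalue_def)
  then show ?thesis using eigenvalue_root_char_poly[OF A] by simp
qed

text \<open>The constant functions show that 1 is a root too. So \<open>\<mu>\<close> and 1 occupy
  different positions of the descending list; one of these positions is not the first, and the entry
  there is at least \<open>\<mu>\<close>.\<close>

lemma second_eigenvalue_ge:
  assumes "poly (char_poly (transition_matrix n E)) \<mu> = 0" "\<mu> < 1"
  shows "\<mu> \<le> walk_eigenvalue n E 2"
proof -
  let ?p = "char_poly (transition_matrix n E)"
  define L where "L = rev (sorted_list_of_multiset (proots ?p))"
  have "?p \<noteq> 0" using degree_monic_char_poly[of "transition_matrix n E" n]
    by (auto simp: transition_matrix_def)
  moreover have "poly ?p 1 = 0"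
    by (rule eigenvalue_transition_matrix[of "\<lambda>_. 1" _ 0]) (use n2 in \<open>auto simp: card_neighbours\<close>)
  ultimately have "\<mu> \<in> set L" "1 \<in> set L"
    using assms(1) by (auto simp: L_def)
  then obtain i j where ij: "i < length L" "L ! i = \<mu>" "j < length L" "L ! j = 1"
    by (auto simp: in_set_conv_nth)
  have "sorted_wrt (\<ge>) L" unfolding L_def by (simp add: sorted_wrt_rev)
  then have desc: "a \<le> b \<Longrightarrow> b < length L \<Longrightarrow> L ! b \<le> L ! a" for a b
    by (cases "a = b") (auto simp: sorted_wrt_iff_nth_less)
  have "i \<noteq> j" using ij assms(2) by auto
  have "\<mu> \<le> L ! 1"
  proof (cases "1 \<le> i")
    case True
    then show ?thesis using desc[of 1 i] ij by simp
  next
    case False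
    then have "1 \<le> j" using \<open>i \<noteq> j\<close> by auto
    then show ?thesis using desc[of 1 j] ij assms(2) by simp
  qed
  then show ?thesis by (simp add: walk_eigenvalue_def L_def)
qed

text \<open>Compactness gives a maximiser of the Rayleigh quotient on mean-zero functions. The first
  variation makes it an eigenvector, its eigenvalue is below 1 by connectedness, and hence is at
  most the second eigenvalue, which \<open>lambda_max\<close> dominates.\<close>

lemma poincare_mean_zero:
  assumes f: "mean_zero f"
  shows "(1 - lambda_max n E) * wnorm f \<le> energy f"
proof (cases "wnorm f = 0")
  case False
  have scale: "wnorm (\<lambda>x. c * g x) = c\<^sup>2 * wnorm g" "adjform (\<lambda>x. c * g x) (\<lambda>x. c * g x) = c\<^sup>2 * adjform g g" for c g
    unfolding wnorm_def adjform_def by (simp_all add: sum_distrib_left power2_eq_square algebra_simps)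
  have cong: "wnorm g = wnorm h" "adjform g g = adjform h h" "mean_zero g = mean_zero h"
    if "\<And>x. x < n \<Longrightarrow> g x = h x" for g h
  proof -
    have nb: "y \<in> neighbours E x \<Longrightarrow> g y = h y" for x y
      using that edgeD by (auto simp: neighbours_iff)
    show "wnorm g = wnorm h" "adjform g g = adjform h h" "mean_zero g = mean_zero h"
      unfolding wnorm_def adjform_def mean_zero_def using that nb
      by (auto intro!: sum.cong arg_cong[of _ _ "\<lambda>s. s = 0"])
  qed
  define nf where "nf g x = (if x < n then g x / sqrt (wnorm g) else 0)" for g :: "nat \<Rightarrow> real" and x
  have nf: "nf g \<in> unit_sphere" "adjform (nf g) (nf g) = adjform g g / wnorm g"
    if g: "wnorm g \<noteq> 0" "mean_zero g" for g
  proof -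
    have pos: "0 < wnorm g" using g(1) wnorm_nonneg[of g] by simp
    let ?h = "\<lambda>x. (1 / sqrt (wnorm g)) * g x"
    have eq: "x < n \<Longrightarrow> nf g x = ?h x" for x by (simp add: nf_def)
    have "mean_zero ?h" using g(2) unfolding mean_zero_def
      by (simp add: sum_divide_distrib[symmetric])
    moreover have "wnorm ?h = 1" unfolding scale using pos by (simp add: power_divide)
    ultimately show "nf g \<in> unit_sphere"
      using cong(1,3)[of "nf g" ?h] eq by (auto simp: unit_sphere_def nf_def)
    have "adjform (nf g) (nf g) = adjform ?h ?h" using cong(2)[of "nf g" ?h] eq by blast
    then show "adjform (nf g) (nf g) = adjform g g / wnorm g"
      unfolding scale using pos by (simp add: power_divide)
  qed
  obtain f0 where f0: "f0 \<in> unit_sphere" "\<And>g. g \<in> unit_sphere \<Longrightarrow> adjform g g \<le> adjform f0 f0"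
    using maximal_rayleigh nf(1)[OF False f] by blast
  define \<mu> where "\<mu> = adjform f0 f0"
  have f01: "wnorm f0 = 1" "mean_zero f0" using f0(1) by (auto simp: unit_sphere_def)
  have ray: "adjform g g \<le> \<mu> * wnorm g" if g: "mean_zero g" for g
  proof (cases "wnorm g = 0")
    case True
    then have "x < n \<Longrightarrow> g x = 0" for x by (rule wnorm_zero)
    then have "adjform g g = 0" by (simp add: adjform_def)
    then show ?thesis using True by simp
  next
    case False
    then have "0 < wnorm g" using wnorm_nonneg[of g] by simp
    then show ?thesis using f0(2)[OF nf(1)[OF False g]] nf(2)[OF False g]
      by (simp add: \<mu>_def field_simps)
  qed
  have crit: "adjform f0 h = \<mu> * (\<Sum>x<n. deg x * f0 x * h x)" if h: "mean_zero h" for h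
  proof -
    have "0 \<le> 2 * t * (\<mu> * (\<Sum>x<n. deg x * f0 x * h x) - adjform f0 h) + t\<^sup>2 * (\<mu> * wnorm h - adjform h h)" for t
    proof -
      have "mean_zero (\<lambda>x. f0 x + t * h x)"
        using h f01(2) unfolding mean_zero_def
        by (simp add: algebra_simps sum.distrib sum_distrib_left[symmetric])
      from ray[OF this] show ?thesis
        unfolding adjform_add_scale wnorm_add_scale using f01(1) by (simp add: \<mu>_def algebra_simps)
    qed
    from linear_coeff_zero[OF this] show ?thesis by simp
  qed
  \<comment> \<open>The residual of the eigenvalue equation has mean zero itself, so it may be
    inserted into \<open>crit\<close>, and this gives \<open>wnorm h = 0\<close>.\<close>
  define h where "h x = (\<Sum>y\<in>neighbours E x. f0 y) / deg x - \<mu> * f0 x" for x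
  have dh: "deg x * h x = (\<Sum>y\<in>neighbours E x. f0 y) - \<mu> * deg x * f0 x" if "x < n" for x
    using deg_ge1[OF that] by (simp add: h_def field_simps)
  have "mean_zero h"
  proof -
    have "(\<Sum>x<n. deg x * h x) = (\<Sum>x<n. \<Sum>y\<in>neighbours E x. f0 y) - \<mu> * (\<Sum>x<n. deg x * f0 x)"
      using dh by (simp add: sum_subtractf sum_distrib_left mult.assoc)
    also have "(\<Sum>x<n. \<Sum>y\<in>neighbours E x. f0 y) = (\<Sum>x<n. \<Sum>y\<in>neighbours E x. f0 x)"
      by (rule sum_neighbours_swap)
    also have "\<dots> = (\<Sum>x<n. deg x * f0 x)" by (simp add: card_neighbours)
    finally show ?thesis using f01(2) by (simp add: mean_zero_def)
  qed
  then have "(\<Sum>x<n. h x * (\<Sum>y\<in>neighbours E x. f0 y)) = (\<Sum>x<n. h x * (\<mu> * deg x * f0 x))"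
    using crit[of h] adjform_commute[of f0 h]
    by (simp add: adjform_conv[of h] sum_distrib_left algebra_simps)
  then have "(\<Sum>x<n. h x * (deg x * h x)) = 0"
    using dh by (simp add: right_diff_distrib sum_subtractf)
  then have "wnorm h = 0" by (simp add: wnorm_def power2_eq_square algebra_simps)
  then have "x < n \<Longrightarrow> h x = 0" for x by (rule wnorm_zero)
  then have eig: "x < n \<Longrightarrow> (\<Sum>y\<in>neighbours E x. f0 y) = \<mu> * deg x * f0 x" for x using dh by fastforce
  have "\<exists>x0<n. f0 x0 \<noteq> 0" using f01(1) by (auto simp: wnorm_def intro: ccontr)
  then obtain x0 where x0: "x0 < n" "f0 x0 \<noteq> 0" by blast
  \<comment> \<open>Connectedness enters here: zero energy would make \<open>f0\<close> a nonzero
    constant, whose mean is not 0.\<close>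
  have "energy f0 \<noteq> 0"
  proof
    assume "energy f0 = 0"
    then have "x < n \<Longrightarrow> f0 x = f0 x0" for x using energy_zero_const x0(1) by blast
    then have "(\<Sum>x<n. deg x * f0 x) = total_degree * f0 x0" by (simp add: total_degree_def sum_distrib_right)
    then show False using f01(2) x0(2) total_degree_pos by (simp add: mean_zero_def)
  qed
  then have "\<mu> < 1" using energy_nonneg[of f0] energy_conv[of f0] f01(1) by (simp add: \<mu>_def)
  then have "\<mu> \<le> lambda_max n E"
    using second_eigenvalue_ge[OF eigenvalue_transition_matrix[OF eig x0]] by (simp add: lambda_max_def)
  then have "\<mu> * wnorm f \<le> lambda_max n E * wnorm f"
    using wnorm_nonneg by (intro mult_right_mono) auto
  then show ?thesis using ray[OF f] by (simp add: energy_conv algebra_simps)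
qed (use energy_nonneg in simp)

lemma poincare:
  defines "a f \<equiv> (\<Sum>x<n. deg x * f x) / total_degree"
  shows "(1 - lambda_max n E) * wnorm (\<lambda>x. f x - a f) \<le> energy f"
proof -
  have "(\<Sum>x<n. deg x * (f x - a f)) = (\<Sum>x<n. deg x * f x) - total_degree * a f"
    by (simp add: right_diff_distrib sum_subtractf sum_distrib_right total_degree_def)
  then have "mean_zero (\<lambda>x. f x - a f)"
    using total_degree_pos by (simp add: mean_zero_def a_def)
  from poincare_mean_zero[OF this] show ?thesis by (simp add: energy_def)
qed

lemma lambda_max_nonneg: "0 \<le> lambda_max n E"
  unfolding lambda_max_def by simp

section \<open>Dirichlet eigenvalues\<close>

lemma wnorm_decomp:
  defines "a f \<equiv> (\<Sum>x<n. deg x * f x) / total_degree"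
  shows "wnorm f = wnorm (\<lambda>x. f x - a f) + total_degree * (a f)\<^sup>2"
proof -
  have S: "(\<Sum>x<n. deg x * f x) = total_degree * a f"
    using total_degree_pos by (simp add: a_def)
  have "wnorm (\<lambda>x. f x - a f) = (\<Sum>x<n. deg x * (f x)\<^sup>2 - 2 * a f * (deg x * f x) + (a f)\<^sup>2 * deg x)"
    unfolding wnorm_def by (intro sum.cong) (auto simp: power2_eq_square algebra_simps)
  also have "\<dots> = wnorm f - 2 * a f * (total_degree * a f) + (a f)\<^sup>2 * total_degree"
    by (simp add: sum.distrib sum_subtractf sum_distrib_left[symmetric] S wnorm_def total_degree_def)
  finally show ?thesis by (simp add: power2_eq_square algebra_simps)
qed

lemma sum_sq_le_wnorm: "Q \<subseteq> {..<n} \<Longrightarrow> (\<Sum>u\<in>Q. (f u)\<^sup>2) \<le> wnorm f"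
proof -
  assume Q: "Q \<subseteq> {..<n}"
  have "(\<Sum>u\<in>Q. (f u)\<^sup>2) \<le> (\<Sum>u<n. (f u)\<^sup>2)" using Q by (intro sum_mono2) auto
  also have "\<dots> \<le> wnorm f" unfolding wnorm_def
  proof (rule sum_mono)
    fix i assume "i \<in> {..<n}"
    then have "1 * (f i)\<^sup>2 \<le> deg i * (f i)\<^sup>2" using deg_ge1[of i] by (intro mult_right_mono) auto
    then show "(f i)\<^sup>2 \<le> deg i * (f i)\<^sup>2" by simp
  qed
  finally show ?thesis .
qed

lemma n_le_total_degree: "real n \<le> total_degree"
  unfolding total_degree_def using sum_mono[of "{..<n}" "\<lambda>_. 1" deg] deg_ge1 by simp

lemma total_degree_le: "total_degree \<le> real \<Delta> * real n"
  unfolding total_degree_def using sum_mono[of "{..<n}" deg "\<lambda>_. real \<Delta>"] deg_le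
  by (simp add: mult.commute)

text \<open>If \<open>f\<close> is small on \<open>Q\<close> then either its mean is small too, or it oscillates on \<open>Q\<close>.\<close>

lemma dirichlet_bound:
  defines "\<gamma> \<equiv> 1 - lambda_max n E"
  assumes \<gamma>: "0 < \<gamma>" and Q: "Q \<subseteq> {..<n}" and c: "0 \<le> c"
    and f: "(\<Sum>u\<in>Q. (f u)\<^sup>2) \<le> c * energy f"
  shows "\<gamma> * real (card Q) * wnorm f \<le> total_degree * (3 + 2 * \<gamma> * c) * energy f"
proof -
  define a where "a = (\<Sum>x<n. deg x * f x) / total_degree"
  define V where "V = wnorm (\<lambda>x. f x - a)"
  let ?e = "energy f" and ?q = "real (card Q)" and ?t = total_degree
  have V: "\<gamma> * V \<le> ?e" using poincare[of f] by (simp add: \<gamma>_def V_def a_def)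
  have W: "wnorm f = V + ?t * a\<^sup>2" using wnorm_decomp[of f] by (simp add: V_def a_def)
  have "?q * a\<^sup>2 = (\<Sum>u\<in>Q. a\<^sup>2)" by simp
  also have "\<dots> \<le> (\<Sum>u\<in>Q. 2 * (f u - a)\<^sup>2 + 2 * (f u)\<^sup>2)"
  proof (rule sum_mono)
    fix u
    have "0 \<le> (2 * f u - a)\<^sup>2" by simp
    then show "a\<^sup>2 \<le> 2 * (f u - a)\<^sup>2 + 2 * (f u)\<^sup>2" by (simp add: power2_eq_square algebra_simps)
  qed
  also have "\<dots> = 2 * (\<Sum>u\<in>Q. (f u - a)\<^sup>2) + 2 * (\<Sum>u\<in>Q. (f u)\<^sup>2)"
    by (simp add: sum.distrib sum_distrib_left)
  also have "\<dots> \<le> 2 * V + 2 * (c * ?e)"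
    using sum_sq_le_wnorm[OF Q, of "\<lambda>x. f x - a"] f by (simp add: V_def)
  finally have qa: "?q * a\<^sup>2 \<le> 2 * V + 2 * (c * ?e)" .
  have "card Q \<le> n" using card_mono[OF _ Q] by simp
  then have qt: "?q \<le> ?t" using n_le_total_degree by linarith
  have e0: "0 \<le> ?e" by (rule energy_nonneg)
  have "\<gamma> * ?q * wnorm f = ?q * (\<gamma> * V) + ?t * (\<gamma> * (?q * a\<^sup>2))"
    unfolding W by (simp add: algebra_simps)
  also have "\<dots> \<le> ?t * ?e + ?t * (\<gamma> * (2 * V + 2 * (c * ?e)))"
  proof (rule add_mono)
    have "?q * (\<gamma> * V) \<le> ?q * ?e" using V by (intro mult_left_mono) auto
    also have "\<dots> \<le> ?t * ?e" using qt e0 by (intro mult_right_mono)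
    finally show "?q * (\<gamma> * V) \<le> ?t * ?e" .
    show "?t * (\<gamma> * (?q * a\<^sup>2)) \<le> ?t * (\<gamma> * (2 * V + 2 * (c * ?e)))"
      using qa \<gamma> total_degree_pos by (intro mult_left_mono) auto
  qed
  also have "\<dots> \<le> ?t * ?e + ?t * (2 * ?e + 2 * \<gamma> * c * ?e)"
    using V total_degree_pos by (intro add_left_mono mult_left_mono) (auto simp: algebra_simps)
  finally show ?thesis by (simp add: algebra_simps)
qed

text \<open>Cauchy-Schwarz along a leg, starting from the zero at its foot, bounds each squared
  value by \<open>x\<close> times the sum of squared increments; summing over the positions gives
  the second factor \<open>x\<close>. The leg vertices are distinct, so all increments together are
  at most the ordered edge sum, which is twice the energy.\<close>

lemma legs_energy:
  assumes q0: "\<And>z. z \<in> Z \<Longrightarrow> f (q z 0) = 0"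
    and edge: "\<And>z i. z \<in> Z \<Longrightarrow> i < x \<Longrightarrow> {q z i, q z (Suc i)} \<in> E"
    and inj: "inj_on (\<lambda>(z, i). q z i) (Z \<times> {1..x})" and "finite Z"
  shows "(\<Sum>u\<in>(\<lambda>(z, i). q z i) ` (Z \<times> {1..x}). (f u)\<^sup>2) \<le> 2 * (real x)\<^sup>2 * energy f"
proof -
  let ?g = "\<lambda>z i. (f (q z i) - f (q z (i - 1)))\<^sup>2"
  have leg: "(f (q z i))\<^sup>2 \<le> real x * (\<Sum>j\<in>{1..x}. ?g z j)" if z: "z \<in> Z" and i: "i \<in> {1..x}" for z i
  proof -
    have "f (q z i) = (\<Sum>j\<in>{1..i}. f (q z j) - f (q z (j - 1)))"
      using sum_telescope''[of 0 i "\<lambda>j. f (q z j)"] q0[OF z] by simp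
    then have "(f (q z i))\<^sup>2 \<le> (\<Sum>j\<in>{1..i}. ?g z j) * real (card {1..i})"
      using sum_squared_le_sum_of_squares[of "\<lambda>j. f (q z j) - f (q z (j - 1))" "{1..i}"] by simp
    also have "\<dots> \<le> (\<Sum>j\<in>{1..x}. ?g z j) * real x"
      using i by (intro mult_mono sum_mono2 sum_nonneg) auto
    finally show ?thesis by (simp add: mult.commute)
  qed
  let ?Q = "(\<lambda>(z, i). q z i) ` (Z \<times> {1..x})"
  have Qn: "?Q \<subseteq> {..<n}"
  proof clarsimp
    fix z i assume "z \<in> Z" "Suc 0 \<le> i" "i \<le> x"
    then have "{q z (i - 1), q z i} \<in> E" using edge[of z "i - 1"] by simp
    then show "q z i < n" using edgeD by blast
  qed
  have "(\<Sum>u\<in>?Q. (f u)\<^sup>2) = (\<Sum>(z, i)\<in>Z \<times> {1..x}. (f (q z i))\<^sup>2)"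
    by (subst sum.reindex[OF inj]) (simp add: case_prod_beta comp_def)
  also have "\<dots> = (\<Sum>z\<in>Z. \<Sum>i\<in>{1..x}. (f (q z i))\<^sup>2)" by (rule sum.cartesian_product[symmetric])
  also have "\<dots> \<le> (\<Sum>z\<in>Z. \<Sum>i\<in>{1..x}. real x * (\<Sum>j\<in>{1..x}. ?g z j))"
    using leg by (intro sum_mono)
  also have "\<dots> = (real x)\<^sup>2 * (\<Sum>z\<in>Z. \<Sum>j\<in>{1..x}. ?g z j)"
    by (simp add: sum_distrib_left power2_eq_square mult.assoc)
  also have "\<dots> \<le> (real x)\<^sup>2 * (2 * energy f)"
  proof (rule mult_left_mono)
    have "(\<Sum>z\<in>Z. \<Sum>j\<in>{1..x}. ?g z j) \<le> (\<Sum>z\<in>Z. \<Sum>j\<in>{1..x}. \<Sum>y\<in>neighbours E (q z j). (f (q z j) - f y)\<^sup>2)"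
    proof (intro sum_mono)
      fix z j assume zj: "z \<in> Z" "j \<in> {1..x}"
      then have "j - 1 < x" "Suc (j - 1) = j" by auto
      then have "q z (j - 1) \<in> neighbours E (q z j)"
        using edge[OF zj(1), of "j - 1"] by (simp add: neighbours_iff insert_commute)
      then show "?g z j \<le> (\<Sum>y\<in>neighbours E (q z j). (f (q z j) - f y)\<^sup>2)"
        by (rule member_le_sum) auto
    qed
    also have "\<dots> = (\<Sum>(z, j)\<in>Z \<times> {1..x}. \<Sum>y\<in>neighbours E (q z j). (f (q z j) - f y)\<^sup>2)"
      by (rule sum.cartesian_product)
    also have "\<dots> = (\<Sum>u\<in>?Q. \<Sum>y\<in>neighbours E u. (f u - f y)\<^sup>2)"
      by (subst sum.reindex[OF inj]) (simp add: case_prod_beta comp_def)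
    also have "\<dots> \<le> (\<Sum>u<n. \<Sum>y\<in>neighbours E u. (f u - f y)\<^sup>2)"
      using Qn by (intro sum_mono2) (auto intro: sum_nonneg)
    finally show "(\<Sum>z\<in>Z. \<Sum>j\<in>{1..x}. ?g z j) \<le> 2 * energy f" by (simp add: energy_def)
  qed simp
  finally show ?thesis by (simp add: mult_ac)
qed

section \<open>Diameter\<close>

definition graph_dist :: "nat \<Rightarrow> nat \<Rightarrow> nat" where
  "graph_dist u v = (LEAST j. (u, v) \<in> adj_in E {..<n} ^^ j)"

lemma reachable: "u < n \<Longrightarrow> v < n \<Longrightarrow> (u, v) \<in> (adj_in E {..<n})\<^sup>*"
proof -
  assume uv: "u < n" "v < n"
  have "(u, v) \<in> {(x, y). {x, y} \<in> E}\<^sup>*" using conn uv by (auto simp: connected_graph_def)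
  moreover have "{(x, y). {x, y} \<in> E} = adj_in E {..<n}" using edgeD by (auto simp: adj_in_def)
  ultimately show ?thesis by simp
qed

lemma graph_dist_relpow: "u < n \<Longrightarrow> v < n \<Longrightarrow> (u, v) \<in> adj_in E {..<n} ^^ graph_dist u v"
proof -
  assume "u < n" "v < n"
  then have "\<exists>j. (u, v) \<in> adj_in E {..<n} ^^ j" using reachable by (simp add: rtrancl_power)
  from LeastI_ex[OF this] show ?thesis unfolding graph_dist_def .
qed

lemma graph_dist_le: "(u, v) \<in> adj_in E {..<n} ^^ j \<Longrightarrow> graph_dist u v \<le> j"
  unfolding graph_dist_def by (rule Least_le)

lemma graph_dist_edge: "u < n \<Longrightarrow> {x, y} \<in> E \<Longrightarrow> graph_dist u y \<le> Suc (graph_dist u x)"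
  using graph_dist_relpow[of u x] edgeD[of x y]
  by (intro graph_dist_le) (auto simp: adj_in_iff)

definition gball :: "nat \<Rightarrow> nat \<Rightarrow> nat set" where
  "gball u i = {y. y < n \<and> graph_dist u y \<le> i}"

lemma finite_gball [simp]: "finite (gball u i)" by (simp add: gball_def)

text \<open>Apply \<open>poincare\<close> to the ramp that is 0 on the inner ball and 1 outside the
  outer ball. Its energy is at most \<open>\<Delta> / g^2\<close> per vertex of the outer ball. Its
  variance is at least half the size of the inner ball, because at least as many vertices lie
  outside the outer ball as inside the inner one.\<close>

lemma ball_doubling:
  defines "\<gamma> \<equiv> 1 - lambda_max n E"
  assumes \<gamma>: "0 < \<gamma>" "4 * real \<Delta> \<le> \<gamma> * (real g)\<^sup>2" and g: "0 < g" and u: "u < n"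
    and half: "2 * card (gball u (i + g)) \<le> n"
  shows "2 * card (gball u i) \<le> card (gball u (i + g))"
proof -
  define f where "f y = real (min g (graph_dist u y - i)) / real g" for y
  let ?B = "gball u (i + g)"
  let ?s = "real (card (gball u i))" and ?b = "real (card ?B)"
  define a where "a = (\<Sum>x<n. deg x * f x) / total_degree"
  have sub: "gball u i \<subseteq> ?B" by (auto simp: gball_def)
  have diff: "(f x - f y)\<^sup>2 \<le> (if x \<in> ?B then 1 / (real g)\<^sup>2 else 0) + (if y \<in> ?B then 1 / (real g)\<^sup>2 else 0)"
    if xy: "y \<in> neighbours E x" for x y
  proof -
    have E: "{x, y} \<in> E" "{y, x} \<in> E" "x < n" "y < n"
      using xy edgeD by (auto simp: neighbours_iff insert_commute)
    show ?thesis
    proof (cases "x \<in> ?B \<or> y \<in> ?B")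
      case True
      have "\<bar>real (min g (graph_dist u x - i)) - real (min g (graph_dist u y - i))\<bar> \<le> 1"
        using graph_dist_edge[OF u E(1)] graph_dist_edge[OF u E(2)] by (auto simp: min_def)
      then have "\<bar>real (min g (graph_dist u x - i)) - real (min g (graph_dist u y - i))\<bar> / real g \<le> 1 / real g"
        by (rule divide_right_mono) simp
      moreover have "f x - f y = (real (min g (graph_dist u x - i)) - real (min g (graph_dist u y - i))) / real g"
        unfolding f_def by (rule diff_divide_distrib[symmetric])
      ultimately have "\<bar>f x - f y\<bar> \<le> \<bar>1 / real g\<bar>" by (simp add: abs_divide)
      then have "(f x - f y)\<^sup>2 \<le> (1 / real g)\<^sup>2" by (simp only: abs_le_square_iff)
      then have "(f x - f y)\<^sup>2 \<le> 1 / (real g)\<^sup>2" by (simp add: power_divide)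
      also have "1 / (real g)\<^sup>2 \<le> (if x \<in> ?B then 1 / (real g)\<^sup>2 else 0) + (if y \<in> ?B then 1 / (real g)\<^sup>2 else 0)"
        using True by auto
      finally show ?thesis .
    next
      case False
      then have "f x = f y" using E by (auto simp: gball_def f_def min_def)
      then show ?thesis by simp
    qed
  qed
  have "2 * energy f \<le> (\<Sum>x<n. \<Sum>y\<in>neighbours E x. (if x \<in> ?B then 1 / (real g)\<^sup>2 else 0) + (if y \<in> ?B then 1 / (real g)\<^sup>2 else 0))"
    unfolding energy_def using diff by (simp add: sum_mono)
  also have "\<dots> = 2 * (\<Sum>x<n. \<Sum>y\<in>neighbours E x. (if x \<in> ?B then 1 / (real g)\<^sup>2 else 0))"
    using sum_neighbours_swap[of "\<lambda>x y. if x \<in> ?B then 1 / (real g)\<^sup>2 else 0"] by (simp add: sum.distrib)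
  also have "(\<Sum>x<n. \<Sum>y\<in>neighbours E x. (if x \<in> ?B then 1 / (real g)\<^sup>2 else 0))
      \<le> (\<Sum>x<n. if x \<in> ?B then real \<Delta> / (real g)\<^sup>2 else 0)"
    using deg_le by (intro sum_mono) (auto simp: card_neighbours divide_right_mono)
  also have "\<dots> = ?b * (real \<Delta> / (real g)\<^sup>2)"
  proof -
    have "{..<n} \<inter> ?B = ?B" by (auto simp: gball_def)
    then show ?thesis by (simp add: sum.inter_restrict[symmetric])
  qed
  finally have en: "energy f \<le> ?b * (real \<Delta> / (real g)\<^sup>2)" by simp
  have f0: "f y = 0" if "y \<in> gball u i" for y using that by (simp add: f_def gball_def)
  have f1: "f y = 1" if "y \<in> {..<n} - ?B" for y
    using that g by (auto simp: f_def gball_def min_def)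
  have "?s * a\<^sup>2 + ?s * (1 - a)\<^sup>2 \<le> ?s * a\<^sup>2 + real (card ({..<n} - ?B)) * (1 - a)\<^sup>2"
  proof -
    have "?B \<subseteq> {..<n}" by (auto simp: gball_def)
    then have "card ({..<n} - ?B) = n - card ?B" by (simp add: card_Diff_subset)
    then have "card (gball u i) \<le> card ({..<n} - ?B)" using half card_mono[OF _ sub] by simp
    then show ?thesis by (intro add_left_mono mult_right_mono) auto
  qed
  also have "\<dots> = (\<Sum>y\<in>gball u i \<union> ({..<n} - ?B). (f y - a)\<^sup>2)"
    using sub f0 f1 by (subst sum.union_disjoint) auto
  also have "\<dots> \<le> wnorm (\<lambda>y. f y - a)"
    by (intro sum_sq_le_wnorm) (auto simp: gball_def)
  finally have "?s * (a\<^sup>2 + (1 - a)\<^sup>2) \<le> wnorm (\<lambda>y. f y - a)" by (simp add: algebra_simps)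
  moreover have "?s * (1 / 2) \<le> ?s * (a\<^sup>2 + (1 - a)\<^sup>2)"
  proof (rule mult_left_mono)
    have "0 \<le> (2 * a - 1)\<^sup>2" by simp
    then show "1 / 2 \<le> a\<^sup>2 + (1 - a)\<^sup>2" by (simp add: power2_eq_square algebra_simps)
  qed simp
  ultimately have "?s * (1 / 2) \<le> wnorm (\<lambda>y. f y - a)" by linarith
  then have "\<gamma> * (?s * (1 / 2)) \<le> \<gamma> * wnorm (\<lambda>y. f y - a)" using \<gamma>(1) by (intro mult_left_mono) auto
  also have "\<dots> \<le> energy f" using poincare[of f] by (simp add: \<gamma>_def a_def)
  finally have "\<gamma> * ?s \<le> 2 * (?b * (real \<Delta> / (real g)\<^sup>2))" using en by simp
  then have "\<gamma> * (real g)\<^sup>2 * ?s \<le> 2 * ?b * real \<Delta>" using g by (simp add: field_simps)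
  moreover have "4 * real \<Delta> * ?s \<le> \<gamma> * (real g)\<^sup>2 * ?s" using \<gamma>(2) by (intro mult_right_mono) auto
  ultimately have "4 * real \<Delta> * ?s \<le> 2 * ?b * real \<Delta>" by (rule order_trans[rotated])
  then have "real \<Delta> * (2 * ?s) \<le> real \<Delta> * ?b" by (simp add: mult_ac)
  then have "2 * ?s \<le> ?b" using Delta_ge2 by (subst (asm) mult_le_cancel_left_pos) auto
  then show ?thesis by linarith
qed

text \<open>Doubling along the radii 0, \<open>g\<close>, ..., \<open>J * g\<close> takes every ball
  beyond \<open>n / 2\<close> vertices, so the balls around \<open>u\<close> and \<open>v\<close>
  meet.\<close>

lemma diameter_bound:
  defines "\<gamma> \<equiv> 1 - lambda_max n E"
  assumes \<gamma>: "0 < \<gamma>" "4 * real \<Delta> \<le> \<gamma> * (real g)\<^sup>2" and g: "0 < g" and J: "n < 2 ^ Suc J"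
    and u: "u < n" "v < n"
  shows "\<exists>k \<le> 2 * (J * g). (u, v) \<in> adj_in E {..<n} ^^ k"
proof -
  have large: "n < 2 * card (gball w (J * g))" if w: "w < n" for w
  proof (rule ccontr)
    assume *: "\<not> ?thesis"
    have "2 ^ j \<le> card (gball w (j * g))" if "j \<le> J" for j
      using that
    proof (induction j)
      case 0
      have "w \<in> gball w 0" using w graph_dist_le[of w w 0] by (simp add: gball_def)
      then show ?case using card_gt_0_iff[of "gball w 0"] by (simp add: Suc_le_eq) blast
    next
      case (Suc j)
      have "gball w (j * g + g) \<subseteq> gball w (J * g)"
        using Suc.prems mult_le_mono1[of "Suc j" J g] by (auto simp: gball_def)
      then have "card (gball w (j * g + g)) \<le> card (gball w (J * g))" by (intro card_mono) simp_all
      then have "2 * card (gball w (j * g + g)) \<le> n" using * by linarith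
      then have "2 * card (gball w (j * g)) \<le> card (gball w (j * g + g))"
        using ball_doubling[of g w "j * g"] \<gamma> g w by (simp add: \<gamma>_def)
      then show ?case using Suc by (simp add: add.commute)
    qed
    from this[of J] * J show False by simp
  qed
  have "gball u (J * g) \<inter> gball v (J * g) \<noteq> {}"
  proof
    assume "gball u (J * g) \<inter> gball v (J * g) = {}"
    then have "card (gball u (J * g)) + card (gball v (J * g)) = card (gball u (J * g) \<union> gball v (J * g))"
      by (simp add: card_Un_disjoint)
    also have "\<dots> \<le> card {..<n}" by (intro card_mono) (auto simp: gball_def)
    finally show False using large[OF u(1)] large[OF u(2)] by simp
  qed
  then obtain w where w: "w < n" "graph_dist u w \<le> J * g" "graph_dist v w \<le> J * g"
    by (auto simp: gball_def)
  have "(u, v) \<in> adj_in E {..<n} ^^ (graph_dist u w + graph_dist v w)"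
    using relpow_trans[OF graph_dist_relpow[OF u(1) w(1)] relpow_sym[OF sym_adj_in graph_dist_relpow[OF u(2) w(1)]]] .
  then show ?thesis using w by (intro exI[of _ "graph_dist u w + graph_dist v w"]) auto
qed

text \<open>Goodness is applied to the vertex 0 with the whole vertex set as \<open>U\<close>: every
  other vertex is close to a neighbour of 0 by \<open>diameter_bound\<close>, and
  \<open>class_parity\<close> holds with all edges of the graph.\<close>

lemma good_graph_bound:
  defines "\<gamma> \<equiv> 1 - lambda_max n E"
  assumes \<gamma>: "0 < \<gamma>" "4 * real \<Delta> \<le> \<gamma> * (real g)\<^sup>2" and g: "0 < g" and J: "n < 2 ^ Suc J"
    and good: "good_graph n E l"
  shows "l \<le> 4 * \<Delta>\<^sup>2 * (2 * (J * g) + 1)"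
proof (rule good_vertex_bound[where z = 0 and U = "{..<n}"])
  have z: "0 < n" using n2 by simp
  show "good_vertex n E l 0" using good z by (simp add: good_graph_def)
  show "neighbours E 0 \<subseteq> {..<n} - {0}" using edgeD[of 0 0] edgeD by (auto simp: neighbours_iff)
  show "\<exists>c\<in>neighbours E 0. \<exists>j\<le>2 * (J * g). (y, c) \<in> adj_in E ({..<n} - {0}) ^^ j"
    if y: "y \<in> {..<n} - {0}" for y
  proof -
    obtain k where k: "k \<le> 2 * (J * g)" "(y, 0) \<in> adj_in E {..<n} ^^ k"
      using diameter_bound[OF _ _ g J, of y 0] \<gamma> y z by (auto simp: \<gamma>_def)
    then obtain c i where "c \<in> neighbours E 0" "i < k" "(y, c) \<in> adj_in E ({..<n} - {0}) ^^ i"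
      using step_avoiding[OF k(2)] y by auto
    moreover then have "i \<le> 2 * (J * g)" using k(1) by simp
    ultimately show ?thesis by blast
  qed
  show "even (card {b \<in> neighbours E 0. (a, b) \<in> (adj_in E ({..<n} - {0}))\<^sup>*})" if a: "a \<in> neighbours E 0" for a
  proof -
    let ?C = "(adj_in E ({..<n} - {0}))\<^sup>* `` {a}"
    have aU: "a \<in> {..<n} - {0}" using a edgeD[of 0 a] by (auto simp: neighbours_iff)
    have C: "?C \<subseteq> {..<n} - {0}"
    proof
      fix b assume "b \<in> ?C"
      then have "(a, b) \<in> (adj_in E ({..<n} - {0}))\<^sup>*" by simp
      then show "b \<in> {..<n} - {0}" by (rule adj_in_rtrancl_mem) (rule aU)
    qed
    have "even (card {b \<in> ?C. {0, b} \<in> E})"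
    proof (rule class_parity[OF order_refl])
      show "finite ?C" using C finite_subset by (metis finite_Diff finite_lessThan)
      show "0 \<notin> ?C" using C by blast
      show "even (vertex_degree E w)" if "w \<in> ?C" for w using that C even_deg by blast
      show "y \<in> ?C \<or> y = 0" if xy: "x \<in> ?C" "{x, y} \<in> E" for x y
      proof (rule disjCI)
        assume "y \<noteq> 0"
        moreover have "x \<in> {..<n} - {0}" using xy C by blast
        ultimately have "(x, y) \<in> adj_in E ({..<n} - {0})" using xy edgeD by (auto simp: adj_in_iff)
        then show "y \<in> ?C" using xy(1) by (auto intro: rtrancl_into_rtrancl)
      qed
    qed
    moreover have "{b \<in> ?C. {0, b} \<in> E} = {b \<in> neighbours E 0. (a, b) \<in> (adj_in E ({..<n} - {0}))\<^sup>*}"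
      by (auto simp: neighbours_iff)
    ultimately show ?thesis by simp
  qed
qed (use n2 in auto)

section \<open>Survival probabilities of the killed walk\<close>

text \<open>The probability that the simple random walk from \<open>x\<close> has its first \<open>j\<close> positions outside \<open>S\<close>.\<close>

primrec survival :: "nat set \<Rightarrow> nat \<Rightarrow> nat \<Rightarrow> real" where
  "survival S 0 x = 1"
| "survival S (Suc j) x = (if x \<in> S then 0 else (\<Sum>y\<in>neighbours E x. survival S j y) / deg x)"

lemma survival_nonneg: "0 \<le> survival S j x"
  by (induction j arbitrary: x) (auto intro!: sum_nonneg divide_nonneg_nonneg)

text \<open>By nonnegativity of the kernel the upper bound on its quadratic form is also a bound on its norm.\<close>

lemma survival_le:
  assumes \<theta>: "0 < \<theta>" and dir: "\<And>f. (\<And>u. u \<in> S \<Longrightarrow> f u = 0) \<Longrightarrow> (1 - \<theta>) * wnorm f \<le> energy f"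
    and x: "x < n"
  shows "survival S (Suc j) x \<le> sqrt total_degree * \<theta> ^ j"
proof -
  have up: "adjform f f \<le> \<theta> * wnorm f" if "\<And>u. u \<in> S \<Longrightarrow> f u = 0" for f
    using dir[of f] that by (simp add: energy_conv algebra_simps)
  have low: "- adjform f f \<le> \<theta> * wnorm f" if f: "\<And>u. u \<in> S \<Longrightarrow> f u = 0" for f
  proof -
    have "- adjform f f = (\<Sum>x<n. \<Sum>y\<in>neighbours E x. - (f x * f y))"
      by (simp add: adjform_def sum_negf)
    also have "\<dots> \<le> adjform (\<lambda>x. \<bar>f x\<bar>) (\<lambda>x. \<bar>f x\<bar>)"
      unfolding adjform_def by (intro sum_mono) (metis abs_ge_minus_self abs_mult)
    also have "\<dots> \<le> \<theta> * wnorm (\<lambda>x. \<bar>f x\<bar>)" using f by (intro up) simp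
    also have "wnorm (\<lambda>x. \<bar>f x\<bar>) = wnorm f" by (simp add: wnorm_def)
    finally show ?thesis .
  qed
  \<comment> \<open>Polarisation: four times \<open>adjform f g\<close> is the form at
    \<open>f + g\<close> minus the form at \<open>f - g\<close>, bounded by \<open>up\<close> and
    \<open>low\<close> respectively.\<close>
  have polar: "adjform f g \<le> \<theta> / 2 * (wnorm f + wnorm g)"
    if fg: "\<And>u. u \<in> S \<Longrightarrow> f u = 0" "\<And>u. u \<in> S \<Longrightarrow> g u = 0" for f g
  proof -
    have "adjform (\<lambda>x. f x + 1 * g x) (\<lambda>x. f x + 1 * g x) \<le> \<theta> * wnorm (\<lambda>x. f x + 1 * g x)"
      using fg by (intro up) simp
    moreover have "- adjform (\<lambda>x. f x + (-1) * g x) (\<lambda>x. f x + (-1) * g x) \<le> \<theta> * wnorm (\<lambda>x. f x + (-1) * g x)"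
      using fg by (intro low) simp
    ultimately show ?thesis
      unfolding adjform_add_scale wnorm_add_scale by (simp add: algebra_simps)
  qed
  \<comment> \<open>The shift is there because \<open>survival S 0\<close> is 1 even on
    \<open>S\<close>, whereas \<open>polar\<close> applies to functions vanishing on
    \<open>S\<close>.\<close>
  define w where "w j = survival S (Suc j)" for j
  have w0: "u \<in> S \<Longrightarrow> w j u = 0" for u j by (simp add: w_def)
  have step: "wnorm (w (Suc j)) \<le> \<theta>\<^sup>2 * wnorm (w j)" for j
  proof -
    have "wnorm (w (Suc j)) = adjform (w (Suc j)) (w j)"
      unfolding adjform_conv wnorm_def
    proof (rule sum.cong[OF refl])
      fix x assume "x \<in> {..<n}"
      then have "1 \<le> deg x" using deg_ge1 by simp
      then show "deg x * (w (Suc j) x)\<^sup>2 = w (Suc j) x * (\<Sum>y\<in>neighbours E x. w j y)"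
        by (simp add: w_def power2_eq_square)
    qed
    \<comment> \<open>Rescaling by \<theta> lets the arithmetic mean in \<open>polar\<close> act
      like Cauchy-Schwarz: half of \<open>wnorm (w (Suc j))\<close> is absorbed on the left and the
      factor \<open>\<theta>\<^sup>2\<close> remains.\<close>
    also have "\<dots> = \<theta> * adjform (\<lambda>x. w (Suc j) x / \<theta>) (w j)"
      using \<theta> by (simp add: adjform_def sum_distrib_left)
    also have "\<dots> \<le> \<theta> * (\<theta> / 2 * (wnorm (\<lambda>x. w (Suc j) x / \<theta>) + wnorm (w j)))"
      using \<theta> w0 by (intro mult_left_mono polar) auto
    also have "wnorm (\<lambda>x. w (Suc j) x / \<theta>) = wnorm (w (Suc j)) / \<theta>\<^sup>2"
      by (simp add: wnorm_def power_divide sum_divide_distrib)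
    finally show ?thesis using \<theta> by (simp add: field_simps power2_eq_square)
  qed
  have "wnorm (w j) \<le> (\<theta>\<^sup>2) ^ j * total_degree" for j
  proof (induction j)
    case 0
    have "deg x * (w 0 x)\<^sup>2 \<le> deg x" for x
      by (simp add: w_def card_neighbours)
    then show ?case by (simp add: wnorm_def total_degree_def sum_mono)
  next
    case (Suc j)
    have "wnorm (w (Suc j)) \<le> \<theta>\<^sup>2 * ((\<theta>\<^sup>2) ^ j * total_degree)"
      using step[of j] Suc by (meson mult_left_mono order_trans zero_le_power2)
    then show ?case by (simp add: mult.assoc)
  qed
  moreover have "(w j x)\<^sup>2 \<le> wnorm (w j)" using sum_sq_le_wnorm[of "{x}" "w j"] x by simp
  ultimately have "(w j x)\<^sup>2 \<le> (\<theta>\<^sup>2) ^ j * total_degree" by (rule order_trans[rotated])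
  also have "\<dots> = (sqrt total_degree * \<theta> ^ j)\<^sup>2"
    using total_degree_pos by (simp add: power_mult_distrib power_mult[symmetric] mult.commute)
  finally have "(w j x)\<^sup>2 \<le> (sqrt total_degree * \<theta> ^ j)\<^sup>2" .
  moreover have "0 \<le> sqrt total_degree * \<theta> ^ j"
    using \<theta> total_degree_pos by (intro mult_nonneg_nonneg) simp_all
  ultimately show ?thesis unfolding w_def by (rule power2_le_imp_le)
qed

section \<open>Counting induced paths\<close>

definition paths :: "nat \<Rightarrow> nat \<Rightarrow> nat list set" where
  "paths v k = {p. induced_path p \<and> length p = Suc k \<and> hd p = v}"

definition branching :: "nat list \<Rightarrow> nat" where
  "branching p = card {u \<in> set p. 4 \<le> vertex_degree E u}"

lemma finite_paths [simp]: "finite (paths v k)"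
proof (rule finite_subset)
  show "paths v k \<subseteq> {p. set p \<subseteq> {..<n} \<and> length p = Suc k}"
    by (auto simp: paths_def induced_path_def)
  show "finite {p. set p \<subseteq> {..<n} \<and> length p = Suc k}" by (rule finite_lists_length_eq) simp
qed

text \<open>Chords to earlier vertices are allowed here, so this over-counts the induced extensions,
  as is fine for an upper bound.\<close>

definition extensions :: "nat list \<Rightarrow> nat set" where
  "extensions p = {y \<in> neighbours E (last p). y \<notin> set p}"

lemma butlast_induced:
  assumes "p \<in> paths v (Suc k)"
  shows "butlast p \<in> paths v k" "last p \<in> extensions (butlast p)"
proof -
  have p: "induced_path p" "length p = Suc (Suc k)" "hd p = v" using assms by (auto simp: paths_def)
  then obtain q y where q: "p = q @ [y]" "length q = Suc k" by (cases p rule: rev_cases) auto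
  have "induced_path q"
    unfolding induced_path_def
  proof (intro conjI allI impI)
    show "q \<noteq> []" using q by auto
    show "distinct q" "set q \<subseteq> {..<n}" using p(1) q by (auto simp: induced_path_def)
    fix i j assume ij: "i < j \<and> j < length q"
    then have "{p ! i, p ! j} \<in> E \<longleftrightarrow> j = Suc i" using p(1,2) q by (auto simp: induced_path_def)
    then show "{q ! i, q ! j} \<in> E \<longleftrightarrow> j = Suc i" using ij q by (simp add: nth_append)
  qed
  moreover have "hd q = v" using p(3) q by (cases q) auto
  ultimately show "butlast p \<in> paths v k" using q by (simp add: paths_def)
  have "{p ! k, p ! Suc k} \<in> E" using induced_path_edge[OF p(1), of k] p(2) by simp
  moreover have "p ! k = last q" "p ! Suc k = y"
    using q last_conv_nth[of q] by (cases "q = []"; simp add: nth_append)+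
  moreover have "y \<notin> set q" using p(1) q by (auto simp: induced_path_def)
  ultimately show "last p \<in> extensions (butlast p)" using q by (simp add: extensions_def neighbours_iff)
qed

lemma branching_snoc:
  "distinct (q @ [y]) \<Longrightarrow> branching (q @ [y]) = branching q + (if 4 \<le> vertex_degree E y then 1 else 0)"
proof -
  assume d: "distinct (q @ [y])"
  have "{u \<in> set (q @ [y]). 4 \<le> vertex_degree E u}
      = (if 4 \<le> vertex_degree E y then insert y {u \<in> set q. 4 \<le> vertex_degree E u} else {u \<in> set q. 4 \<le> vertex_degree E u})"
    by auto
  then show ?thesis using d by (simp add: branching_def)
qed

text \<open>A branching vertex has at most \<Delta> extensions, paid for by its factor 1 / \<Delta>.
  A vertex of degree 2 has no such factor, but one of its two neighbours is the preceding vertex.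
  The start of the path has no predecessor, hence the 2.\<close>

lemma extensions_weight:
  assumes "p \<in> paths v k"
  shows "real (card (extensions p)) * (1 / real \<Delta>) ^ branching p
     \<le> (if k = 0 then 2 else 1) * (1 / real \<Delta>) ^ branching (butlast p)"
proof -
  have p: "induced_path p" "length p = Suc k" "p \<noteq> []" using assms by (auto simp: paths_def)
  then have pb: "p = butlast p @ [last p]" by simp
  let ?y = "last p"
  have "set p \<subseteq> {..<n}" using p(1) by (simp add: induced_path_def)
  then have y: "?y < n" using last_in_set[OF p(3)] by blast
  have d: "distinct (butlast p @ [?y])" using p pb by (simp add: induced_path_def)
  have br: "branching p = branching (butlast p) + (if 4 \<le> vertex_degree E ?y then 1 else 0)"
    using branching_snoc[OF d] pb by simp
  have sub: "extensions p \<subseteq> neighbours E ?y" by (auto simp: extensions_def)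
  have c: "card (extensions p) \<le> vertex_degree E ?y"
    using card_mono[OF _ sub] by (simp add: card_neighbours)
  show ?thesis
  proof (cases "4 \<le> vertex_degree E ?y")
    case True
    have "real (card (extensions p)) \<le> real \<Delta>" using c deg_le[OF y] by simp
    then have "real (card (extensions p)) * (1 / real \<Delta>) \<le> 1" using Delta_ge2 by simp
    then have "real (card (extensions p)) * (1 / real \<Delta>) * (1 / real \<Delta>) ^ branching (butlast p)
        \<le> 1 * (1 / real \<Delta>) ^ branching (butlast p)" by (intro mult_right_mono) auto
    also have "\<dots> \<le> (if k = 0 then 2 else 1) * (1 / real \<Delta>) ^ branching (butlast p)"
      by (intro mult_right_mono) auto
    finally show ?thesis using True by (simp add: br mult_ac)
  next
    case False
    then have deg2: "vertex_degree E ?y = 2"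
      using degree_ge2[OF y] even_deg[OF y] by presburger
    have "card (extensions p) \<le> (if k = 0 then 2 else 1)"
    proof (cases "k = 0")
      case False
      then obtain j where j: "k = Suc j" by (cases k) auto
      have "{p ! j, p ! Suc j} \<in> E" using induced_path_edge[OF p(1), of j] p(2) j by simp
      then have "p ! j \<in> neighbours E ?y"
        using p j by (simp add: last_conv_nth neighbours_iff insert_commute)
      moreover have "p ! j \<notin> extensions p" using p j by (simp add: extensions_def)
      ultimately have "extensions p \<subset> neighbours E ?y" using sub by blast
      then have "card (extensions p) < 2" using psubset_card_mono[of "neighbours E ?y"] deg2 by (simp add: card_neighbours)
      then show ?thesis using False by simp
    qed (use c deg2 in simp)
    then have "real (card (extensions p)) \<le> (if k = 0 then 2 else 1)" by (auto split: if_splits)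
    then show ?thesis using False br by (intro mult_mono) auto
  qed
qed

text \<open>The last vertex is left out of the weight, so that its factor is available when the path
  is extended. By \<open>extensions_weight\<close> the sum can then grow only in the very first
  step.\<close>

lemma sum_paths_le: "(\<Sum>p\<in>paths v k. (1 / real \<Delta>) ^ branching (butlast p)) \<le> (if k = 0 then 1 else 2)"
proof (induction k)
  case 0
  have "paths v 0 \<subseteq> {[v]}" by (auto simp: paths_def length_Suc_conv)
  then have "(\<Sum>p\<in>paths v 0. (1 / real \<Delta>) ^ branching (butlast p)) \<le> (\<Sum>p\<in>{[v]}. (1 / real \<Delta>) ^ branching (butlast p))"
    by (intro sum_mono2) auto
  then show ?case by (simp add: branching_def)
next
  case (Suc k)
  let ?w = "\<lambda>p. (1 / real \<Delta>) ^ branching p"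
  have "(\<Sum>p\<in>paths v (Suc k). ?w (butlast p))
      = (\<Sum>(q, y)\<in>(\<lambda>p. (butlast p, last p)) ` paths v (Suc k). ?w q)"
  proof (subst sum.reindex)
    show "inj_on (\<lambda>p. (butlast p, last p)) (paths v (Suc k))"
    proof (rule inj_onI)
      fix p q assume "p \<in> paths v (Suc k)" "q \<in> paths v (Suc k)" "(butlast p, last p) = (butlast q, last q)"
      moreover from this have "p \<noteq> []" "q \<noteq> []" by (auto simp: paths_def)
      ultimately show "p = q" by (metis append_butlast_last_id prod.inject)
    qed
  qed simp
  also have "\<dots> \<le> (\<Sum>(q, y)\<in>Sigma (paths v k) extensions. ?w q)"
  proof (rule sum_mono2)
    show "finite (Sigma (paths v k) extensions)" by (auto simp: extensions_def)
    show "(\<lambda>p. (butlast p, last p)) ` paths v (Suc k) \<subseteq> Sigma (paths v k) extensions"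
      using butlast_induced by auto
  qed auto
  also have "\<dots> = (\<Sum>q\<in>paths v k. \<Sum>y\<in>extensions q. ?w q)"
    by (rule sum.Sigma[symmetric]) (auto simp: extensions_def)
  also have "\<dots> = (\<Sum>q\<in>paths v k. real (card (extensions q)) * ?w q)" by simp
  also have "\<dots> \<le> (\<Sum>q\<in>paths v k. (if k = 0 then 2 else 1) * ?w (butlast q))"
    by (intro sum_mono extensions_weight)
  also have "\<dots> = (if k = 0 then 2 else 1) * (\<Sum>q\<in>paths v k. ?w (butlast q))"
    by (rule sum_distrib_left[symmetric])
  also have "\<dots> \<le> 2" using Suc.IH by (auto split: if_splits)
  finally show ?case by simp
qed

text \<open>In particular at most \<open>2 * \<Delta> ^ b\<close> paths have \<open>b\<close>
  branching vertices; the weighted form goes directly into the union bound.\<close>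

lemma sum_branching_le: "(\<Sum>p\<in>paths v k. (1 / real \<Delta>) ^ branching p) \<le> 2"
proof -
  have "(\<Sum>p\<in>paths v k. (1 / real \<Delta>) ^ branching p) \<le> (\<Sum>p\<in>paths v k. (1 / real \<Delta>) ^ branching (butlast p))"
  proof (rule sum_mono)
    fix p assume "p \<in> paths v k"
    have "branching (butlast p) \<le> branching p"
      unfolding branching_def by (intro card_mono) (auto dest: in_set_butlastD)
    then show "(1 / real \<Delta>) ^ branching p \<le> (1 / real \<Delta>) ^ branching (butlast p)"
      using Delta_ge2 by (intro power_decreasing) auto
  qed
  also have "\<dots> \<le> 2" using sum_paths_le[of v k] by (auto split: if_splits)
  finally show ?thesis .
qed

text \<open>Without chords a vertex of \<open>p\<close> has at most two neighbours on
  \<open>p\<close>, so one of degree at least 4 has a neighbour in the boundary. Each boundary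
  vertex serves at most \<Delta> vertices of \<open>p\<close>.\<close>

lemma branching_le_boundary:
  assumes p: "induced_path p"
  shows "branching p \<le> \<Delta> * card (path_boundary p)"
proof -
  let ?Z = "path_boundary p"
  have Zn: "?Z \<subseteq> {..<n}" using edgeD by (auto simp: path_boundary_def)
  then have finZ: "finite ?Z" using finite_subset by blast
  have "{u \<in> set p. 4 \<le> vertex_degree E u} \<subseteq> (\<Union>z\<in>?Z. neighbours E z)"
  proof
    fix u assume u: "u \<in> {u \<in> set p. 4 \<le> vertex_degree E u}"
    then obtain i where i: "i < length p" "u = p ! i" by (auto simp: in_set_conv_nth)
    \<comment> \<open>At the ends of \<open>p\<close> one of the two list entries is spurious, which
      only enlarges the set.\<close>
    have "neighbours E u \<inter> set p \<subseteq> {p ! (i - 1), p ! Suc i}"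
    proof
      fix w assume w: "w \<in> neighbours E u \<inter> set p"
      then obtain j where j: "j < length p" "w = p ! j" by (auto simp: in_set_conv_nth)
      have e: "{p ! i, p ! j} \<in> E" "{p ! j, p ! i} \<in> E" using w i j by (auto simp: neighbours_iff insert_commute)
      have "j \<noteq> i" using e(1) edgeD by blast
      then have "j = Suc i \<or> i = Suc j"
        using p e i(1) j(1) unfolding induced_path_def by (metis linorder_neqE_nat)
      then show "w \<in> {p ! (i - 1), p ! Suc i}" using j by auto
    qed
    then have "card (neighbours E u \<inter> set p) \<le> card {p ! (i - 1), p ! Suc i}" by (intro card_mono) auto
    also have "\<dots> \<le> 2" by (simp add: card_insert_if)
    finally have "neighbours E u \<inter> set p \<noteq> neighbours E u" using u by (auto simp: card_neighbours)
    then obtain z where z: "z \<in> neighbours E u" "z \<notin> set p" by blast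
    then have "z \<in> ?Z" using u by (auto simp: path_boundary_def neighbours_iff)
    moreover have "u \<in> neighbours E z" using z neighbours_sym by blast
    ultimately show "u \<in> (\<Union>z\<in>?Z. neighbours E z)" by blast
  qed
  then have "branching p \<le> card (\<Union>z\<in>?Z. neighbours E z)"
    unfolding branching_def using finZ by (intro card_mono) auto
  also have "\<dots> \<le> (\<Sum>z\<in>?Z. card (neighbours E z))" by (rule card_UN_le[OF finZ])
  also have "\<dots> \<le> (\<Sum>z\<in>?Z. \<Delta>)" using Zn deg_le by (intro sum_mono) (auto simp: card_neighbours)
  finally show ?thesis by (simp add: mult.commute)
qed

end

section \<open>The E-process\<close>

locale eprocess_rule =
  fixes E :: "nat set set" and A :: "nat list \<Rightarrow> nat pmf"
begin

definition next_pmf :: "nat \<Rightarrow> nat list \<Rightarrow> nat pmf" where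
  "next_pmf v h = (if h = [] then return_pmf v else eprocess_step E A h)"

text \<open>The distribution of the first \<open>k\<close> positions. Every event used below depends
  on finitely many positions, so discrete distributions suffice.\<close>

primrec law :: "nat \<Rightarrow> nat \<Rightarrow> nat list pmf" where
  "law v 0 = return_pmf []"
| "law v (Suc k) = bind_pmf (law v k) (\<lambda>h. map_pmf (\<lambda>y. h @ [y]) (next_pmf v h))"

lemma measurable_map_upt:
  assumes "{0..<t} \<subseteq> I"
  shows "(\<lambda>\<omega>. map \<omega> [0..<t]) \<in> measurable (PiM I (\<lambda>_. count_space (UNIV :: nat set))) (count_space UNIV)"
  using assms
proof (induction t)
  case (Suc t)
  have [measurable]: "(\<lambda>\<omega>. map \<omega> [0..<t]) \<in> measurable (PiM I (\<lambda>_. count_space (UNIV :: nat set))) (count_space UNIV)"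
    using Suc.prems by (intro Suc.IH) auto
  have [measurable]: "(\<lambda>\<omega>. \<omega> t) \<in> measurable (PiM I (\<lambda>_. count_space (UNIV :: nat set))) (count_space UNIV)"
    using Suc.prems by (intro measurable_component_singleton) auto
  have "(\<lambda>\<omega>. map \<omega> [0..<t] @ [\<omega> t]) \<in> measurable (PiM I (\<lambda>_. count_space (UNIV :: nat set))) (count_space UNIV)"
    by measurable
  then show ?case by simp
qed simp

text \<open>The measure \<open>C 0 k\<close> composes the first \<open>k\<close> kernels, which is
  the recursion of \<open>law\<close>.\<close>

lemma nn_integral_C_law:
  fixes f :: "nat list \<Rightarrow> ennreal"
  shows "(\<integral>\<^sup>+\<omega>. f (map \<omega> [0..<k])
      \<partial>Ionescu_Tulcea.C (eprocess_kernel E A v) (\<lambda>_. count_space UNIV) 0 k (\<lambda>_. undefined))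
    = (\<integral>\<^sup>+h. f h \<partial>law v k)"
proof -
  let ?M = "\<lambda>_ :: nat. count_space (UNIV :: nat set)"
  interpret IT: Ionescu_Tulcea "eprocess_kernel E A v" ?M
    by (rule Ionescu_Tulcea_eprocess)
  let ?u = "\<lambda>_ :: nat. undefined :: nat"
  have u: "?u \<in> space (PiM {0..<0} ?M)" by (simp add: space_PiM)
  show ?thesis
  proof (induction k arbitrary: f)
    case 0
    have "(\<lambda>\<omega>. f (map \<omega> [0..<0])) \<in> borel_measurable (PiM {0..<0} ?M)" by simp
    then show ?case using u by (simp add: nn_integral_return)
  next
    case (Suc k)
    have meas: "(\<lambda>\<omega>. f (map \<omega> [0..<Suc k])) \<in> borel_measurable (PiM {0..<Suc k} ?M)"
      using measurable_compose[OF measurable_map_upt[OF order_refl] borel_measurable_count_space] .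
    have setsC: "sets (IT.C 0 k ?u) = sets (PiM {0..<k} ?M)" using IT.sets_C[OF u, of k] by simp
    have eP: "IT.eP k \<in> measurable (IT.C 0 k ?u) (subprob_algebra (PiM {0..<Suc k} ?M))"
      using IT.measurable_eP[of k] measurable_cong_sets[OF setsC refl] by blast
    have "(\<integral>\<^sup>+\<omega>. f (map \<omega> [0..<Suc k]) \<partial>IT.C 0 (Suc k) ?u)
        = (\<integral>\<^sup>+\<omega>. (\<integral>\<^sup>+\<omega>'. f (map \<omega>' [0..<Suc k]) \<partial>IT.eP k \<omega>) \<partial>IT.C 0 k ?u)"
      using nn_integral_bind[OF meas eP] by simp
    also have "\<dots> = (\<integral>\<^sup>+\<omega>. (\<lambda>h. \<integral>\<^sup>+x. f (h @ [x]) \<partial>next_pmf v h) (map \<omega> [0..<k]) \<partial>IT.C 0 k ?u)"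
    proof (rule nn_integral_cong)
      fix \<omega> assume "\<omega> \<in> space (IT.C 0 k ?u)"
      then have \<omega>: "\<omega> \<in> space (PiM {0..<k} ?M)" using sets_eq_imp_space_eq[OF setsC] by simp
      have "(\<integral>\<^sup>+\<omega>'. f (map \<omega>' [0..<Suc k]) \<partial>IT.eP k \<omega>)
          = (\<integral>\<^sup>+x. f (map (fun_upd \<omega> k x) [0..<Suc k]) \<partial>eprocess_kernel E A v k \<omega>)"
        by (rule IT.nn_integral_eP[OF \<omega> meas])
      also have "eprocess_kernel E A v k \<omega> = measure_pmf (next_pmf v (map \<omega> [0..<k]))"
        by (simp add: eprocess_kernel_def next_pmf_def)
      also have "(\<integral>\<^sup>+x. f (map (fun_upd \<omega> k x) [0..<Suc k]) \<partial>next_pmf v (map \<omega> [0..<k]))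
          = (\<integral>\<^sup>+x. f (map \<omega> [0..<k] @ [x]) \<partial>next_pmf v (map \<omega> [0..<k]))"
      proof -
        have "map (fun_upd \<omega> k x) [0..<Suc k] = map \<omega> [0..<k] @ [x]" for x by simp
        then show ?thesis by (simp only:)
      qed
      finally show "(\<integral>\<^sup>+\<omega>'. f (map \<omega>' [0..<Suc k]) \<partial>IT.eP k \<omega>)
          = (\<lambda>h. \<integral>\<^sup>+x. f (h @ [x]) \<partial>next_pmf v h) (map \<omega> [0..<k])" .
    qed
    also have "\<dots> = (\<integral>\<^sup>+h. (\<integral>\<^sup>+x. f (h @ [x]) \<partial>next_pmf v h) \<partial>law v k)"
      by (rule Suc.IH)
    also have "\<dots> = (\<integral>\<^sup>+h. f h \<partial>law v (Suc k))"
      by (simp only: law.simps(2) nn_integral_bind_pmf nn_integral_map_pmf)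
    finally show ?case .
  qed
qed

lemma emeasure_eprocess:
  "{\<omega>. P (map \<omega> [0..<k])} \<in> sets (eprocess E A v)"
  "emeasure (eprocess E A v) {\<omega>. P (map \<omega> [0..<k])} = emeasure (law v k) {h. P h}"
proof -
  let ?M = "\<lambda>_ :: nat. count_space (UNIV :: nat set)"
  interpret IT: Ionescu_Tulcea "eprocess_kernel E A v" ?M
    by (rule Ionescu_Tulcea_eprocess)
  let ?u = "\<lambda>_ :: nat. undefined :: nat"
  define X where "X = (\<lambda>\<omega>. map \<omega> [0..<k]) -` {h. P h} \<inter> space (PiM {0..<k} ?M)"
  have X: "X \<in> sets (PiM {0..<k} ?M)"
    unfolding X_def by (rule measurable_sets[OF measurable_map_upt[OF order_refl]]) simp
  have emb: "IT.PF.emb UNIV {0..<k} X = {\<omega>. P (map \<omega> [0..<k])}"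
  proof -
    have r: "map (restrict \<omega> {0..<k}) [0..<k] = map \<omega> [0..<k]" for \<omega> :: "nat \<Rightarrow> nat" by simp
    show ?thesis unfolding prod_emb_def X_def vimage_Int by (auto simp add: space_PiM r simp del: map_eq_conv)
  qed
  have "IT.PF.emb UNIV {0..<k} X \<in> sets (PiM UNIV ?M)"
    using X by (intro measurable_prod_emb) auto
  then show "{\<omega>. P (map \<omega> [0..<k])} \<in> sets (eprocess E A v)"
    unfolding emb by (simp add: eprocess_def)
  have u: "?u \<in> space (PiM {0..<0} ?M)" by (simp add: space_PiM)
  have setsC: "sets (IT.C 0 k ?u) = sets (PiM {0..<k} ?M)" using IT.sets_C[OF u, of k] by simp
  have "emeasure (eprocess E A v) {\<omega>. P (map \<omega> [0..<k])} = emeasure (IT.CI {0..<k}) X"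
    unfolding eprocess_def emb[symmetric] using X by (intro IT.lim) auto
  also have "\<dots> = emeasure (IT.C 0 k ?u) (IT.PF.emb {0..<k} {0..<k} X)"
    using X by (intro IT.emeasure_CI) auto
  also have "IT.PF.emb {0..<k} {0..<k} X = X"
    using sets.sets_into_space[OF X] by (intro prod_emb_id) (simp add: space_PiM)
  also have "emeasure (IT.C 0 k ?u) X = (\<integral>\<^sup>+\<omega>. indicator X \<omega> \<partial>IT.C 0 k ?u)"
    using X setsC by simp
  also have "\<dots> = (\<integral>\<^sup>+\<omega>. indicator {h. P h} (map \<omega> [0..<k]) \<partial>IT.C 0 k ?u)"
    using sets_eq_imp_space_eq[OF setsC]
    by (intro nn_integral_cong) (simp add: X_def indicator_def)
  also have "\<dots> = emeasure (law v k) {h. P h}" by (subst nn_integral_C_law) simp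
  finally show "emeasure (eprocess E A v) {\<omega>. P (map \<omega> [0..<k])} = emeasure (law v k) {h. P h}" .
qed

text \<open>The tail-sum formula. A trajectory that never covers makes every term 1, so the
  right-hand side is infinite as well.\<close>

lemma cover_step_le_suminf:
  "cover_step n \<omega> \<le> (\<Sum>t. indicator {\<omega>. \<not> {..<n} \<subseteq> \<omega> ` {..t}} \<omega>)"
proof (cases "\<exists>t. {..<n} \<subseteq> \<omega> ` {..t}")
  case True
  define t where "t = (LEAST t. {..<n} \<subseteq> \<omega> ` {..t})"
  have t: "{..<n} \<subseteq> \<omega> ` {..t}" unfolding t_def using True by (rule LeastI_ex)
  have "cover_step n \<omega> \<le> of_nat t" unfolding cover_step_def using t by (intro INF_lower) simp
  also have "\<dots> = (\<Sum>s<t. indicator {\<omega>. \<not> {..<n} \<subseteq> \<omega> ` {..s}} \<omega>)"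
    using not_less_Least[of _ "\<lambda>t. {..<n} \<subseteq> \<omega> ` {..t}"] by (simp add: t_def)
  also have "\<dots> \<le> (\<Sum>t. indicator {\<omega>. \<not> {..<n} \<subseteq> \<omega> ` {..t}} \<omega>)" by (rule sum_le_suminf) auto
  finally show ?thesis .
next
  case False
  have "of_nat N \<le> (\<Sum>t. indicator {\<omega>. \<not> {..<n} \<subseteq> \<omega> ` {..t}} \<omega> :: ennreal)" for N
  proof -
    have "(of_nat N :: ennreal) = (\<Sum>s<N. indicator {\<omega>. \<not> {..<n} \<subseteq> \<omega> ` {..s}} \<omega>)"
      using False by simp
    also have "\<dots> \<le> (\<Sum>t. indicator {\<omega>. \<not> {..<n} \<subseteq> \<omega> ` {..t}} \<omega>)" by (rule sum_le_suminf) auto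
    finally show ?thesis .
  qed
  then have "(\<Sum>t. indicator {\<omega>. \<not> {..<n} \<subseteq> \<omega> ` {..t}} \<omega> :: ennreal) = \<top>"
    by (metis SUP_least ennreal_SUP_of_nat_eq_top top_unique)
  then show ?thesis by simp
qed

lemma expected_cover_time_le:
  "expected_cover_time n E A v \<le> (\<Sum>t. emeasure (law v (Suc t)) {h. \<not> {..<n} \<subseteq> set h})"
proof -
  have *: "{\<omega>. \<not> {..<n} \<subseteq> \<omega> ` {..t}} = {\<omega>. \<not> {..<n} \<subseteq> set (map \<omega> [0..<Suc t])}" for t
    by (simp add: atLeast0LessThan lessThan_Suc_atMost del: upt_Suc)
  have "expected_cover_time n E A v \<le> (\<integral>\<^sup>+\<omega>. (\<Sum>t. indicator {\<omega>. \<not> {..<n} \<subseteq> \<omega> ` {..t}} \<omega>) \<partial>eprocess E A v)"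
    unfolding expected_cover_time_def by (intro nn_integral_mono cover_step_le_suminf)
  also have "\<dots> = (\<Sum>t. \<integral>\<^sup>+\<omega>. indicator {\<omega>. \<not> {..<n} \<subseteq> \<omega> ` {..t}} \<omega> \<partial>eprocess E A v)"
    unfolding * by (intro nn_integral_suminf borel_measurable_indicator emeasure_eprocess(1))
  also have "\<dots> = (\<Sum>t. emeasure (law v (Suc t)) {h. \<not> {..<n} \<subseteq> set h})"
  proof (rule suminf_cong)
    fix t
    show "(\<integral>\<^sup>+\<omega>. indicator {\<omega>. \<not> {..<n} \<subseteq> \<omega> ` {..t}} \<omega> \<partial>eprocess E A v)
        = emeasure (law v (Suc t)) {h. \<not> {..<n} \<subseteq> set h}"
      unfolding *
      using nn_integral_indicator[OF emeasure_eprocess(1)[where P = "\<lambda>h. \<not> {..<n} \<subseteq> set h" and k = "Suc t"]]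
        emeasure_eprocess(2)[where P = "\<lambda>h. \<not> {..<n} \<subseteq> set h" and k = "Suc t"] by simp
  qed
  finally show ?thesis .
qed

end

section \<open>Histories: phases of unvisited edges and red steps\<close>

context even_graph begin

abbreviation exhausted :: "nat list \<Rightarrow> bool" where
  "exhausted h \<equiv> unvisited_neighbours E h = {}"

text \<open>Histories grow at the end, so the recursion runs over the reversed list: in
  \<open>y # r\<close> the history before the step to \<open>y\<close> is \<open>rev r\<close>. A
  red step to \<open>y\<close> opens a new phase anchored at \<open>y\<close>.\<close>

primrec anchor_rev :: "nat list \<Rightarrow> nat" where
  "anchor_rev [] = 0"
| "anchor_rev (y # r) = (if r = [] \<or> exhausted (rev r) then y else anchor_rev r)"

primrec reds_rev :: "nat list \<Rightarrow> nat" where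
  "reds_rev [] = 0"
| "reds_rev (y # r) = (if r \<noteq> [] \<and> exhausted (rev r) then Suc (reds_rev r) else reds_rev r)"

primrec redset_rev :: "nat list \<Rightarrow> nat set" where
  "redset_rev [] = {}"
| "redset_rev (y # r) = (if r \<noteq> [] \<and> exhausted (rev r) then insert (hd r) (redset_rev r) else redset_rev r)"

text \<open>The anchor is the starting point of the current phase of unvisited edges; a red step is a
  uniformly random step, and \<open>redset h\<close> collects the vertices from which red steps were made.\<close>

definition anchor :: "nat list \<Rightarrow> nat" where "anchor h = anchor_rev (rev h)"
definition reds :: "nat list \<Rightarrow> nat" where "reds h = reds_rev (rev h)"
definition redset :: "nat list \<Rightarrow> nat set" where "redset h = redset_rev (rev h)"

lemma singleton_simps [simp]: "anchor [v] = v" "reds [v] = 0" "redset [v] = {}"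
  by (simp_all add: anchor_def reds_def redset_def)

lemma snoc_simps:
  assumes "h \<noteq> []"
  shows "anchor (h @ [y]) = (if exhausted h then y else anchor h)"
    "reds (h @ [y]) = (if exhausted h then Suc (reds h) else reds h)"
    "redset (h @ [y]) = (if exhausted h then insert (last h) (redset h) else redset h)"
  using assms by (simp_all add: anchor_def reds_def redset_def hd_rev)

lemma visited_snoc: "h \<noteq> [] \<Longrightarrow> visited_edges (h @ [y]) = insert {last h, y} (visited_edges h)"
proof -
  assume h: "h \<noteq> []"
  show ?thesis
  proof (intro equalityI subsetI)
    fix e assume "e \<in> visited_edges (h @ [y])"
    then obtain i where i: "Suc i < Suc (length h)" "e = {(h @ [y]) ! i, (h @ [y]) ! Suc i}"
      by (auto simp: visited_edges_def)
    show "e \<in> insert {last h, y} (visited_edges h)"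
    proof (cases "Suc i < length h")
      case True
      then show ?thesis using i(2) by (auto simp: visited_edges_def nth_append)
    next
      case False
      then have "i = length h - 1" "length h - 1 < length h" using i h by (auto simp: less_Suc_eq)
      then show ?thesis using i(2) h by (simp add: nth_append last_conv_nth)
    qed
  next
    fix e assume "e \<in> insert {last h, y} (visited_edges h)"
    then show "e \<in> visited_edges (h @ [y])"
    proof
      assume "e = {last h, y}"
      then show ?thesis unfolding visited_edges_def using h
        by (intro CollectI exI[of _ "length h - 1"]) (auto simp: nth_append last_conv_nth)
    next
      assume "e \<in> visited_edges h"
      then obtain i where i: "Suc i < length h" "e = {h ! i, h ! Suc i}" by (auto simp: visited_edges_def)
      then show ?thesis unfolding visited_edges_def
        by (intro CollectI exI[of _ i]) (auto simp: nth_append)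
    qed
  qed
qed

lemma visited_singleton [simp]: "visited_edges [v] = {}"
  by (simp add: visited_edges_def)

lemma visited_subset_set: "e \<in> visited_edges h \<Longrightarrow> e \<subseteq> set h"
  by (auto simp: visited_edges_def)

text \<open>By \<open>law_history\<close> every history of positive probability is of this kind,
  whatever the rule; deterministic facts about the process are proved by induction over it.\<close>

inductive history :: "nat \<Rightarrow> nat list \<Rightarrow> bool" for v where
  start: "history v [v]"
| blue: "history v h \<Longrightarrow> y \<in> unvisited_neighbours E h \<Longrightarrow> history v (h @ [y])"
| red: "history v h \<Longrightarrow> exhausted h \<Longrightarrow> y \<in> neighbours E (last h) \<Longrightarrow> history v (h @ [y])"

lemma exhausted_incident:
  assumes "exhausted h" shows "incident_edges E (last h) \<subseteq> visited_edges h"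
proof
  fix e assume "e \<in> incident_edges E (last h)"
  then have e: "e \<in> E" "last h \<in> e" by (auto simp: incident_edges_def)
  then obtain u where "e = {last h, u}" using edgeE by metis
  then show "e \<in> visited_edges h" using assms e by (auto simp: unvisited_neighbours_def)
qed

lemma history_basic:
  assumes "history v h" "v < n"
  shows "h \<noteq> [] \<and> set h \<subseteq> {..<n} \<and> visited_edges h \<subseteq> E"
  using assms
proof (induction rule: history.induct)
  case (blue h y)
  then have "{last h, y} \<in> E" by (auto simp: unvisited_neighbours_def)
  then show ?case using blue edgeD[of "last h" y] by (auto simp: visited_snoc)
next
  case (red h y)
  then have "{last h, y} \<in> E" by (simp add: neighbours_iff)
  then show ?case using red edgeD[of "last h" y] by (auto simp: visited_snoc)
qed auto

lemma last_less: "history v h \<Longrightarrow> v < n \<Longrightarrow> last h < n"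
  using history_basic[of v h] last_in_set by blast

text \<open>If the anchor differed from the current vertex, the latter would have odd visited
  degree; but at an exhausted vertex the visited degree is the full, even degree. Parity is a
  premise because the induction for \<open>odd_visited\<close> uses this lemma.\<close>

lemma exhausted_anchor_aux:
  assumes h: "history v h" "v < n" and odd: "odd_vertices (visited_edges h) = sym_diff {anchor h} {last h}"
    and ex: "exhausted h"
  shows "anchor h = last h"
proof (rule ccontr)
  assume "anchor h \<noteq> last h"
  then have "last h \<in> odd_vertices (visited_edges h)" unfolding odd by auto
  moreover have "incident_edges (visited_edges h) (last h) = incident_edges E (last h)"
    using exhausted_incident[OF ex] history_basic[OF h] by (auto simp: incident_edges_def)
  ultimately show False
    using even_deg[OF last_less[OF h]] by (simp add: odd_vertices_def vertex_degree_def)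
qed

text \<open>The edges visited in the current phase form a trail from the anchor to the current vertex,
  and the earlier phases were closed.\<close>

lemma odd_visited:
  assumes "history v h" "v < n"
  shows "odd_vertices (visited_edges h) = sym_diff {anchor h} {last h}"
  using assms
proof (induction rule: history.induct)
  case (blue h y)
  have hb: "h \<noteq> []" "visited_edges h \<subseteq> E" using history_basic[OF blue.hyps(1) blue.prems] by auto
  have y: "{last h, y} \<in> E" "{last h, y} \<notin> visited_edges h"
    using blue.hyps(2) by (auto simp: unvisited_neighbours_def)
  have ne: "last h \<noteq> y" using edgeD y(1) by blast
  have "visited_edges (h @ [y]) = sym_diff (visited_edges h) {{last h, y}}"
    using y(2) hb by (auto simp: visited_snoc)
  also have "odd_vertices \<dots> = sym_diff (sym_diff {anchor h} {last h}) {last h, y}"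
    using finite_subset[OF hb(2) finite_E] blue.IH[OF blue.prems] odd_vertices_edge[OF ne]
    by (subst odd_vertices_sym_diff) auto
  also have "\<dots> = sym_diff {anchor h} {y}" using ne by auto
  also have "anchor h = anchor (h @ [y])" using hb blue.hyps(2) by (auto simp: snoc_simps)
  finally show ?case by simp
next
  case (red h y)
  have hb: "h \<noteq> []" "visited_edges h \<subseteq> E" using history_basic[OF red.hyps(1) red.prems] by auto
  have "{last h, y} \<in> visited_edges h"
    using exhausted_incident[OF red.hyps(2)] red.hyps(3) by (auto simp: incident_edges_def neighbours_iff)
  then have "visited_edges (h @ [y]) = visited_edges h" using hb by (auto simp: visited_snoc)
  moreover have "anchor h = last h"
    using exhausted_anchor_aux[OF red.hyps(1) red.prems red.IH[OF red.prems] red.hyps(2)] .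
  moreover have "anchor (h @ [y]) = y" using red.hyps(2) hb by (simp add: snoc_simps)
  ultimately show ?case using red.IH[OF red.prems] by simp
qed simp

lemma exhausted_anchor: "history v h \<Longrightarrow> v < n \<Longrightarrow> exhausted h \<Longrightarrow> anchor h = last h"
  using exhausted_anchor_aux odd_visited by blast

lemma length_history:
  assumes "history v h" "v < n"
  shows "length h = Suc (reds h + card (visited_edges h))"
  using assms
proof (induction rule: history.induct)
  case (blue h y)
  have hb: "h \<noteq> []" "visited_edges h \<subseteq> E" using history_basic[OF blue.hyps(1) blue.prems] by auto
  have "{last h, y} \<notin> visited_edges h" "\<not> exhausted h"
    using blue.hyps(2) by (auto simp: unvisited_neighbours_def)
  then show ?case using blue hb finite_subset[OF hb(2) finite_E] by (simp add: visited_snoc snoc_simps)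
next
  case (red h y)
  have hb: "h \<noteq> []" "visited_edges h \<subseteq> E" using history_basic[OF red.hyps(1) red.prems] by auto
  have "{last h, y} \<in> visited_edges h"
    using exhausted_incident[OF red.hyps(2)] red.hyps(3) by (auto simp: incident_edges_def neighbours_iff)
  then show ?case using red hb by (simp add: visited_snoc snoc_simps insert_absorb)
qed simp

lemma redset_incident:
  assumes "history v h" "v < n" "u \<in> redset h"
  shows "incident_edges E u \<subseteq> visited_edges h"
  using assms
proof (induction rule: history.induct)
  case (blue h y)
  have "h \<noteq> []" "\<not> exhausted h" using history_basic[OF blue.hyps(1) blue.prems(1)] blue.hyps(2) by auto
  then show ?case using blue by (auto simp: visited_snoc snoc_simps)
next
  case (red h y)
  have "h \<noteq> []" using history_basic[OF red.hyps(1) red.prems(1)] by auto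
  then show ?case using red exhausted_incident[OF red.hyps(2)] by (auto simp: visited_snoc snoc_simps)
qed simp

text \<open>Blue steps leave \<open>redset\<close> unchanged, so the situation just before the last
  red step decides; \<open>0 < reds h\<close> provides such a step. At that time the visited edges
  form an even graph, hence so do the unvisited ones, and \<open>blue_path\<close> applies. Its
  vertices have unvisited edges, while vertices of \<open>redset\<close> have none.\<close>

lemma unvisited_path:
  assumes "history v h" "v < n" "0 < reds h" "u < n" "u \<notin> set h"
    and good: "good_graph n E l" and m: "4 * \<Delta>\<^sup>2 * m < l"
  shows "\<exists>p\<in>paths u m. redset h \<inter> set p = {}"
  using assms(1-5)
proof (induction rule: history.induct)
  case (blue h y)
  have "h \<noteq> []" "\<not> exhausted h" using history_basic[OF blue.hyps(1)] blue by auto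
  then show ?case using blue by (simp add: snoc_simps)
next
  case (red h y)
  have hb: "h \<noteq> []" "visited_edges h \<subseteq> E" using history_basic[OF red.hyps(1)] red by auto
  define B where "B = E - visited_edges h"
  have fin: "finite (visited_edges h)" using hb finite_E finite_subset by blast
  have "odd_vertices (visited_edges h) = {}"
    using odd_visited[OF red.hyps(1)] exhausted_anchor[OF red.hyps(1) _ red.hyps(2)] red.prems by simp
  moreover have "odd_vertices E = {}"
  proof -
    have "vertex_degree E w = 0" if "\<not> w < n" for w
    proof -
      have "neighbours E w = {}" using that edgeD by (auto simp: neighbours_iff)
      then show ?thesis using card_neighbours[of w] by simp
    qed
    then show ?thesis using even_deg by (auto simp: odd_vertices_def) (metis even_zero)
  qed
  moreover have "B = sym_diff E (visited_edges h)" using hb by (auto simp: B_def)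
  ultimately have "odd_vertices B = {}" using fin finite_E by (simp add: odd_vertices_sym_diff)
  then have Bev: "even (vertex_degree B w)" for w by (auto simp: odd_vertices_def)
  have uh: "u \<notin> set h" using red.prems by simp
  then have star: "incident_edges E u \<subseteq> B"
    using visited_subset_set unfolding B_def incident_edges_def by blast
  have "good_vertex n E l u" using good red.prems by (simp add: good_graph_def)
  then obtain p where p: "length p = Suc m" "hd p = u" "induced_path p" "\<And>w. w \<in> set p \<Longrightarrow> w \<in> \<Union>B"
    using blue_path[OF _ Bev star red.prems(3) _ m] by (auto simp: B_def)
  have "w \<notin> redset (h @ [y])" if "w \<in> set p" for w
  proof
    assume "w \<in> redset (h @ [y])"
    then have "incident_edges E w \<subseteq> visited_edges h"
      using exhausted_incident[OF red.hyps(2)] redset_incident[OF red.hyps(1) red.prems(1)] hb red.hyps(2)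
      by (auto simp: snoc_simps)
    then show False using p(4)[OF that] by (auto simp: B_def incident_edges_def)
  qed
  then show ?case using p by (auto simp: paths_def)
qed simp

end

section \<open>The red walk under an arbitrary rule\<close>

locale eprocess_graph = even_graph + eprocess_rule +
  assumes valid: "valid_rule E A"
begin

lemma neighbours_nonempty: "x < n \<Longrightarrow> neighbours E x \<noteq> {}"
  using degree_ge2[of x] card_neighbours[of x] by auto

lemma step_blue: "h \<noteq> [] \<Longrightarrow> \<not> exhausted h \<Longrightarrow> next_pmf v h = A h \<and> set_pmf (A h) \<subseteq> unvisited_neighbours E h"
  using valid by (auto simp: next_pmf_def eprocess_step_def valid_rule_def)

lemma step_red: "h \<noteq> [] \<Longrightarrow> last h < n \<Longrightarrow> exhausted h \<Longrightarrow> next_pmf v h = pmf_of_set (neighbours E (last h))"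
  using neighbours_nonempty by (auto simp: next_pmf_def eprocess_step_def)

lemma law_history:
  assumes "v < n" "h \<in> set_pmf (law v (Suc k))"
  shows "history v h \<and> length h = Suc k"
  using assms(2)
proof (induction k arbitrary: h)
  case 0
  then show ?case by (simp add: next_pmf_def history.start)
next
  case (Suc k)
  then obtain g y where g: "g \<in> set_pmf (law v (Suc k))" "y \<in> set_pmf (next_pmf v g)" "h = g @ [y]"
    by (auto simp del: law.simps(2) simp: law.simps(2)[of v "Suc k"])
  have hg: "history v g" "length g = Suc k" using Suc.IH[OF g(1)] by auto
  have ne: "g \<noteq> []" using hg(2) by auto
  show ?case
  proof (cases "exhausted g")
    case True
    have "y \<in> neighbours E (last g)"
      using g(2) step_red[OF ne last_less[OF hg(1) assms(1)] True]
        neighbours_nonempty[OF last_less[OF hg(1) assms(1)]] by simp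
    then show ?thesis using history.red[OF hg(1) True] hg(2) g(3) by simp
  next
    case False
    then have "y \<in> unvisited_neighbours E g" using g(2) step_blue[OF ne False] by auto
    then show ?thesis using history.blue[OF hg(1)] hg(2) g(3) by simp
  qed
qed

text \<open>The survival probability of the red walk given the history: the next red step will start
  from the anchor. Truncated subtraction makes the value 1 once \<open>T\<close> red steps have been
  made and \<open>redset\<close> still misses \<open>S\<close>.\<close>

definition potential :: "nat set \<Rightarrow> nat \<Rightarrow> nat list \<Rightarrow> real" where
  "potential S T h = (if redset h \<inter> S = {} then survival S (T - reds h) (anchor h) else 0)"

text \<open>A supermartingale for every rule. Blue steps change none of \<open>redset\<close>,
  \<open>reds\<close> and \<open>anchor\<close>. A red step starts from the anchor by
  \<open>exhausted_anchor\<close>, so the average over the neighbours is the recursion of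
  \<open>survival\<close>; after \<open>T\<close> red steps the value can only stay or drop to
  0.\<close>

lemma potential_step:
  assumes h: "history v h" and v: "v < n"
  shows "(\<integral>\<^sup>+y. ennreal (potential S T (h @ [y])) \<partial>next_pmf v h) \<le> ennreal (potential S T h)"
proof -
  have ne: "h \<noteq> []" using history_basic[OF h v] by auto
  show ?thesis
  proof (cases "exhausted h")
    case False
    have "(\<integral>\<^sup>+y. ennreal (potential S T (h @ [y])) \<partial>next_pmf v h) = (\<integral>\<^sup>+y. ennreal (potential S T h) \<partial>next_pmf v h)"
      using False ne by (simp add: potential_def snoc_simps)
    then show ?thesis by (simp add: measure_pmf.emeasure_space_1)
  next
    case True
    let ?x = "last h" and ?N = "neighbours E (last h)" and ?j = "T - Suc (reds h)"
    have x: "?x < n" using last_less[OF h v] .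
    have anc: "anchor h = ?x" using exhausted_anchor[OF h v True] .
    \<comment> \<open>The vertex \<open>v\<close> in \<open>redset (h @ [v])\<close> is a dummy:
      after a red step \<open>redset\<close> depends only on where the step started.\<close>
    show ?thesis
    proof (cases "redset (h @ [v]) \<inter> S = {}")
      case dead: False
      then have "potential S T (h @ [y]) = 0" for y using True ne by (auto simp: potential_def snoc_simps)
      then show ?thesis by simp
    next
      case alive: True
      then have al: "redset h \<inter> S = {}" "?x \<notin> S" using True ne by (auto simp: snoc_simps)
      have pot: "potential S T (h @ [y]) = survival S ?j y" for y
        using alive True ne by (auto simp: potential_def snoc_simps)
      have "(\<integral>\<^sup>+y. ennreal (potential S T (h @ [y])) \<partial>next_pmf v h) = (\<Sum>y\<in>?N. ennreal (survival S ?j y)) / real (card ?N)"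
        unfolding pot step_red[OF ne x True] using neighbours_nonempty[OF x]
        by (subst nn_integral_pmf_of_set) (simp_all add: ennreal_of_nat_eq_real_of_nat)
      also have "\<dots> = ennreal ((\<Sum>y\<in>?N. survival S ?j y) / deg ?x)"
        using survival_nonneg deg_ge1[OF x]
        by (simp add: card_neighbours sum_nonneg divide_ennreal ennreal_of_nat_eq_real_of_nat)
      also have "\<dots> \<le> ennreal (potential S T h)"
      proof (rule ennreal_leI)
        show "(\<Sum>y\<in>?N. survival S ?j y) / deg ?x \<le> potential S T h"
        proof (cases "reds h < T")
          case True
          then have "T - reds h = Suc ?j" by simp
          then show ?thesis using al anc by (simp add: potential_def)
        next
          case False
          then have "potential S T h = 1" "?j = 0" using al by (simp_all add: potential_def)
          then show ?thesis using deg_ge1[OF x] by (simp add: card_neighbours)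
        qed
      qed
      finally show ?thesis .
    qed
  qed
qed

lemma potential_law:
  assumes v: "v < n"
  shows "(\<integral>\<^sup>+h. ennreal (potential S T h) \<partial>law v (Suc k)) \<le> ennreal (survival S T v)"
proof (induction k)
  case 0
  then show ?case by (simp add: next_pmf_def potential_def)
next
  case (Suc k)
  have "(\<integral>\<^sup>+h. ennreal (potential S T h) \<partial>law v (Suc (Suc k)))
      = (\<integral>\<^sup>+h. (\<integral>\<^sup>+y. ennreal (potential S T (h @ [y])) \<partial>next_pmf v h) \<partial>law v (Suc k))"
    by (subst law.simps(2)) (simp only: nn_integral_bind_pmf nn_integral_map_pmf)
  also have "\<dots> \<le> (\<integral>\<^sup>+h. ennreal (potential S T h) \<partial>law v (Suc k))"
    by (intro nn_integral_mono_AE AE_pmfI potential_step v) (use law_history[OF v] in blast)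
  finally show ?case using Suc by (rule order_trans)
qed

text \<open>On this event the potential equals 1, so its expectation bounds the probability.\<close>

lemma avoid_prob:
  assumes v: "v < n"
  shows "emeasure (law v (Suc k)) {h. T \<le> reds h \<and> redset h \<inter> S = {}} \<le> ennreal (survival S T v)"
proof -
  have "emeasure (law v (Suc k)) {h. T \<le> reds h \<and> redset h \<inter> S = {}}
      = (\<integral>\<^sup>+h. indicator {h. T \<le> reds h \<and> redset h \<inter> S = {}} h \<partial>law v (Suc k))"
    by (rule nn_integral_indicator[symmetric]) simp
  also have "\<dots> \<le> (\<integral>\<^sup>+h. ennreal (potential S T h) \<partial>law v (Suc k))"
    by (intro nn_integral_mono) (auto simp: potential_def indicator_def)
  also have "\<dots> \<le> ennreal (survival S T v)" by (rule potential_law[OF v])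
  finally show ?thesis .
qed

lemma card_E_le: "card E \<le> \<Delta> * n"
proof -
  have "E \<subseteq> (\<Union>v<n. incident_edges E v)"
  proof
    fix e assume e: "e \<in> E"
    then obtain u where "u \<in> e" using card_edge[OF e] by (metis card.empty ex_in_conv zero_neq_numeral)
    then show "e \<in> (\<Union>v<n. incident_edges E v)" using e edgeE[OF e] by (auto simp: incident_edges_def)
  qed
  then have "card E \<le> card (\<Union>v<n. incident_edges E v)"
    using finite_E by (intro card_mono) (auto simp: incident_edges_def)
  also have "\<dots> \<le> (\<Sum>v<n. vertex_degree E v)" unfolding vertex_degree_def by (rule card_UN_le) simp
  also have "\<dots> \<le> (\<Sum>v<n. \<Delta>)" using deg_le by (intro sum_mono) auto
  finally show ?thesis by (simp add: mult.commute)
qed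

text \<open>Of the \<open>k\<close> steps at most \<open>card E\<close>, hence at most
  \<open>\<Delta> * n\<close>, use new edges, so at least \<open>T\<close> are red. The rest is
  \<open>unvisited_path\<close> and a union bound over the unvisited vertex and its path.\<close>

lemma uncovered_prob:
  assumes v: "v < n" and good: "good_graph n E l" and m: "4 * \<Delta>\<^sup>2 * m < l"
    and T: "0 < T" "T + \<Delta> * n \<le> k"
  shows "emeasure (law v (Suc k)) {h. \<not> {..<n} \<subseteq> set h}
     \<le> (\<Sum>u<n. \<Sum>p\<in>paths u m. ennreal (survival (set p) T v))"
proof -
  let ?M = "measure_pmf (law v (Suc k))"
  let ?Av = "\<lambda>p. {h. T \<le> reds h \<and> redset h \<inter> set p = {}}"
  have "emeasure ?M {h. \<not> {..<n} \<subseteq> set h} \<le> emeasure ?M (\<Union>u<n. \<Union>p\<in>paths u m. ?Av p)"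
  proof (rule emeasure_mono_AE)
    show "AE h in ?M. h \<in> {h. \<not> {..<n} \<subseteq> set h} \<longrightarrow> h \<in> (\<Union>u<n. \<Union>p\<in>paths u m. ?Av p)"
    proof (rule AE_pmfI, rule impI)
      fix h assume hs: "h \<in> set_pmf (law v (Suc k))" and "h \<in> {h. \<not> {..<n} \<subseteq> set h}"
      then obtain u where u: "u < n" "u \<notin> set h" by auto
      have h: "history v h" "length h = Suc k" using law_history[OF v hs] by auto
      have "card (visited_edges h) \<le> card E"
        using history_basic[OF h(1) v] finite_E by (intro card_mono) auto
      then have red: "T \<le> reds h" using length_history[OF h(1) v] h(2) T(2) card_E_le by simp
      then obtain p where "p \<in> paths u m" "redset h \<inter> set p = {}"
        using unvisited_path[OF h(1) v _ u good m] T(1) by auto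
      then show "h \<in> (\<Union>u<n. \<Union>p\<in>paths u m. ?Av p)" using u(1) red by blast
    qed
  qed simp
  also have "\<dots> \<le> (\<Sum>u<n. emeasure ?M (\<Union>p\<in>paths u m. ?Av p))"
    by (rule emeasure_subadditive_finite) auto
  also have "\<dots> \<le> (\<Sum>u<n. \<Sum>p\<in>paths u m. emeasure ?M (?Av p))"
    by (intro sum_mono emeasure_subadditive_finite) auto
  also have "\<dots> \<le> (\<Sum>u<n. \<Sum>p\<in>paths u m. ennreal (survival (set p) T v))"
    by (intro sum_mono avoid_prob v)
  finally show ?thesis .
qed

end

section \<open>The cover time bound\<close>

lemma suminf_geometric_tail:
  fixes f :: "nat \<Rightarrow> ennreal"
  assumes "\<And>t. f t \<le> 1" "\<And>i. f (N + i) \<le> ennreal (c * r ^ i)" "0 \<le> c" "0 \<le> r" "r < 1"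
  shows "(\<Sum>t. f t) \<le> ennreal (real N + c / (1 - r))"
proof -
  define g where "g t = (if t < N then 1 else c * r ^ (t - N))" for t
  have g0: "0 \<le> g t" for t using assms by (simp add: g_def)
  have "(\<lambda>i. c * r ^ i) sums (c * (1 / (1 - r)))"
    using assms by (intro sums_mult geometric_sums) simp
  then have "(\<lambda>i. g (i + N)) sums (c / (1 - r))" by (simp add: g_def)
  then have "g sums (c / (1 - r) + (\<Sum>i<N. g i))" by (simp only: sums_iff_shift)
  moreover have "(\<Sum>i<N. g i) = real N" by (simp add: g_def)
  ultimately have g: "g sums (real N + c / (1 - r))" by (simp add: add.commute)
  have "f t \<le> ennreal (g t)" for t
    using assms(1)[of t] assms(2)[of "t - N"] by (cases "t < N") (simp_all add: g_def)
  then have "(\<Sum>t. f t) \<le> (\<Sum>t. ennreal (g t))" by (intro suminf_le) auto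
  also have "\<dots> = ennreal (real N + c / (1 - r))" using g0 g by (rule suminf_ennreal_eq)
  finally show ?thesis .
qed

context even_graph begin

lemma n3: "3 \<le> n"
proof -
  have n0: "0 < n" using n2 by simp
  have "neighbours E 0 \<subseteq> {..<n} - {0}" using edgeD[of 0 0] neighbours_subset[of 0] by (auto simp: neighbours_iff)
  then have "card (neighbours E 0) \<le> card ({..<n} - {0})" by (intro card_mono) auto
  then show ?thesis using degree_ge2[OF n0] n0 by (simp add: card_neighbours)
qed

lemma ln_ge_one: "1 \<le> ln (real n)"
proof -
  have "exp 1 \<le> real n" using exp_le n3 by (simp add: order_trans)
  then show ?thesis using n2 by (subst ln_ge_iff) auto
qed

text \<open>This is the upper bound on \<open>l\<close> that later keeps the legs of
  \<open>hitting_rate\<close> within order 1 / sqrt \<gamma>. The 36 is 4 from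
  \<open>good_graph_bound\<close> times 9, where 8 comes from rounding \<open>g\<close> and
  \<open>J\<close> and 1 from the additive term.\<close>

lemma good_le_log:
  defines "\<gamma> \<equiv> 1 - lambda_max n E"
  assumes \<gamma>: "0 < \<gamma>" and good: "good_graph n E l"
  shows "real l \<le> 36 * (real \<Delta>)\<^sup>2 * ln (real n) * sqrt (4 * real \<Delta> / \<gamma>)"
proof -
  let ?L = "ln (real n)" and ?s = "sqrt (4 * real \<Delta> / \<gamma>)"
  have \<gamma>1: "\<gamma> \<le> 1" using lambda_max_nonneg by (simp add: \<gamma>_def)
  have D: "2 \<le> real \<Delta>" using Delta_ge2 by simp
  have "1 \<le> 4 * real \<Delta> / \<gamma>" using \<gamma> \<gamma>1 D by (simp add: field_simps)
  then have s1: "1 \<le> ?s" by simp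
  \<comment> \<open>\<open>g\<close> has the least order that \<open>ball_doubling\<close> admits.
    \<open>J\<close> has the least order with \<open>n < 2 ^ Suc J\<close>, as
    \<open>ln 2 > 1 / 2\<close>.\<close>
  define g where "g = nat \<lceil>?s\<rceil>"
  define J where "J = nat \<lfloor>2 * ?L\<rfloor>"
  have g: "?s \<le> real g" "real g \<le> 2 * ?s" "0 < g" using s1 unfolding g_def by linarith+
  have J: "real J \<le> 2 * ?L" "2 * ?L < real J + 1" using ln_ge_one unfolding J_def by linarith+
  have g2: "4 * real \<Delta> \<le> \<gamma> * (real g)\<^sup>2"
  proof -
    have "4 * real \<Delta> = \<gamma> * ?s\<^sup>2" using \<gamma> D by simp
    also have "\<dots> \<le> \<gamma> * (real g)\<^sup>2" using g(1) s1 \<gamma> by (intro mult_left_mono power_mono) auto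
    finally show ?thesis .
  qed
  have "n < 2 ^ Suc J"
  proof -
    have "?L < (real J + 1) * ln 2"
    proof -
      have "(real J + 1) * (1 / 2) \<le> (real J + 1) * ln 2"
        using ln2_ge_two_thirds by (intro mult_left_mono) auto
      moreover have "?L < (real J + 1) * (1 / 2)" using J(2) by simp
      ultimately show ?thesis by (rule less_le_trans[rotated])
    qed
    also have "\<dots> = ln (2 ^ Suc J)" by (subst ln_realpow) simp_all
    finally have "real n < 2 ^ Suc J" using n2 by (subst (asm) ln_less_cancel_iff) auto
    then show ?thesis by (simp only: of_nat_less_numeral_power_cancel_iff)
  qed
  then have "l \<le> 4 * \<Delta>\<^sup>2 * (2 * (J * g) + 1)"
    using good_graph_bound[OF _ _ g(3) _ good] \<gamma> g2 by (simp add: \<gamma>_def)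
  then have "real l \<le> real (4 * \<Delta>\<^sup>2 * (2 * (J * g) + 1))" by (rule of_nat_mono)
  also have "\<dots> = 4 * (real \<Delta>)\<^sup>2 * (2 * (real J * real g) + 1)" by (simp add: algebra_simps)
  also have "\<dots> \<le> 4 * (real \<Delta>)\<^sup>2 * (9 * (?L * ?s))"
  proof (rule mult_left_mono)
    have "real J * real g \<le> (2 * ?L) * (2 * ?s)" using J g s1 by (intro mult_mono) auto
    moreover have "1 * 1 \<le> ?L * ?s" using ln_ge_one s1 by (intro mult_mono) auto
    ultimately show "2 * (real J * real g) + 1 \<le> 9 * (?L * ?s)" by simp
  qed simp
  finally show ?thesis by (simp add: mult_ac)
qed

text \<open>\<open>survival_le\<close> is used with \<theta> = exp (- \<rho>) instead of 1 - \<rho>,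
  which is positive for every \<rho>; the loss is covered by 1 - exp (- \<rho>) \<le>
  \<rho>.\<close>

lemma survival_exp:
  assumes dir: "\<And>f :: nat \<Rightarrow> real. (\<And>u. u \<in> S \<Longrightarrow> f u = 0) \<Longrightarrow> \<rho> * wnorm f \<le> energy f" and x: "x < n"
  shows "survival S (Suc j) x \<le> sqrt total_degree * exp (- \<rho> * real j)"
proof -
  have "survival S (Suc j) x \<le> sqrt total_degree * exp (- \<rho>) ^ j"
  proof (rule survival_le[OF exp_gt_zero _ x])
    fix f :: "nat \<Rightarrow> real" assume f: "\<And>u. u \<in> S \<Longrightarrow> f u = 0"
    have "1 - exp (- \<rho>) \<le> \<rho>" using exp_ge_add_one_self[of "- \<rho>"] by simp
    then have "(1 - exp (- \<rho>)) * wnorm f \<le> \<rho> * wnorm f" using wnorm_nonneg by (rule mult_right_mono)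
    also have "\<dots> \<le> energy f" using f by (rule dir)
    finally show "(1 - exp (- \<rho>)) * wnorm f \<le> energy f" .
  qed
  then show ?thesis by (simp add: exp_of_nat_mult[symmetric] mult.commute)
qed

end

text \<open>The summands serve the three estimates of \<open>hitting_rate\<close>: total cost when
  branching vertices are few, the term \<open>8 * ln n\<close> when they are many, and the entropy
  paid by the legs. The factor \<open>48 * d ^ 3\<close> is the denominator of the basic rate, and
  384 is 8 times 48.\<close>

definition cover_const0 :: "real \<Rightarrow> real" where
  "cover_const0 d = 48 * d ^ 3 * (4 + 3 * d) + 384 * d ^ 3 + 128 * d ^ 5 * (3 + 144 * d)"

context even_graph begin

text \<open>The rate at which the red walk hits a path \<open>p\<close> is of order at least \<open>\<gamma> * length p / n\<close>. If \<open>p\<close>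
  has so many branching vertices that the entropy of the choice of \<open>p\<close> exceeds \<open>ln n\<close>, then the legs
  of length \<open>m / ln n\<close> attached to it improve this rate enough to compensate.\<close>

lemma hitting_rate:
  fixes l :: nat
  defines "\<gamma> \<equiv> 1 - lambda_max n E"
  defines "T0 \<equiv> cover_const0 (real \<Delta>) * real n * ln (real n) / (real l * \<gamma>)"
  assumes \<gamma>: "0 < \<gamma>" and good: "good_graph n E l" and l: "0 < l"
    and m: "m = (l - 1) div (16 * \<Delta>\<^sup>2)" and p: "p \<in> paths u m"
  shows "\<exists>\<rho>. \<gamma> * real l / (48 * real \<Delta> ^ 3 * real n) \<le> \<rho> \<and>
     4 * ln (real n) + real (branching p) * ln (real \<Delta>) \<le> \<rho> * T0 \<and>
     (\<forall>f. (\<forall>v\<in>set p. f v = 0) \<longrightarrow> \<rho> * wnorm f \<le> energy f)"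
proof -
  let ?L = "ln (real n)" and ?d = "real \<Delta>" and ?b = "real (branching p)"
  let ?C = "cover_const0 ?d"
  have d2: "2 \<le> ?d" using Delta_ge2 by simp
  have L1: "1 \<le> ?L" by (rule ln_ge_one)
  have n0: "0 < real n" using n2 by simp
  have l0: "0 < real l" using l by simp
  have lnd: "0 \<le> ln ?d" "ln ?d \<le> ?d" using d2 ln_le_minus_one[of ?d] by auto
  have ip: "induced_path p" and len: "length p = Suc m" using p by (auto simp: paths_def)
  have K0: "0 < 16 * \<Delta>\<^sup>2" using Delta_ge2 by simp
  have m1: "16 * \<Delta>\<^sup>2 * m \<le> l - 1" unfolding m by simp
  have "l - 1 < 16 * \<Delta>\<^sup>2 * (m + 1)"
    using dividend_less_times_div[OF K0, of "l - 1"] by (simp add: m)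
  then have "l \<le> 16 * \<Delta>\<^sup>2 * (m + 1)" using l by linarith
  then have "real l \<le> real (16 * \<Delta>\<^sup>2 * (m + 1))" by (rule of_nat_mono)
  then have lm: "real l \<le> 16 * ?d\<^sup>2 * (real m + 1)" by (simp add: algebra_simps)
  have pos: "0 \<le> 48 * ?d ^ 3 * (4 + 3 * ?d)" "0 \<le> 384 * ?d ^ 3" "0 \<le> 128 * ?d ^ 5 * (3 + 144 * ?d)"
    using d2 by auto
  have C: "48 * ?d ^ 3 * (4 + 3 * ?d) \<le> ?C" "384 * ?d ^ 3 \<le> ?C" "128 * ?d ^ 5 * (3 + 144 * ?d) \<le> ?C"
    using pos unfolding cover_const0_def by linarith+
  have C0: "0 \<le> ?C" using C(2) pos(2) by linarith
  have T0: "0 \<le> T0" unfolding T0_def using C0 n0 L1 l0 \<gamma> by simp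
  \<comment> \<open>The basic rate, from \<open>dirichlet_bound\<close> with \<open>c = 0\<close>:
    the 48 is its 3 times the 16 in the choice of \<open>m\<close>, and \<open>d ^ 3\<close> joins
    \<open>d\<^sup>2\<close> from there to \<open>d\<close> from the total degree.\<close>
  define \<rho>1 where "\<rho>1 = \<gamma> * real l / (48 * ?d ^ 3 * real n)"
  have \<rho>1T: "\<rho>1 * T0 = ?C * ?L / (48 * ?d ^ 3)"
    unfolding \<rho>1_def T0_def using \<gamma> l0 n0 d2 by (simp add: field_simps)
  have dir1: "\<rho>1 * wnorm f \<le> energy f" if f: "\<forall>v\<in>set p. f v = 0" for f
  proof -
    have card: "card (set p) = Suc m" using ip len by (simp add: induced_path_def distinct_card)
    have "\<gamma> * real (card (set p)) * wnorm f \<le> total_degree * (3 + 2 * \<gamma> * 0) * energy f"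
      unfolding \<gamma>_def
      by (rule dirichlet_bound) (use \<gamma> ip f in \<open>auto simp: \<gamma>_def induced_path_def\<close>)
    also have "\<dots> \<le> (?d * real n) * 3 * energy f"
      using total_degree_le energy_nonneg by (simp add: mult_right_mono)
    finally have 1: "\<gamma> * (real m + 1) * wnorm f \<le> 3 * ?d * real n * energy f"
      using card by (simp add: mult_ac add.commute)
    have "\<gamma> * real l * wnorm f \<le> \<gamma> * (16 * ?d\<^sup>2 * (real m + 1)) * wnorm f"
      using lm \<gamma> wnorm_nonneg by (intro mult_right_mono mult_left_mono) auto
    also have "\<dots> = 16 * ?d\<^sup>2 * (\<gamma> * (real m + 1) * wnorm f)" by (simp add: mult_ac)
    also have "\<dots> \<le> 16 * ?d\<^sup>2 * (3 * ?d * real n * energy f)" using 1 by (intro mult_left_mono) auto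
    also have "\<dots> = 48 * ?d ^ 3 * real n * energy f" by (simp add: power2_eq_square power3_eq_cube mult_ac)
    finally show ?thesis unfolding \<rho>1_def using d2 n0 by (simp add: field_simps)
  qed
  show ?thesis
  proof (cases "?b \<le> 3 * ?L")
    case True
    have "?b * ln ?d \<le> (3 * ?L) * ?d" using True lnd L1 by (intro mult_mono) auto
    then have "4 * ?L + ?b * ln ?d \<le> ?L * (4 + 3 * ?d)" by (simp add: algebra_simps)
    also have "\<dots> = (48 * ?d ^ 3 * (4 + 3 * ?d)) * ?L / (48 * ?d ^ 3)" using d2 by simp
    also have "\<dots> \<le> ?C * ?L / (48 * ?d ^ 3)"
      using C(1) L1 d2 by (intro divide_right_mono mult_right_mono) auto
    finally show ?thesis using dir1 \<rho>1T by (intro exI[of _ \<rho>1]) (simp add: \<rho>1_def)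
  next
    case False
    have "branching p \<le> card (set p)" unfolding branching_def by (intro card_mono) auto
    also have "\<dots> \<le> length p" by (rule card_length)
    finally have "?b \<le> real m + 1" using len by simp
    \<comment> \<open>The threshold \<open>3 * ?L\<close> is chosen for this: more branching
      vertices force \<open>m\<close> to be at least \<open>2 * ?L\<close>, so the legs have length
      at least 2, as \<open>legs\<close> demands.\<close>
    then have mL: "2 * ?L \<le> real m" using False L1 by linarith
    then have m2: "2 \<le> real m" using L1 by linarith
    define x where "x = nat \<lfloor>real m / ?L\<rfloor>"
    have q2: "2 \<le> real m / ?L" using mL L1 by (simp add: field_simps)
    have xq: "real x \<le> real m / ?L" "real m / ?L < real x + 1" using q2 unfolding x_def by linarith+
    have x2: "2 \<le> x" using q2 unfolding x_def by linarith
    have xL: "real x * ?L \<le> real m" using xq(1) L1 by (simp add: field_simps)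
    have xL': "real m / 2 \<le> real x * ?L"
    proof -
      have "real m < real x * ?L + ?L" using xq(2) L1 by (simp add: field_simps)
      then show ?thesis using mL by linarith
    qed
    have "real x * 1 \<le> real x * ?L" using L1 by (intro mult_left_mono) auto
    then have xm: "x \<le> m" using xL by linarith
    \<comment> \<open>The 16 in the choice of \<open>m\<close> is 4 times 4: since
      \<open>x + m + 1\<close> is at most \<open>4 * m\<close>, the goodness condition of
      \<open>legs\<close> still holds.\<close>
    have legl: "4 * \<Delta>\<^sup>2 * (x + m + 1) < l"
    proof -
      have "x + m + 1 \<le> 4 * m" using xm m2 by linarith
      then have "4 * \<Delta>\<^sup>2 * (x + m + 1) \<le> 4 * \<Delta>\<^sup>2 * (4 * m)" by (rule mult_le_mono2)
      also have "\<dots> \<le> l - 1" using m1 by simp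
      finally show ?thesis using l by simp
    qed
    obtain q where q: "\<And>z. z \<in> path_boundary p \<Longrightarrow> q z 0 \<in> set p"
        "\<And>z i. z \<in> path_boundary p \<Longrightarrow> i < x \<Longrightarrow> {q z i, q z (Suc i)} \<in> E"
        "inj_on (\<lambda>(z, i). q z i) (path_boundary p \<times> {1..x})"
      using legs[OF ip len x2 legl good] by blast
    let ?Z = "path_boundary p"
    let ?Q = "(\<lambda>(z, i). q z i) ` (?Z \<times> {1..x})"
    have finZ: "finite ?Z"
      by (rule finite_subset[of _ "{..<n}"]) (use edgeD in \<open>auto simp: path_boundary_def\<close>)
    have Qn: "?Q \<subseteq> {..<n}"
    proof clarsimp
      fix z i assume "z \<in> ?Z" "Suc 0 \<le> i" "i \<le> x"
      then have "{q z (i - 1), q z i} \<in> E" using q(2)[of z "i - 1"] by simp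
      then show "q z i < n" using edgeD by blast
    qed
    have cardQ: "card ?Q = card ?Z * x" using card_image[OF q(3)] by (simp add: card_cartesian_product)
    \<comment> \<open>By \<open>good_le_log\<close> the path length \<open>m\<close> is at most
      \<open>3 * ?L * ?s\<close>; dividing by \<open>ln n\<close> bounds \<open>x\<close> by
      \<open>3 * ?s\<close>, and squaring gives 9 times 4.\<close>
    have gx: "\<gamma> * (real x)\<^sup>2 \<le> 36 * ?d"
    proof -
      let ?s = "sqrt (4 * ?d / \<gamma>)"
      have "16 * ?d\<^sup>2 * real m \<le> real l"
      proof -
        have "16 * \<Delta>\<^sup>2 * m \<le> l" using m1 by simp
        then have "real (16 * \<Delta>\<^sup>2 * m) \<le> real l" by (rule of_nat_mono)
        then show ?thesis by simp
      qed
      also have "\<dots> \<le> 36 * ?d\<^sup>2 * ?L * ?s" using good_le_log[OF _ good] \<gamma> by (simp add: \<gamma>_def)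
      finally have "16 * ?d\<^sup>2 * real m \<le> 16 * ?d\<^sup>2 * (3 * ?L * ?s)"
        using L1 \<gamma> d2 by (simp add: mult_ac)
      then have "real m \<le> 3 * ?L * ?s" using d2 by (subst (asm) mult_le_cancel_left_pos) auto
      then have "real x * ?L \<le> (3 * ?s) * ?L" using xL by (simp add: mult_ac)
      then have "real x \<le> 3 * ?s" using L1 by (subst (asm) mult_le_cancel_right_pos) auto
      then have "(real x)\<^sup>2 \<le> (3 * ?s)\<^sup>2" by (intro power_mono) auto
      also have "\<dots> = 36 * ?d / \<gamma>" using \<gamma> d2 by (simp add: power_mult_distrib)
      finally show ?thesis using \<gamma> by (simp add: field_simps)
    qed
    \<comment> \<open>With \<open>c = 2 * x^2\<close> from \<open>legs_energy\<close> the bracket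
      \<open>3 + 2 * \<gamma> * c\<close> is at most \<open>3 + 4 * 36 * d\<close>. One factor
      \<open>d\<close> stems from the total degree, the other from
      \<open>branching_le_boundary\<close>.\<close>
    define \<rho>2 where "\<rho>2 = \<gamma> * (?b * real x) / (?d\<^sup>2 * real n * (3 + 144 * ?d))"
    have dir2: "\<rho>2 * wnorm f \<le> energy f" if f: "\<forall>v\<in>set p. f v = 0" for f
    proof -
      have leg: "(\<Sum>u\<in>?Q. (f u)\<^sup>2) \<le> 2 * (real x)\<^sup>2 * energy f"
        using q f finZ by (intro legs_energy) auto
      have "\<gamma> * real (card ?Q) * wnorm f \<le> total_degree * (3 + 2 * \<gamma> * (2 * (real x)\<^sup>2)) * energy f"
        unfolding \<gamma>_def
        by (rule dirichlet_bound) (use \<gamma> Qn leg in \<open>auto simp: \<gamma>_def\<close>)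
      also have "\<dots> \<le> (?d * real n) * (3 + 144 * ?d) * energy f"
        using total_degree_le energy_nonneg gx \<gamma> total_degree_pos
        by (intro mult_right_mono mult_mono) auto
      finally have 1: "\<gamma> * (real (card ?Z) * real x) * wnorm f \<le> ?d * real n * (3 + 144 * ?d) * energy f"
        using cardQ by simp
      have "branching p \<le> \<Delta> * card ?Z" by (rule branching_le_boundary[OF ip])
      then have "real (branching p) \<le> real (\<Delta> * card ?Z)" by (rule of_nat_mono)
      then have bZ: "?b \<le> ?d * real (card ?Z)" by simp
      have "\<gamma> * (?b * real x) * wnorm f \<le> \<gamma> * ((?d * real (card ?Z)) * real x) * wnorm f"
        using bZ \<gamma> wnorm_nonneg by (intro mult_right_mono mult_left_mono) auto
      also have "\<dots> = ?d * (\<gamma> * (real (card ?Z) * real x) * wnorm f)" by (simp add: mult_ac)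
      also have "\<dots> \<le> ?d * (?d * real n * (3 + 144 * ?d) * energy f)" using 1 by (intro mult_left_mono) auto
      also have "\<dots> = (?d\<^sup>2 * real n * (3 + 144 * ?d)) * energy f" by (simp add: power2_eq_square mult_ac)
      finally have "\<gamma> * (?b * real x) * wnorm f \<le> (?d\<^sup>2 * real n * (3 + 144 * ?d)) * energy f" .
      moreover have "0 < ?d\<^sup>2 * real n * (3 + 144 * ?d)" using d2 n0 by (intro mult_pos_pos) auto
      ultimately show ?thesis unfolding \<rho>2_def by (simp add: divide_le_eq mult.commute)
    qed
    have \<rho>2T: "2 * (?b * ln ?d) \<le> \<rho>2 * T0"
    proof -
      define H where "H = 3 + 144 * ?d"
      have H0: "0 < H" using d2 by (simp add: H_def)
      have eq: "\<rho>2 * T0 = ?b * (?C * (real x * ?L)) / (?d\<^sup>2 * H * real l)"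
        unfolding \<rho>2_def T0_def H_def[symmetric] using \<gamma> n0 l0 H0 d2 by (simp add: field_simps)
      have "real l \<le> 16 * ?d\<^sup>2 * (4 * (real x * ?L))"
      proof -
        have "real m + 1 \<le> 4 * (real x * ?L)" using xL' m2 by linarith
        then have "16 * ?d\<^sup>2 * (real m + 1) \<le> 16 * ?d\<^sup>2 * (4 * (real x * ?L))" by (intro mult_left_mono) auto
        then show ?thesis using lm by linarith
      qed
      then have "2 * ?d * (?d\<^sup>2 * H * real l) \<le> 2 * ?d * (?d\<^sup>2 * H * (16 * ?d\<^sup>2 * (4 * (real x * ?L))))"
        using H0 by (intro mult_left_mono) auto
      also have "\<dots> = (128 * ?d ^ 5 * H) * (real x * ?L)"
        by (simp add: power2_eq_square eval_nat_numeral mult_ac)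
      also have "\<dots> \<le> ?C * (real x * ?L)" using C(3) L1 unfolding H_def by (intro mult_right_mono) auto
      finally have "?b * (2 * ?d * (?d\<^sup>2 * H * real l)) \<le> ?b * (?C * (real x * ?L))" by (intro mult_left_mono) auto
      moreover have "0 < ?d\<^sup>2 * H * real l" using H0 l0 d2 by (intro mult_pos_pos) auto
      ultimately have "?b * (2 * ?d) \<le> \<rho>2 * T0" unfolding eq by (simp add: le_divide_eq mult_ac)
      moreover have "2 * (?b * ln ?d) \<le> ?b * (2 * ?d)" using lnd by (simp add: mult_left_mono)
      ultimately show ?thesis by (rule order_trans[rotated])
    qed
    have \<rho>1T': "8 * ?L \<le> \<rho>1 * T0"
    proof -
      have "8 * ?L = 384 * ?d ^ 3 * ?L / (48 * ?d ^ 3)" using d2 by simp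
      also have "\<dots> \<le> ?C * ?L / (48 * ?d ^ 3)"
        using C(2) L1 d2 by (intro divide_right_mono mult_right_mono) auto
      finally show ?thesis by (simp add: \<rho>1T)
    qed
    \<comment> \<open>The maximum dominates the average of the two rates; this is why
      \<open>\<rho>1T'\<close> and \<open>\<rho>2T\<close> were each proved with an extra factor
      2.\<close>
    define \<rho> where "\<rho> = max \<rho>1 \<rho>2"
    have "\<rho>1 * T0 \<le> \<rho> * T0" "\<rho>2 * T0 \<le> \<rho> * T0"
      unfolding \<rho>_def using T0 by (intro mult_right_mono; simp)+
    then have "4 * ?L + ?b * ln ?d \<le> \<rho> * T0" using \<rho>1T' \<rho>2T by linarith
    moreover have "\<rho> * wnorm f \<le> energy f" if "\<forall>v\<in>set p. f v = 0" for f
      using dir1[OF that] dir2[OF that] by (simp add: \<rho>_def max_def)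
    moreover have "\<rho>1 \<le> \<rho>" by (simp add: \<rho>_def)
    ultimately show ?thesis by (intro exI[of _ \<rho>]) (simp add: \<rho>1_def)
  qed
qed

text \<open>Time \<open>T0\<close> earns each path the factor \<open>1 / n ^ 4\<close>, which pays
  for the sum over \<open>u\<close> and for \<open>sqrt total_degree\<close>, and the factor
  \<open>(1 / \<Delta>) ^ branching p\<close>, which is summable by \<open>sum_branching_le\<close>.
  The excess time \<open>i\<close> gives geometric decay at the basic rate.\<close>

lemma sum_survival_le:
  fixes l :: nat
  defines "\<gamma> \<equiv> 1 - lambda_max n E"
  defines "T0 \<equiv> cover_const0 (real \<Delta>) * real n * ln (real n) / (real l * \<gamma>)"
  assumes \<gamma>: "0 < \<gamma>" and good: "good_graph n E l" and l: "0 < l"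
    and m: "m = (l - 1) div (16 * \<Delta>\<^sup>2)" and j: "T0 + real i \<le> real j" and v: "v < n"
  shows "(\<Sum>u<n. \<Sum>p\<in>paths u m. survival (set p) (Suc j) v)
    \<le> 2 * real \<Delta> * exp (- (\<gamma> * real l / (48 * real \<Delta> ^ 3 * real n))) ^ i"
proof -
  let ?L = "ln (real n)" and ?d = "real \<Delta>"
  define r where "r = \<gamma> * real l / (48 * ?d ^ 3 * real n)"
  have n0: "0 < real n" using n2 by simp
  have d2: "2 \<le> ?d" using Delta_ge2 by simp
  have r0: "0 \<le> r" unfolding r_def using \<gamma> by simp
  have one: "survival (set p) (Suc j) v \<le> sqrt total_degree * exp (- r) ^ i * exp (- 4 * ?L) * (1 / ?d) ^ branching p"
    if p: "p \<in> paths u m" for p u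
  proof -
    obtain \<rho> where \<rho>: "r \<le> \<rho>" "4 * ?L + real (branching p) * ln ?d \<le> \<rho> * T0"
      "\<And>f. \<forall>v\<in>set p. f v = 0 \<Longrightarrow> \<rho> * wnorm f \<le> energy f"
      using hitting_rate[OF _ good l m p] \<gamma> unfolding \<gamma>_def T0_def r_def by blast
    have "r * real i \<le> \<rho> * real i" using \<rho>(1) by (intro mult_right_mono) auto
    moreover have "\<rho> * (T0 + real i) \<le> \<rho> * real j" using j \<rho>(1) r0 by (intro mult_left_mono) auto
    ultimately have "- \<rho> * real j \<le> - (r * real i) + (- 4 * ?L) + real (branching p) * (- ln ?d)"
      using \<rho>(2) by (simp add: algebra_simps)
    then have "exp (- \<rho> * real j) \<le> exp (- (r * real i) + (- 4 * ?L) + real (branching p) * (- ln ?d))"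
      by (simp only: exp_le_cancel_iff)
    also have "\<dots> = exp (- r) ^ i * exp (- 4 * ?L) * (1 / ?d) ^ branching p"
    proof -
      have "exp (real (branching p) * (- ln ?d)) = (1 / ?d) ^ branching p"
        using d2 by (simp add: exp_of_nat_mult exp_minus inverse_eq_divide power_one_over)
      moreover have "exp (- (r * real i)) = exp (- r) ^ i"
        by (simp add: exp_of_nat_mult[symmetric] mult.commute)
      ultimately show ?thesis by (simp only: exp_add)
    qed
    finally have "exp (- \<rho> * real j) \<le> exp (- r) ^ i * exp (- 4 * ?L) * (1 / ?d) ^ branching p" .
    then have "sqrt total_degree * exp (- \<rho> * real j) \<le> sqrt total_degree * (exp (- r) ^ i * exp (- 4 * ?L) * (1 / ?d) ^ branching p)"
      using total_degree_pos by (intro mult_left_mono) auto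
    moreover have "survival (set p) (Suc j) v \<le> sqrt total_degree * exp (- \<rho> * real j)"
      using \<rho>(3) v by (intro survival_exp) auto
    ultimately show ?thesis by (simp add: mult.assoc)
  qed
  let ?c = "sqrt total_degree * exp (- r) ^ i * exp (- 4 * ?L)"
  have c0: "0 \<le> ?c" using total_degree_pos by simp
  have "(\<Sum>u<n. \<Sum>p\<in>paths u m. survival (set p) (Suc j) v) \<le> (\<Sum>u<n. \<Sum>p\<in>paths u m. ?c * (1 / ?d) ^ branching p)"
    by (intro sum_mono one)
  also have "\<dots> = (\<Sum>u<n. ?c * (\<Sum>p\<in>paths u m. (1 / ?d) ^ branching p))" by (simp only: sum_distrib_left)
  also have "\<dots> \<le> (\<Sum>u<n. ?c * 2)" using sum_branching_le c0 by (intro sum_mono mult_left_mono)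
  also have "\<dots> = 2 * (real n * sqrt total_degree * exp (- 4 * ?L)) * exp (- r) ^ i" by simp
  also have "\<dots> \<le> 2 * ?d * exp (- r) ^ i"
  proof (intro mult_right_mono mult_left_mono)
    have e: "exp (- 4 * ?L) = 1 / real n ^ 4"
    proof -
      have "exp (- 4 * ?L) = inverse (exp (real 4 * ?L))" by (simp add: exp_minus[symmetric])
      also have "exp (real 4 * ?L) = real n ^ 4" using n0 by (simp only: exp_of_nat_mult exp_ln)
      finally show ?thesis by (simp add: inverse_eq_divide)
    qed
    have t1: "1 \<le> total_degree" using n_le_total_degree n2 by linarith
    then have "sqrt total_degree \<le> sqrt (total_degree * total_degree)" by (intro real_sqrt_le_mono) simp
    then have "sqrt total_degree \<le> ?d * real n" using total_degree_le t1 by simp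
    then have "real n * sqrt total_degree \<le> real n * (?d * real n)" by (intro mult_left_mono) auto
    also have "\<dots> = ?d * (real n ^ 2)" by (simp add: power2_eq_square)
    also have "\<dots> \<le> ?d * real n ^ 4" using n2 by (intro mult_left_mono power_increasing) auto
    finally show "real n * sqrt total_degree * exp (- 4 * ?L) \<le> ?d" unfolding e using n0 by (simp add: divide_le_eq)
  qed auto
  finally show ?thesis by (simp add: r_def)
qed

end

text \<open>\<open>cover_const0\<close> accounts for \<open>T0\<close>, and
  \<open>96 * d ^ 4\<close> is the tail prefactor \<open>2 * d\<close> times
  \<open>48 * d ^ 3\<close> from \<open>1 / r\<close>. The rest collects \<open>\<Delta> * n\<close>
  blue steps, a constant \<open>2 * d\<close> from the tail, and 2 from rounding \<open>T0\<close>
  and from the index shift.\<close>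

definition cover_const :: "real \<Rightarrow> real" where
  "cover_const d = cover_const0 d + 96 * d ^ 4 + 3 * d + 2"

context eprocess_graph begin

lemma expected_cover_time_bound:
  defines "\<gamma> \<equiv> 1 - lambda_max n E"
  assumes \<gamma>: "0 < \<gamma>" and good: "good_graph n E l" and l: "0 < l" and v: "v < n"
  shows "expected_cover_time n E A v
    \<le> ennreal (cover_const (real \<Delta>) * (real n + real n * ln (real n) / (real l * \<gamma>)))"
proof -
  let ?L = "ln (real n)" and ?d = "real \<Delta>"
  define X where "X = real n * ?L / (real l * \<gamma>)"
  define T0 where "T0 = cover_const0 ?d * real n * ?L / (real l * \<gamma>)"
  define r where "r = \<gamma> * real l / (48 * ?d ^ 3 * real n)"
  define J where "J = nat \<lceil>T0\<rceil>"
  \<comment> \<open>\<open>J\<close> red steps reach time \<open>T0\<close>, one more accounts for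
    the index shift in \<open>survival S (Suc j)\<close>, and \<open>\<Delta> * n\<close> leaves
    room for the blue steps.\<close>
  define N where "N = J + 1 + \<Delta> * n"
  define m where "m = (l - 1) div (16 * \<Delta>\<^sup>2)"
  have d2: "2 \<le> ?d" using Delta_ge2 by simp
  have L1: "1 \<le> ?L" by (rule ln_ge_one)
  have n1: "1 \<le> real n" using n2 by simp
  have l0: "0 < real l" using l by simp
  have T0X: "T0 = cover_const0 ?d * X" by (simp add: T0_def X_def)
  have X0: "0 \<le> X" unfolding X_def using L1 l0 \<gamma> by simp
  have c0: "0 \<le> cover_const0 ?d" unfolding cover_const0_def using d2 by simp
  have T00: "0 \<le> T0" unfolding T0X using X0 c0 by simp
  have J: "T0 \<le> real J" "real J \<le> T0 + 1" using T00 unfolding J_def by linarith+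
  have rpos: "0 < r" unfolding r_def using \<gamma> l0 d2 n1 by simp
  have m4: "4 * \<Delta>\<^sup>2 * m < l"
  proof -
    have "4 * \<Delta>\<^sup>2 * m \<le> 16 * \<Delta>\<^sup>2 * m" by simp
    also have "\<dots> \<le> l - 1" unfolding m_def by simp
    finally show ?thesis using l by simp
  qed
  have "expected_cover_time n E A v \<le> (\<Sum>t. emeasure (law v (Suc t)) {h. \<not> {..<n} \<subseteq> set h})"
    by (rule expected_cover_time_le)
  also have "\<dots> \<le> ennreal (real N + 2 * ?d / (1 - exp (- r)))"
  proof (rule suminf_geometric_tail)
    show "emeasure (law v (Suc t)) {h. \<not> {..<n} \<subseteq> set h} \<le> 1" for t
      by (rule measure_pmf.emeasure_le_1)
    fix i
    have j: "T0 + real i \<le> real (J + i)" using J by simp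
    have "emeasure (law v (Suc (N + i))) {h. \<not> {..<n} \<subseteq> set h}
        \<le> (\<Sum>u<n. \<Sum>p\<in>paths u m. ennreal (survival (set p) (Suc (J + i)) v))"
      by (rule uncovered_prob[OF v good m4]) (simp_all add: N_def)
    also have "\<dots> = ennreal (\<Sum>u<n. \<Sum>p\<in>paths u m. survival (set p) (Suc (J + i)) v)"
      using survival_nonneg by (simp add: sum_nonneg del: survival.simps)
    also have "\<dots> \<le> ennreal (2 * ?d * exp (- r) ^ i)"
      using sum_survival_le[OF _ good l m_def _ v, of i "J + i"] \<gamma> j
      by (intro ennreal_leI) (simp add: \<gamma>_def T0_def r_def)
    finally show "emeasure (law v (Suc (N + i))) {h. \<not> {..<n} \<subseteq> set h} \<le> ennreal (2 * ?d * exp (- r) ^ i)" .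
  qed (use rpos in auto)
  also have "\<dots> \<le> ennreal (cover_const ?d * (real n + X))"
  proof (rule ennreal_leI)
    have "1 / (1 - exp (- r)) \<le> 1 + 1 / r"
    proof -
      have "exp (- r) \<le> 1 / (1 + r)"
        using exp_ge_add_one_self[of r] rpos by (simp add: exp_minus inverse_eq_divide frac_le)
      then have "r / (1 + r) \<le> 1 - exp (- r)" using rpos by (simp add: field_simps)
      moreover have "0 < r / (1 + r)" using rpos by simp
      ultimately have "1 / (1 - exp (- r)) \<le> 1 / (r / (1 + r))"
        using rpos by (intro divide_left_mono mult_pos_pos) auto
      also have "\<dots> = 1 + 1 / r" using rpos by (simp add: field_simps)
      finally show ?thesis .
    qed
    moreover have "1 / r \<le> 48 * ?d ^ 3 * X"
    proof -
      have "1 / r = 48 * ?d ^ 3 * (real n * 1 / (real l * \<gamma>))" unfolding r_def using \<gamma> l0 by (simp add: mult_ac)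
      also have "\<dots> \<le> 48 * ?d ^ 3 * X"
        unfolding X_def using L1 l0 \<gamma> by (intro mult_left_mono divide_right_mono) auto
      finally show ?thesis .
    qed
    ultimately have "1 / (1 - exp (- r)) \<le> 1 + 48 * ?d ^ 3 * X" by linarith
    then have "2 * ?d * (1 / (1 - exp (- r))) \<le> 2 * ?d * (1 + 48 * ?d ^ 3 * X)"
      using d2 by (intro mult_left_mono) auto
    also have "\<dots> = 2 * ?d + 96 * ?d ^ 4 * X" by (simp add: algebra_simps eval_nat_numeral)
    finally have tail: "2 * ?d / (1 - exp (- r)) \<le> 2 * ?d + 96 * ?d ^ 4 * X" by simp
    have "real N = real J + 1 + ?d * real n" by (simp add: N_def)
    then have "real N + 2 * ?d / (1 - exp (- r)) \<le> cover_const0 ?d * X + 96 * ?d ^ 4 * X + (2 + 2 * ?d) * 1 + ?d * real n"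
      using J(2) T0X tail by simp
    also have "\<dots> \<le> cover_const0 ?d * X + 96 * ?d ^ 4 * X + (2 + 2 * ?d) * real n + ?d * real n"
    proof -
      have "(2 + 2 * ?d) * 1 \<le> (2 + 2 * ?d) * real n" using n1 d2 by (intro mult_left_mono) auto
      then show ?thesis by linarith
    qed
    also have "\<dots> \<le> cover_const ?d * (real n + X)"
    proof -
      have "0 \<le> (cover_const0 ?d + 96 * ?d ^ 4) * real n"
        using c0 by (intro mult_nonneg_nonneg add_nonneg_nonneg) auto
      moreover have "0 \<le> (3 * ?d + 2) * X" using X0 d2 by simp
      ultimately show ?thesis unfolding cover_const_def by (simp add: algebra_simps)
    qed
    finally show "real N + 2 * ?d / (1 - exp (- r)) \<le> cover_const ?d * (real n + X)" .
  qed
  finally show ?thesis by (simp add: X_def)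
qed

end

lemma (in eprocess_rule) law_start_mem: "h \<in> set_pmf (law v (Suc k)) \<Longrightarrow> v \<in> set h"
proof (induction k arbitrary: h)
  case (Suc k)
  then show ?case by (auto simp: law.simps(2)[of v "Suc k"] simp del: law.simps(2))
qed (simp add: next_pmf_def)

lemma (in eprocess_rule) expected_cover_time_trivial: "expected_cover_time 1 E A 0 = 0"
proof -
  have "emeasure (law 0 (Suc t)) {h. \<not> {..<1} \<subseteq> set h} = 0" for t
  proof -
    have "AE h in law 0 (Suc t). h \<notin> {h. \<not> {..<1} \<subseteq> set h}"
      by (rule AE_pmfI) (drule law_start_mem, auto)
    then show ?thesis by (subst (asm) AE_iff_measurable[OF _ refl]) auto
  qed
  then have "expected_cover_time 1 E A 0 \<le> 0" using expected_cover_time_le[of 1 0] by simp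
  then show ?thesis by simp
qed

theorem theorem1:
  fixes \<Delta> :: nat
  shows "\<exists>C::real. C > 0 \<and>
    (\<forall>(n::nat) (E::nat set set) (l::nat) (A::nat list \<Rightarrow> nat pmf).
       simple_graph n E \<and> connected_graph n E \<and>
       (\<forall>v<n. even (vertex_degree E v)) \<and> (\<forall>v<n. vertex_degree E v \<le> \<Delta>) \<and>
       good_graph n E l \<and> valid_rule E A \<longrightarrow>
       cover_time n E A \<le>
         ennreal C * (ennreal (real n) +
           ennreal (real n * ln (real n)) / ennreal (real l * (1 - lambda_max n E))))"
proof (intro exI[of _ "cover_const (real \<Delta>)"] conjI allI impI)
  show C0: "0 < cover_const (real \<Delta>)"
    unfolding cover_const_def cover_const0_def by (intro add_nonneg_pos add_nonneg_nonneg) auto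
  fix n :: nat and E :: "nat set set" and l :: nat and A :: "nat list \<Rightarrow> nat pmf"
  let ?C = "cover_const (real \<Delta>)" and ?g = "1 - lambda_max n E"
  let ?R = "ennreal ?C * (ennreal (real n) + ennreal (real n * ln (real n)) / ennreal (real l * ?g))"
  assume H: "simple_graph n E \<and> connected_graph n E \<and>
       (\<forall>v<n. even (vertex_degree E v)) \<and> (\<forall>v<n. vertex_degree E v \<le> \<Delta>) \<and>
       good_graph n E l \<and> valid_rule E A"
  then have n0: "0 < n" by (simp add: connected_graph_def)
  have "expected_cover_time n E A v \<le> ?R" if v: "v < n" for v
  proof (cases "n = 1")
    \<comment> \<open>On a single vertex the walk covers at time 0, so the unspecified value of
      \<open>lambda_max\<close> does no harm.\<close>
    case True
    then show ?thesis using eprocess_rule.expected_cover_time_trivial[of E A] v by simp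
  next
    case False
    then have n2: "2 \<le> n" using n0 by simp
    interpret eprocess_graph n E \<Delta> A
      using H n2 by unfold_locales auto
    have pos: "0 < real n * ln (real n)" using n2 by simp
    show ?thesis
    proof (cases "0 < real l * ?g")
      case True
      then have g: "0 < ?g" and l: "0 < l" by (auto simp: zero_less_mult_iff)
      have "expected_cover_time n E A v \<le> ennreal (?C * (real n + real n * ln (real n) / (real l * ?g)))"
        using expected_cover_time_bound[OF g _ l v] H by simp
      also have "\<dots> = ?R"
        using True pos C0 by (simp add: divide_ennreal ennreal_mult'' ennreal_plus[symmetric] del: ennreal_plus)
      finally show ?thesis .
    next
      \<comment> \<open>If \<open>l = 0\<close> or the gap is not positive, the denominator is 0 in
        \<open>ennreal\<close>; the numerator is positive, so the bound is infinite.\<close>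
      case False
      then have "ennreal (real l * ?g) = 0" by (simp add: ennreal_eq_0_iff)
      then have "ennreal (real n * ln (real n)) / ennreal (real l * ?g) = \<top>"
      proof -
        have "ln (real n) \<noteq> 0" "0 < n" using n2 by simp_all
        with \<open>ennreal (real l * ?g) = 0\<close> pos show ?thesis by simp
      qed
      then have "?R = \<top>" using C0 by (simp add: ennreal_mult_top)
      then show ?thesis by simp
    qed
  qed
  moreover have "finite (expected_cover_time n E A ` {..<n})" "expected_cover_time n E A ` {..<n} \<noteq> {}"
    using n0 by auto
  ultimately show "cover_time n E A \<le> ?R" unfolding cover_time_def by (subst Max_le_iff) auto
qed

end
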